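(* Let $n\ge2$, $c\in(0,1)$, and let $$\sigma=\sigma(c,1)=\sqrt c\,(e_{11}+e_{nn})+\sum_{i=2}^{n-1}e_{ii}+\sqrt{1-c}\,(e_{n1}-e_{1n})\in SU(n).$$ Let $K_k=S(U(k)\times U(n-k))\subset SU(n)$ and let $H_{\sigma}=\sigma\,S(U(1)\times U(n-1))\,\sigma^{-1}$ (the stabilizer in $SU(n)$ of the line spanned by ${}^t(\sqrt c,0,\ldots,0,\sqrt{1-c})$). For any $k=1,\ldots,n-1$ we have $$K_k\cap H_\sigma=\left\{\begin{pmatrix}a&0&0&0\\0&B_{11}&0&0\\0&0&B_{22}&0\\0&0&0&a\end{pmatrix}: a^2=\det(B_{11}B_{22})^{-1},\ B_{11}\in U(k-1),\ B_{22}\in U(n-k-1)\right\},$$ where $\det(B_{11}B_{22})$ stands for $\det(B_{11})\det(B_{22})$ (and $a\in U(1)$). Furthermore $K_k/(K_k\cap H_\sigma)$ is Poisson diffeomorphic to $(\mathbb S^{2k-1}\times\mathbb S^{2(n-k)-1})/\mathbb T$ (if $k=1$, to the standard Poisson odd sphere $\mathbb S^{2n-3}$).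
   Context: $e_{ij}$ are the $n\times n$ matrix units. $U(d)$ and $SU(d)$ carry the standard Poisson--Lie structure $\pi(g)=L_gr-R_gr$ (up to a constant factor), where $L_g,R_g$ are left and right translations, $r=\sum_{1\le i<j\le d}X^+_{ij}\wedge X^-_{ij}$, $X^+_{ij}=\sqrt{-1}\,(e_{ij}+e_{ji})$, $X^-_{ij}=e_{ij}-e_{ji}$. $K_k$ (block-diagonal matrices $\mathrm{diag}(A,B)$ of determinant one, $A\in U(k)$, $B\in U(n-k)$) is a Poisson--Lie subgroup of $SU(n)$, and carries the restricted Poisson structure; $H_\sigma$ is a coisotropic subgroup of $SU(n)$, meaning $\pi(h)\in L_h(\mathfrak h_\sigma\wedge\mathfrak{su}(n))$ for all $h\in H_\sigma$ with $\mathfrak h_\sigma$ the Lie algebra of $H_\sigma$, and $K_k\cap H_\sigma$ is coisotropic in $K_k$. Quotients of Poisson--Lie groups by closed coisotropic subgroups carry the Poisson structure projected from the group. The standard Poisson odd sphere $\mathbb S^{2d-1}$ is the quotient of standard $U(d)$ by a Poisson--Lie subgroup $1\times U(d-1)$ or $U(d-1)\times1$; here $\mathbb S^{2k-1}\times\mathbb S^{2(n-k)-1}=U(k)/(1\times U(k-1))\times U(n-k)/(U(n-k-1)\times1)$ with the product Poisson structure, where $U(k)\times U(n-k)$ is embedded block-diagonally in $U(n)$. The circle $\mathbb T=\{\mathrm{diag}(a,I_{k-1},I_{n-k-1},a):a\in U(1)\}$ acts on this product diagonally, by the action induced from right multiplication on $U(k)\times U(n-k)$, and $(\mathbb S^{2k-1}\times\mathbb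 S^{2(n-k)-1})/\mathbb T$ has the quotient Poisson structure. For blocks of size $0$ the corresponding rows and columns are absent. *)

theory Defs
  imports "HOL-Analysis.Analysis"
begin

section \<open>Matrices with rows and columns numbered from 1\<close>

text \<open>
  Square matrices of size \<open>d\<close> are elements of \<open>'d cmat\<close> with
  \<open>'d :: {finite,linorder}\<close> and \<open>CARD('d) = d\<close>; the order serves only to number
  the indices \<open>1, \<dots>, d\<close>.
\<close>

type_synonym 'd cmat = "((complex, 'd) vec, 'd) vec"

definition idx :: "'d::{finite,linorder} \<Rightarrow> nat" where
  "idx i = card {j. j \<le> i}"

definition munit :: "nat \<Rightarrow> nat \<Rightarrow> 'd::{finite,linorder} cmat" where
  "munit p q = (\<chi> i j. if idx i = p \<and> idx j = q then 1 else 0)"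

definition conj_transpose :: "'d::finite cmat \<Rightarrow> 'd cmat" where
  "conj_transpose A = (\<chi> i j. cnj (A $ j $ i))"

definition unitary_group :: "'d::finite cmat set" where
  "unitary_group = {A. A ** conj_transpose A = mat 1 \<and> conj_transpose A ** A = mat 1}"

definition special_unitary_group :: "'d::finite cmat set" where
  "special_unitary_group = {A \<in> unitary_group. det A = 1}"

text \<open>
  For a set \<open>J\<close> of consecutive indices, \<open>block_unitary_group J\<close> is \<open>1 \<times> U(card J) \<times> 1\<close>.
  An element and its \<open>J\<close>-block have the same determinant, and \<open>J = {}\<close> gives the trivial group.
\<close>

definition block_unitary_group :: "nat set \<Rightarrow> 'd::{finite,linorder} cmat set" where
  "block_unitary_group J =
     {A \<in> unitary_group. \<forall>i j. idx i \<notin> J \<or> idx j \<notin> J \<longrightarrow> A $ i $ j = mat 1 $ i $ j}"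

text \<open>\<open>K k\<close> is \<open>S(U(k) \<times> U(n - k))\<close>: a block-diagonal matrix is unitary iff both its blocks are.\<close>

definition K :: "nat \<Rightarrow> 'n::{finite,linorder} cmat set" where
  "K k = {A \<in> special_unitary_group. \<forall>i j. (idx i \<le> k) \<noteq> (idx j \<le> k) \<longrightarrow> A $ i $ j = 0}"

definition sigma :: "real \<Rightarrow> 'n::{finite,linorder} cmat" where
  "sigma c = (let n = CARD('n) in
     sqrt c *\<^sub>R (munit 1 1 + munit n n) + (\<Sum>i = 2..n - 1. munit i i)
     + sqrt (1 - c) *\<^sub>R (munit n 1 - munit 1 n))"

definition H :: "real \<Rightarrow> 'n::{finite,linorder} cmat set" where
  "H c = {sigma c ** g ** matrix_inv (sigma c) | g. g \<in> K 1}"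

definition line_vector :: "real \<Rightarrow> complex^'n::{finite,linorder}" where
  "line_vector c = (\<chi> i. if idx i = 1 then of_real (sqrt c)
                        else if idx i = CARD('n) then of_real (sqrt (1 - c)) else 0)"

text \<open>
  The matrix \<open>diag(a, B\<^sub>1, B\<^sub>2, a)\<close>: rows \<open>2..k\<close> carry the block of \<open>B1\<close>, rows \<open>k+1..n-1\<close>
  that of \<open>B2\<close>.
\<close>

definition four_block_diag ::
    "nat \<Rightarrow> complex \<Rightarrow> 'n::{finite,linorder} cmat \<Rightarrow> 'n cmat \<Rightarrow> 'n cmat" where
  "four_block_diag k a B1 B2 = (\<chi> i j.
     if idx i \<in> {2..k} \<and> idx j \<in> {2..k} then B1 $ i $ j
     else if idx i \<in> {k + 1..CARD('n) - 1} \<and> idx j \<in> {k + 1..CARD('n) - 1} then B2 $ i $ j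
     else if i = j \<and> idx i \<in> {1, CARD('n)} then a
     else 0)"


section \<open>Poisson manifolds\<close>

text \<open>\<open>smooth_on W F\<close> is meant for open \<open>W\<close>.\<close>

primrec Ck_on :: "nat \<Rightarrow> 'a::euclidean_space set \<Rightarrow> ('a \<Rightarrow> real) \<Rightarrow> bool" where
  "Ck_on 0 W F \<longleftrightarrow> continuous_on W F"
| "Ck_on (Suc m) W F \<longleftrightarrow> (\<forall>x\<in>W. F differentiable (at x)) \<and>
     (\<forall>v. Ck_on m W (\<lambda>x. frechet_derivative F (at x) v))"

definition smooth_on :: "'a::euclidean_space set \<Rightarrow> ('a \<Rightarrow> real) \<Rightarrow> bool" where
  "smooth_on W F \<longleftrightarrow> (\<forall>m. Ck_on m W F)"

text \<open>
  All manifolds below are images of a surjective submersion \<open>mproj\<close> defined on an embedded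
  submanifold \<open>mtotal\<close> of a Euclidean space (the identity, for the matrix groups themselves).
  The submersion determines the manifold: the topology is the quotient topology, and a function
  on an open set is smooth iff its pullback is smooth on \<open>mtotal\<close>, i.e. locally the restriction
  of a smooth function on the ambient space. The Poisson structure is the bracket of smooth
  functions; \<open>mbracket M f g p\<close> only depends on \<open>f\<close> and \<open>g\<close> near \<open>p\<close>, so it applies
  to functions defined on open subsets as well.
\<close>

record ('a, 'p) pman =
  mtotal :: "'a set"
  mproj :: "'a \<Rightarrow> 'p"
  mbracket :: "('p \<Rightarrow> real) \<Rightarrow> ('p \<Rightarrow> real) \<Rightarrow> 'p \<Rightarrow> real"

definition mpoints :: "('a, 'p) pman \<Rightarrow> 'p set" where
  "mpoints M = mproj M ` mtotal M"

definition mopen :: "('a::euclidean_space, 'p) pman \<Rightarrow> 'p set \<Rightarrow> bool" where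
  "mopen M U \<longleftrightarrow> U \<subseteq> mpoints M \<and>
     openin (top_of_set (mtotal M)) {x \<in> mtotal M. mproj M x \<in> U}"

definition msmooth :: "('a::euclidean_space, 'p) pman \<Rightarrow> 'p set \<Rightarrow> ('p \<Rightarrow> real) \<Rightarrow> bool" where
  "msmooth M U f \<longleftrightarrow> (\<forall>x \<in> mtotal M. mproj M x \<in> U \<longrightarrow>
     (\<exists>W F. open W \<and> x \<in> W \<and> smooth_on W F \<and> (\<forall>y \<in> W \<inter> mtotal M. F y = f (mproj M y))))"

text \<open>
  A Poisson diffeomorphism is a homeomorphism identifying the smooth functions on open sets
  together with their Poisson brackets.
\<close>

definition poisson_diffeo ::
    "('p \<Rightarrow> 'q) \<Rightarrow> ('a::euclidean_space, 'p) pman \<Rightarrow> ('b::euclidean_space, 'q) pman \<Rightarrow> bool" where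
  "poisson_diffeo \<phi> M N \<longleftrightarrow>
     bij_betw \<phi> (mpoints M) (mpoints N) \<and>
     (\<forall>U \<subseteq> mpoints N. mopen N U \<longleftrightarrow> mopen M {p \<in> mpoints M. \<phi> p \<in> U}) \<and>
     (\<forall>U f. mopen N U \<longrightarrow>
        (msmooth N U f \<longleftrightarrow> msmooth M {p \<in> mpoints M. \<phi> p \<in> U} (f \<circ> \<phi>))) \<and>
     (\<forall>U f g. mopen N U \<and> msmooth N U f \<and> msmooth N U g \<longrightarrow>
        (\<forall>p \<in> mpoints M. \<phi> p \<in> U \<longrightarrow>
           mbracket M (f \<circ> \<phi>) (g \<circ> \<phi>) p = mbracket N f g (\<phi> p)))"

definition poisson_diffeomorphic ::
    "('a::euclidean_space, 'p) pman \<Rightarrow> ('b::euclidean_space, 'q) pman \<Rightarrow> bool" where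
  "poisson_diffeomorphic M N \<longleftrightarrow> (\<exists>\<phi>. poisson_diffeo \<phi> M N)"

text \<open>
  A bivector field on the ambient space is given by its value \<open>P x F G\<close> on the differentials
  of \<open>F\<close> and \<open>G\<close> at \<open>x\<close>. If it is tangent to \<open>S\<close>, it restricts to \<open>S\<close>:
  the bracket is computed with arbitrary local extensions of \<open>f\<close> and \<open>g\<close>.
\<close>

definition embedded_poisson ::
    "('a::euclidean_space \<Rightarrow> ('a \<Rightarrow> real) \<Rightarrow> ('a \<Rightarrow> real) \<Rightarrow> real) \<Rightarrow> 'a set \<Rightarrow> ('a, 'a) pman" where
  "embedded_poisson P S = \<lparr>mtotal = S, mproj = (\<lambda>x. x),
     mbracket = (\<lambda>f g x. THE v. \<forall>W F G.
        open W \<and> x \<in> W \<and> smooth_on W F \<and> smooth_on W G \<and>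
        (\<forall>y \<in> W \<inter> S. F y = f y \<and> G y = g y) \<longrightarrow> v = P x F G)\<rparr>"

text \<open>The projected Poisson structure on the quotient of \<open>M\<close> by the fibres of \<open>q\<close>.\<close>

definition quotient_poisson :: "('p \<Rightarrow> 'q) \<Rightarrow> ('a, 'p) pman \<Rightarrow> ('a, 'q) pman" where
  "quotient_poisson q M = \<lparr>mtotal = mtotal M, mproj = q \<circ> mproj M,
     mbracket = (\<lambda>f g y. THE v. \<forall>p \<in> mpoints M. q p = y \<longrightarrow>
        v = mbracket M (f \<circ> q) (g \<circ> q) p)\<rparr>"

definition product_poisson :: "('a, 'p) pman \<Rightarrow> ('b, 'q) pman \<Rightarrow> ('a \<times> 'b, 'p \<times> 'q) pman" where
  "product_poisson M N = \<lparr>mtotal = mtotal M \<times> mtotal N, mproj = map_prod (mproj M) (mproj N),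
     mbracket = (\<lambda>f g (p, q).
        mbracket M (\<lambda>p'. f (p', q)) (\<lambda>p'. g (p', q)) p
        + mbracket N (\<lambda>q'. f (p, q')) (\<lambda>q'. g (p, q')) q)\<rparr>"


section \<open>Poisson--Lie groups of matrices and their quotients\<close>

definition Xplus :: "nat \<Rightarrow> nat \<Rightarrow> 'd::{finite,linorder} cmat" where
  "Xplus i j = mat \<i> ** (munit i j + munit j i)"

definition Xminus :: "nat \<Rightarrow> nat \<Rightarrow> 'd::{finite,linorder} cmat" where
  "Xminus i j = munit i j - munit j i"

definition wedge_at :: "'a::euclidean_space \<Rightarrow> 'a \<Rightarrow> 'a \<Rightarrow> ('a \<Rightarrow> real) \<Rightarrow> ('a \<Rightarrow> real) \<Rightarrow> real" where
  "wedge_at x A B F G =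
     frechet_derivative F (at x) A * frechet_derivative G (at x) B
     - frechet_derivative F (at x) B * frechet_derivative G (at x) A"

text \<open>
  The bivector field \<open>\<pi>(g) = L\<^sub>g r - R\<^sub>g r\<close> on all matrices. It is tangent to \<open>U(d)\<close>, \<open>SU(d)\<close>
  and the Poisson--Lie subgroups \<open>K k\<close>, where it induces the standard and the restricted
  Poisson structures respectively.
\<close>

definition std_bivector :: "'d::{finite,linorder} cmat
    \<Rightarrow> ('d cmat \<Rightarrow> real) \<Rightarrow> ('d cmat \<Rightarrow> real) \<Rightarrow> real" where
  "std_bivector g F G = (\<Sum>j = 1..CARD('d). \<Sum>i = 1..<j.
     wedge_at g (g ** Xplus i j) (g ** Xminus i j) F G
     - wedge_at g (Xplus i j ** g) (Xminus i j ** g) F G)"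

definition poisson_group ::
    "'d::{finite,linorder} cmat set \<Rightarrow> ('d cmat, 'd cmat) pman" where
  "poisson_group G = embedded_poisson std_bivector G"

definition left_coset :: "'d::finite cmat set \<Rightarrow> 'd cmat \<Rightarrow> 'd cmat set" where
  "left_coset S g = (\<lambda>s. g ** s) ` S"

definition homogeneous_space :: "'d::{finite,linorder} cmat set \<Rightarrow> 'd cmat set
    \<Rightarrow> ('d cmat, 'd cmat set) pman" where
  "homogeneous_space G S = quotient_poisson (left_coset S) (poisson_group G)"

text \<open>The standard odd sphere \<open>S\<^sup>2\<^sup>d\<^sup>-\<^sup>1\<close>, as \<open>U(d)/(1 \<times> U(d-1))\<close> and as \<open>U(d)/(U(d-1) \<times> 1)\<close>.\<close>

definition sphere_first :: "('d::{finite,linorder} cmat, 'd cmat set) pman" where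
  "sphere_first = homogeneous_space unitary_group (block_unitary_group {2..CARD('d)})"

definition sphere_last :: "('d::{finite,linorder} cmat, 'd cmat set) pman" where
  "sphere_last = homogeneous_space unitary_group (block_unitary_group {1..CARD('d) - 1})"

definition unit_diag :: "nat \<Rightarrow> complex \<Rightarrow> 'd::{finite,linorder} cmat" where
  "unit_diag p a = (\<chi> i j. if i = j then (if idx i = p then a else 1) else 0)"

text \<open>
  The element \<open>diag(a, 1, \<dots>, 1, a)\<close> acts on pairs of cosets by right multiplication with
  \<open>diag(a, 1, \<dots>, 1)\<close> and \<open>diag(1, \<dots>, 1, a)\<close>, which normalize the respective subgroups.
\<close>

definition circle_act :: "complex \<Rightarrow>
    'k::{finite,linorder} cmat set \<times> 'l::{finite,linorder} cmat set
    \<Rightarrow> 'k cmat set \<times> 'l cmat set" where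
  "circle_act a = (\<lambda>(C, D).
     ((\<lambda>x. x ** unit_diag 1 a) ` C, (\<lambda>y. y ** unit_diag CARD('l) a) ` D))"

definition circle_orbit ::
    "'k::{finite,linorder} cmat set \<times> 'l::{finite,linorder} cmat set
    \<Rightarrow> ('k cmat set \<times> 'l cmat set) set" where
  "circle_orbit p = {circle_act a p | a. cmod a = 1}"

definition sphere_product_mod_circle ::
    "('k::{finite,linorder} cmat \<times> 'l::{finite,linorder} cmat,
      ('k cmat set \<times> 'l cmat set) set) pman" where
  "sphere_product_mod_circle =
     quotient_poisson circle_orbit (product_poisson sphere_first sphere_last)"

end

theory Submission
  imports Defs
begin

text \<open>
  Divide the indices into consecutive blocks. The part of \<open>r\<close> that belongs to pairs of indices in
  different blocks is the imaginary part of a Hermitian form, hence invariant under conjugation by block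
  diagonal unitary matrices; the remaining part is tangent to the blocks. Therefore \<open>\<pi>\<close> is tangent to
  \<open>K\<^sub>k\<close>, and brackets of functions that are invariant under the subgroups in question are invariant too.

  The linear map \<open>diag(A, B) \<mapsto> (A, B)\<close> sends \<open>\<pi>\<close> to the product structure and identifies cosets of
  \<open>K\<^sub>k \<inter> H\<^sub>\<sigma>\<close> with circle orbits of pairs of cosets. Moving along an orbit changes the determinant
  of the pair by squares, so a local square root of the determinant gives smooth local sections.

  For \<open>k = 1\<close> every circle orbit meets \<open>{1} \<times> U(n - 1)\<close>, which gives the odd sphere of the second
  factor. Complex conjugation and reversal of the basis both change the sign of \<open>r\<close>; their composition
  is a Poisson automorphism that exchanges the two models of the odd sphere.
\<close>

section \<open>Smooth functions\<close>

text \<open>The brackets of the statement are definite descriptions over all local extensions, or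
  over all points of a fibre; they can be computed only once their value is known not to depend on
  these choices. The property \<open>presents M P\<close> settles this: the bracket is
  \<open>P\<close> applied to any smooth representatives on the total space. It holds for embedded
  groups by tangency and passes to products and, given invariance along fibres, to quotients.
  Diffeomorphisms are then checked without charts, by a map of total spaces that matches fibres and
  has smooth local sections.

  The division into blocks varies and enters as a monotone map \<kappa> from indices to numbers: two
  classes for \<open>K k\<close> and for each sphere, the four classes {1}, {2..k}, {k+1..n-1}, {n}
  for \<open>K k \<inter> H c\<close>. A subgroup has to be block diagonal and to contain the
  rotations inside each class. Singleton classes have no rotations, so the equal corner entries of
  \<open>K k \<inter> H c\<close> cause no trouble. Circle elements lie outside the sphere subgroups
  in general, but they are block diagonal and normalize them, which is enough for
  invariance.\<close>

lemma Ck_on_mono: "Ck_on m W F \<Longrightarrow> V \<subseteq> W \<Longrightarrow> Ck_on m V F"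
  by (induction m arbitrary: F) (auto intro: continuous_on_subset)

text \<open>Openness of \<open>W\<close> matters: the values on \<open>W\<close> determine a
  derivative at a point only if they fill a neighbourhood of it.\<close>

lemma Ck_on_cong:
  assumes "open W" "\<And>y. y \<in> W \<Longrightarrow> F y = G y" "Ck_on m W F"
  shows "Ck_on m W G"
  using assms(2,3)
proof (induction m arbitrary: F G)
  case 0
  then show ?case by (metis Ck_on.simps(1) continuous_on_cong)
next
  case (Suc m)
  have D: "(G has_derivative frechet_derivative F (at x)) (at x)" if "x \<in> W" for x
    using that Suc.prems assms(1)
    by (intro has_derivative_transform_within_open[of F _ x UNIV W G])
      (auto simp: frechet_derivative_works[symmetric])
  have E: "frechet_derivative F (at x) = frechet_derivative G (at x)" if "x \<in> W" for x
    using D[OF that] frechet_derivative_at by blast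
  have "Ck_on m W (\<lambda>x. frechet_derivative G (at x) v)" for v
    using Suc.IH[of "\<lambda>x. frechet_derivative F (at x) v" "\<lambda>x. frechet_derivative G (at x) v"]
      Suc.prems E by auto
  with D show ?case by (auto simp: differentiable_def)
qed

text \<open>\<open>frechet_derivative\<close> is a choice operator; uniqueness of derivatives allows
  any exhibited formula \<open>D\<close> in its place. The rules for sums of two functions,
  products, roots and compositions all start from such a formula.\<close>

lemma Ck_on_Suc_cong:
  assumes "open W"
    and "\<And>x. x \<in> W \<Longrightarrow> (F has_derivative D x) (at x)"
    and "\<And>v. Ck_on m W (\<lambda>x. D x v)"
  shows "Ck_on (Suc m) W F"
proof -
  have "Ck_on m W (\<lambda>x. frechet_derivative F (at x) v)" for v
  proof (rule Ck_on_cong[OF assms(1) _ assms(3)[of v]])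
    show "D y v = frechet_derivative F (at y) v" if "y \<in> W" for y
      using frechet_derivative_at[OF assms(2)[OF that]] by simp
  qed
  with assms(2) show ?thesis by (auto simp: differentiable_def)
qed

text \<open>A derivative formula such as the product rule contains the function itself, which then
  enters the induction at one order less than given.\<close>

lemma Ck_on_SucD: "Ck_on (Suc m) W F \<Longrightarrow> Ck_on m W F"
proof (induction m arbitrary: F)
  case 0
  then show ?case
    by (auto intro!: continuous_at_imp_continuous_on differentiable_imp_continuous_within)
next
  case (Suc m)
  from Suc.prems have "\<forall>x\<in>W. F differentiable (at x)"
    and "\<And>v. Ck_on (Suc m) W (\<lambda>x. frechet_derivative F (at x) v)"
    by simp_all
  then show ?case using Suc.IH by (simp only: Ck_on.simps(2)) blast
qed

lemma Ck_on_Suc_has_derivative: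
  "Ck_on (Suc m) W F \<Longrightarrow> x \<in> W \<Longrightarrow> (F has_derivative frechet_derivative F (at x)) (at x)"
  by (auto simp: frechet_derivative_works[symmetric])

lemma Ck_on_const: "open W \<Longrightarrow> Ck_on m W (\<lambda>x. c)"
  by (induction m arbitrary: c) auto

lemma Ck_on_bounded_linear: "bounded_linear F \<Longrightarrow> open W \<Longrightarrow> Ck_on m W F"
proof (cases m)
  case (Suc l)
  assume "bounded_linear F" "open W"
  then show ?thesis unfolding Suc
    by (intro Ck_on_Suc_cong[where D = "\<lambda>x. F"] bounded_linear_imp_has_derivative Ck_on_const)
qed (auto simp: linear_continuous_on)

lemma Ck_on_add:
  "open W \<Longrightarrow> Ck_on m W F \<Longrightarrow> Ck_on m W G \<Longrightarrow> Ck_on m W (\<lambda>x. F x + G x)"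
proof (induction m arbitrary: F G)
  case (Suc m)
  note D = Ck_on_Suc_has_derivative[OF Suc.prems(2)] Ck_on_Suc_has_derivative[OF Suc.prems(3)]
  show ?case
    using Suc.prems
    by (intro Ck_on_Suc_cong[OF Suc.prems(1) has_derivative_add[OF D]] Suc.IH) auto
qed (auto intro: continuous_on_add)

lemma Ck_on_mult:
  "open W \<Longrightarrow> Ck_on m W F \<Longrightarrow> Ck_on m W G \<Longrightarrow> Ck_on m W (\<lambda>x. F x * G x)"
proof (induction m arbitrary: F G)
  case (Suc m)
  note D = Ck_on_Suc_has_derivative[OF Suc.prems(2)] Ck_on_Suc_has_derivative[OF Suc.prems(3)]
  show ?case
    using Suc.prems Ck_on_SucD[OF Suc.prems(2)] Ck_on_SucD[OF Suc.prems(3)]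
    by (intro Ck_on_Suc_cong[OF Suc.prems(1) has_derivative_mult[OF D]] Ck_on_add Suc.IH) auto
qed (auto intro: continuous_on_mult)

lemma Ck_on_sum:
  "open W \<Longrightarrow> (\<And>i. i \<in> I \<Longrightarrow> Ck_on m W (F i)) \<Longrightarrow> Ck_on m W (\<lambda>x. \<Sum>i\<in>I. F i x)"
  by (induction I rule: infinite_finite_induct) (auto intro: Ck_on_const Ck_on_add)

text \<open>With \<open>h = inverse (sqrt F)\<close> the derivative is \<open>- h^3 / 2\<close>
  times that of \<open>F\<close>, a polynomial in \<open>h\<close> and \<open>F'\<close>, so the
  induction closes by products alone.\<close>

lemma Ck_on_inverse_sqrt:
  "open W \<Longrightarrow> (\<And>x. x \<in> W \<Longrightarrow> F x > 0) \<Longrightarrow> Ck_on m W F \<Longrightarrow> Ck_on m W (\<lambda>x. inverse (sqrt (F x)))"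
proof (induction m)
  case 0
  then show ?case
    by (force intro!: continuous_intros)
next
  case (Suc m)
  let ?h = "\<lambda>x. inverse (sqrt (F x))"
  have D: "(?h has_derivative
      (\<lambda>v. (- 1/2) * (?h x * (?h x * ?h x)) * frechet_derivative F (at x) v)) (at x)"
    if x: "x \<in> W" for x
  proof -
    have p: "F x > 0" using Suc.prems x by auto
    have "((\<lambda>t. inverse (sqrt t)) has_real_derivative (- 1/2) * (?h x * (?h x * ?h x))) (at (F x))"
      using p by (auto intro!: derivative_eq_intros simp: field_simps)
    from has_derivative_compose[OF Ck_on_Suc_has_derivative[OF Suc.prems(3) x]
        this[unfolded has_field_derivative_def]]
    show ?thesis by simp
  qed
  have h: "Ck_on m W ?h" using Suc Ck_on_SucD by blast
  show ?case
    using Suc.prems h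
    by (intro Ck_on_Suc_cong[OF Suc.prems(1) D] Ck_on_mult Ck_on_const) auto
qed

text \<open>\<open>smooth_on\<close> speaks of real functions, so a map is tested on its
  coordinates. Openness of the domain is built in because \<open>smooth_on\<close> is meant for open
  sets.\<close>

definition smooth_map :: "'a::euclidean_space set \<Rightarrow> ('a \<Rightarrow> 'b::euclidean_space) \<Rightarrow> bool" where
  "smooth_map W T \<longleftrightarrow> open W \<and> (\<forall>b\<in>Basis. smooth_on W (\<lambda>x. T x \<bullet> b))"

lemma smooth_mapI: "open W \<Longrightarrow> (\<And>b. b \<in> Basis \<Longrightarrow> smooth_on W (\<lambda>x. T x \<bullet> b)) \<Longrightarrow> smooth_map W T"
  by (simp add: smooth_map_def)

lemma smooth_on_mono: "smooth_on W F \<Longrightarrow> V \<subseteq> W \<Longrightarrow> smooth_on V F"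
  by (auto simp: smooth_on_def intro: Ck_on_mono)

lemma smooth_on_differentiable: "smooth_on W F \<Longrightarrow> x \<in> W \<Longrightarrow> F differentiable (at x)"
  unfolding smooth_on_def using Ck_on.simps(2) by blast

lemma smooth_map_has_derivative:
  assumes "smooth_map W T" "x \<in> W"
  shows "(T has_derivative (\<lambda>v. \<Sum>b\<in>Basis. frechet_derivative (\<lambda>x. T x \<bullet> b) (at x) v *\<^sub>R b)) (at x)"
proof -
  have "((\<lambda>x. T x \<bullet> b) has_derivative frechet_derivative (\<lambda>x. T x \<bullet> b) (at x)) (at x)"
    if "b \<in> Basis" for b
    unfolding frechet_derivative_works[symmetric]
    using assms that by (auto simp: smooth_map_def intro: smooth_on_differentiable)
  then have "((\<lambda>x. \<Sum>b\<in>Basis. (T x \<bullet> b) *\<^sub>R b) has_derivative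
      (\<lambda>v. \<Sum>b\<in>Basis. frechet_derivative (\<lambda>x. T x \<bullet> b) (at x) v *\<^sub>R b)) (at x)"
    by (intro has_derivative_sum has_derivative_scaleR_left) auto
  then show ?thesis by (simp add: euclidean_representation)
qed

lemma smooth_map_continuous_on: "smooth_map W T \<Longrightarrow> continuous_on W T"
  by (meson continuous_at_imp_continuous_on has_derivative_continuous smooth_map_has_derivative)

text \<open>The chain rule in coordinates gives a sum of products of derivatives of \<open>T\<close>
  with partial derivatives of \<open>F\<close> evaluated along \<open>T\<close>. The latter are
  again compositions with \<open>T\<close>, of lower order, hence the induction over all
  \<open>F\<close>.\<close>

lemma Ck_on_compose:
  assumes T: "smooth_map W T" and sub: "T ` W \<subseteq> V"
  shows "Ck_on m V F \<Longrightarrow> Ck_on m W (\<lambda>x. F (T x))"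
proof (induction m arbitrary: F)
  case 0
  then show ?case using sub smooth_map_continuous_on[OF T]
    by (auto intro: continuous_on_compose2)
next
  case (Suc m)
  have W: "open W" using T by (simp add: smooth_map_def)
  have D: "((\<lambda>x. F (T x)) has_derivative
      (\<lambda>v. \<Sum>b\<in>Basis. frechet_derivative (\<lambda>x. T x \<bullet> b) (at x) v *
          frechet_derivative F (at (T x)) b)) (at x)" if x: "x \<in> W" for x
  proof -
    have F: "(F has_derivative frechet_derivative F (at (T x))) (at (T x))"
      using Suc.prems sub x Ck_on_Suc_has_derivative by blast
    then have "linear (frechet_derivative F (at (T x)))"
      using has_derivative_linear by blast
    with has_derivative_compose[OF smooth_map_has_derivative[OF T x] F]
    show ?thesis by (simp add: linear_sum linear_cmul o_def)
  qed
  have b: "Ck_on (Suc m) W (\<lambda>x. T x \<bullet> b)" if "b \<in> Basis" for b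
    using T that unfolding smooth_map_def smooth_on_def by blast
  show ?case
    using Suc.prems b
    by (intro Ck_on_Suc_cong[OF W D] Ck_on_sum Ck_on_mult W Suc.IH) auto
qed

lemma smooth_on_compose:
  "smooth_map W T \<Longrightarrow> T ` W \<subseteq> V \<Longrightarrow> smooth_on V F \<Longrightarrow> smooth_on W (\<lambda>x. F (T x))"
  by (simp add: smooth_on_def Ck_on_compose)

lemma smooth_map_open_vimage:
  "smooth_map W T \<Longrightarrow> open V \<Longrightarrow> open (W \<inter> T -` V)"
  by (rule continuous_open_preimage[OF smooth_map_continuous_on]) (simp_all add: smooth_map_def)

lemma smooth_map_mono: "smooth_map W T \<Longrightarrow> open V \<Longrightarrow> V \<subseteq> W \<Longrightarrow> smooth_map V T"
  by (auto simp: smooth_map_def intro: smooth_on_mono)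

lemma smooth_map_const: "open W \<Longrightarrow> smooth_map W (\<lambda>x. c)"
  by (simp add: smooth_map_def smooth_on_def Ck_on_const)

lemma smooth_map_bounded_linear: "bounded_linear T \<Longrightarrow> open W \<Longrightarrow> smooth_map W T"
  by (auto simp: smooth_map_def smooth_on_def
      intro!: Ck_on_bounded_linear bounded_linear_compose[OF bounded_linear_inner_left])

lemma smooth_map_add:
  "smooth_map W S \<Longrightarrow> smooth_map W T \<Longrightarrow> smooth_map W (\<lambda>x. S x + T x)"
  by (auto simp: smooth_map_def smooth_on_def inner_add_left intro: Ck_on_add)

lemma smooth_map_complex_iff:
  "smooth_map W f \<longleftrightarrow> open W \<and> smooth_on W (\<lambda>x. Re (f x)) \<and> smooth_on W (\<lambda>x. Im (f x))"
  by (simp add: smooth_map_def Basis_complex_def inner_complex_def)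

lemma smooth_on_add:
  "open W \<Longrightarrow> smooth_on W F \<Longrightarrow> smooth_on W G \<Longrightarrow> smooth_on W (\<lambda>x. F x + G x)"
  by (auto simp: smooth_on_def intro: Ck_on_add)

lemma smooth_on_mult:
  "open W \<Longrightarrow> smooth_on W F \<Longrightarrow> smooth_on W G \<Longrightarrow> smooth_on W (\<lambda>x. F x * G x)"
  by (auto simp: smooth_on_def intro: Ck_on_mult)

lemma smooth_on_uminus: "open W \<Longrightarrow> smooth_on W F \<Longrightarrow> smooth_on W (\<lambda>x. - F x)"
  using smooth_on_mult[of W "\<lambda>x. - 1" F] by (simp add: smooth_on_def Ck_on_const)

lemma smooth_map_mult:
  fixes f g :: "'a::euclidean_space \<Rightarrow> complex"
  assumes "smooth_map W f" "smooth_map W g"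
  shows "smooth_map W (\<lambda>x. f x * g x)"
  using assms unfolding smooth_map_complex_iff
  by (auto simp: diff_conv_add_uminus simp del: add_uminus_conv_diff
      intro!: smooth_on_add smooth_on_mult smooth_on_uminus)

lemma smooth_map_cnj:
  fixes f :: "'a::euclidean_space \<Rightarrow> complex"
  shows "smooth_map W f \<Longrightarrow> smooth_map W (\<lambda>x. cnj (f x))"
  by (simp add: smooth_map_complex_iff smooth_on_uminus)

lemma smooth_map_sum:
  "open W \<Longrightarrow> (\<And>i. i \<in> I \<Longrightarrow> smooth_map W (f i)) \<Longrightarrow> smooth_map W (\<lambda>x. \<Sum>i\<in>I. f i x)"
  by (induction I rule: infinite_finite_induct) (auto intro: smooth_map_const smooth_map_add)

lemma smooth_map_prod:
  fixes f :: "'i \<Rightarrow> 'a::euclidean_space \<Rightarrow> complex"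
  shows "open W \<Longrightarrow> (\<And>i. i \<in> I \<Longrightarrow> smooth_map W (f i)) \<Longrightarrow> smooth_map W (\<lambda>x. \<Prod>i\<in>I. f i x)"
  by (induction I rule: infinite_finite_induct) (auto intro: smooth_map_const smooth_map_mult)

lemma smooth_map_cmat:
  fixes T :: "'a::euclidean_space \<Rightarrow> 'd::finite cmat"
  assumes "open W" "\<And>i j. smooth_map W (\<lambda>x. T x $ i $ j)"
  shows "smooth_map W T"
  using assms unfolding smooth_map_def Basis_vec_def
  by (auto simp: inner_axis)

lemma smooth_map_entry:
  fixes T :: "'a::euclidean_space \<Rightarrow> 'd::finite cmat"
  assumes "smooth_map W T"
  shows "smooth_map W (\<lambda>x. T x $ i $ j)"
proof (intro smooth_mapI)
  fix b :: complex assume b: "b \<in> Basis"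
  then have "axis i (axis j b) \<in> (Basis :: 'd cmat set)"
    by (auto simp: Basis_vec_def)
  then have "smooth_on W (\<lambda>x. T x \<bullet> axis i (axis j b))"
    using assms unfolding smooth_map_def by blast
  then show "smooth_on W (\<lambda>x. T x $ i $ j \<bullet> b)"
    by (simp add: inner_axis)
qed (use assms in \<open>simp add: smooth_map_def\<close>)

lemma smooth_map_det:
  fixes T :: "'a::euclidean_space \<Rightarrow> 'd::finite cmat"
  assumes "smooth_map W T"
  shows "smooth_map W (\<lambda>x. det (T x))"
proof -
  have W: "open W" using assms by (simp add: smooth_map_def)
  show ?thesis unfolding det_def
    by (intro smooth_map_sum smooth_map_mult smooth_map_prod smooth_map_const W
        smooth_map_entry assms)
qed

lemma smooth_map_matrix_mult:
  fixes S T :: "'a::euclidean_space \<Rightarrow> 'd::finite cmat"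
  assumes "smooth_map W S" "smooth_map W T"
  shows "smooth_map W (\<lambda>x. S x ** T x)"
proof -
  have W: "open W" using assms by (simp add: smooth_map_def)
  show ?thesis
    by (intro smooth_map_cmat W)
      (auto simp: matrix_matrix_mult_def intro!: smooth_map_sum W smooth_map_mult smooth_map_entry assms)
qed

text \<open>
  For unimodular \<open>w\<close>, the number \<open>(1 + w) / \<bar>1 + w\<bar>\<close> is a square root of \<open>w\<close> depending smoothly
  on \<open>w \<noteq> -1\<close>.
\<close>

definition unit_sqrt :: "complex \<Rightarrow> complex" where
  "unit_sqrt w = (1 + w) * of_real (inverse (sqrt ((1 + Re w)\<^sup>2 + (Im w)\<^sup>2)))"

lemma unit_sqrt:
  assumes "cmod w = 1" "w \<noteq> - 1"
  shows "(unit_sqrt w)\<^sup>2 = w" "cmod (unit_sqrt w) = 1"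
proof -
  let ?q = "(1 + Re w)\<^sup>2 + (Im w)\<^sup>2"
  have q: "?q = (cmod (1 + w))\<^sup>2" by (simp add: cmod_def)
  have nz: "cmod (1 + w) \<noteq> 0" using assms(2)
    by (metis add.inverse_unique norm_eq_zero)
  then show "cmod (unit_sqrt w) = 1"
    unfolding unit_sqrt_def q by (simp add: norm_mult norm_inverse)
  have 1: "w * cnj w = 1" using assms(1) complex_norm_square[of w] by simp
  \<comment> \<open>Unimodularity turns \<open>1 + w\<close> into \<open>w * cnj (1 + w)\<close>,
    which produces the squared modulus that the normalization divides out.\<close>
  have "(1 + w)\<^sup>2 = w * ((1 + w) * cnj (1 + w))"
    using 1 by (simp add: algebra_simps power2_eq_square)
  also have "\<dots> = w * of_real ((cmod (1 + w))\<^sup>2)"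
    using complex_norm_square[of "1 + w"] by simp
  finally show "(unit_sqrt w)\<^sup>2 = w"
    using nz unfolding unit_sqrt_def q by (simp add: power_mult_distrib field_simps)
qed

lemma smooth_map_unit_sqrt:
  assumes f: "smooth_map W f" and nz: "\<And>x. x \<in> W \<Longrightarrow> f x \<noteq> - 1"
  shows "smooth_map W (\<lambda>x. unit_sqrt (f x))"
proof -
  have W: "open W" using assms by (simp add: smooth_map_def)
  let ?q = "\<lambda>x. (1 + Re (f x))\<^sup>2 + (Im (f x))\<^sup>2"
  have c: "smooth_on W (\<lambda>x. c)" for c using W by (simp add: smooth_on_def Ck_on_const)
  have q: "smooth_on W ?q"
    using f W c unfolding smooth_map_complex_iff power2_eq_square
    by (auto intro!: smooth_on_add smooth_on_mult)
  have "?q x > 0" if "x \<in> W" for x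
  proof -
    have "1 + Re (f x) \<noteq> 0 \<or> Im (f x) \<noteq> 0"
      using nz[OF that] by (auto simp: complex_eq_iff)
    then show ?thesis by (auto simp: add_pos_nonneg add_nonneg_pos)
  qed
  then have "smooth_on W (\<lambda>x. inverse (sqrt (?q x)))"
    using q W by (auto simp: smooth_on_def intro!: Ck_on_inverse_sqrt)
  then have "smooth_map W (\<lambda>x. complex_of_real (inverse (sqrt (?q x))))"
    using W c by (simp only: smooth_map_complex_iff Re_complex_of_real Im_complex_of_real)
  then show ?thesis unfolding unit_sqrt_def
    by (intro smooth_map_mult smooth_map_add smooth_map_const W f)
qed

section \<open>Poisson structures presented by bivector fields\<close>

text \<open>A smooth local representative on the total space of a function on the points; both
  \<open>msmooth\<close> and the bracket of \<open>embedded_poisson\<close> quantify over such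
  data.\<close>

definition extends_on :: "('a::euclidean_space, 'p) pman \<Rightarrow> 'a set \<Rightarrow> ('a \<Rightarrow> real) \<Rightarrow> ('p \<Rightarrow> real) \<Rightarrow> bool" where
  "extends_on M W F f \<longleftrightarrow>
     open W \<and> smooth_on W F \<and> (\<forall>y \<in> W \<inter> mtotal M. F y = f (mproj M y))"

lemma extends_on_mono: "extends_on M W F f \<Longrightarrow> open V \<Longrightarrow> V \<subseteq> W \<Longrightarrow> extends_on M V F f"
  by (auto simp: extends_on_def intro: smooth_on_mono)

lemma msmooth_iff:
  "msmooth M U f \<longleftrightarrow>
     (\<forall>x \<in> mtotal M. mproj M x \<in> U \<longrightarrow> (\<exists>W F. x \<in> W \<and> extends_on M W F f))"
  unfolding msmooth_def extends_on_def by blast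

lemma msmooth_extends_on2:
  assumes "msmooth M U f" "msmooth M U g" "x \<in> mtotal M" "mproj M x \<in> U"
  obtains W F G where "x \<in> W" "extends_on M W F f" "extends_on M W G g"
proof -
  obtain V F where 1: "x \<in> V" "extends_on M V F f"
    using assms unfolding msmooth_iff by blast
  obtain W G where 2: "x \<in> W" "extends_on M W G g"
    using assms unfolding msmooth_iff by blast
  have "open (V \<inter> W)" using 1 2 by (auto simp: extends_on_def)
  then show thesis
    using 1 2 by (intro that[of "V \<inter> W" F G]) (auto elim: extends_on_mono)
qed

text \<open>\<open>P\<close> lives on the ambient space of \<open>mtotal M\<close> even when
  \<open>M\<close> is a quotient, so that brackets on quotients are computed with matrices.\<close>

definition presents :: "('a::euclidean_space, 'p) pman \<Rightarrow>
    ('a \<Rightarrow> ('a \<Rightarrow> real) \<Rightarrow> ('a \<Rightarrow> real) \<Rightarrow> real) \<Rightarrow> bool" where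
  "presents M P \<longleftrightarrow> (\<forall>x \<in> mtotal M. \<forall>W F G f g.
     x \<in> W \<longrightarrow> extends_on M W F f \<longrightarrow> extends_on M W G g \<longrightarrow>
     mbracket M f g (mproj M x) = P x F G)"

lemma presentsD:
  "presents M P \<Longrightarrow> x \<in> mtotal M \<Longrightarrow> x \<in> W \<Longrightarrow> extends_on M W F f \<Longrightarrow> extends_on M W G g \<Longrightarrow>
    mbracket M f g (mproj M x) = P x F G"
  unfolding presents_def by blast

text \<open>Tangency of \<open>P\<close> to \<open>S\<close> is expressed as dependence on the
  restrictions to \<open>S\<close> near the point. This gives the defining description a unique
  value.\<close>

lemma presents_embedded:
  assumes tangent: "\<And>x W F F' G G'. x \<in> S \<Longrightarrow> x \<in> W \<Longrightarrow> open W \<Longrightarrow>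
      smooth_on W F \<Longrightarrow> smooth_on W F' \<Longrightarrow> smooth_on W G \<Longrightarrow> smooth_on W G' \<Longrightarrow>
      (\<And>y. y \<in> W \<inter> S \<Longrightarrow> F y = F' y) \<Longrightarrow> (\<And>y. y \<in> W \<inter> S \<Longrightarrow> G y = G' y) \<Longrightarrow> P x F G = P x F' G'"
  shows "presents (embedded_poisson P S) P"
  unfolding presents_def
proof (intro ballI allI impI)
  fix x W F G f g
  assume x: "x \<in> mtotal (embedded_poisson P S)" and W: "x \<in> W"
    and e: "extends_on (embedded_poisson P S) W F f" "extends_on (embedded_poisson P S) W G g"
  from x have xS: "x \<in> S" by (simp add: embedded_poisson_def)
  have F: "open W" "smooth_on W F" "smooth_on W G" "\<And>y. y \<in> W \<inter> S \<Longrightarrow> F y = f y \<and> G y = g y"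
    using e by (auto simp: extends_on_def embedded_poisson_def)
  have "(THE v. \<forall>W F G. open W \<and> x \<in> W \<and> smooth_on W F \<and> smooth_on W G \<and>
        (\<forall>y \<in> W \<inter> S. F y = f y \<and> G y = g y) \<longrightarrow> v = P x F G) = P x F G"
  proof (rule the_equality)
    show "\<forall>W F' G'. open W \<and> x \<in> W \<and> smooth_on W F' \<and> smooth_on W G' \<and>
        (\<forall>y \<in> W \<inter> S. F' y = f y \<and> G' y = g y) \<longrightarrow> P x F G = P x F' G'"
    proof (intro allI impI, elim conjE)
      fix V F' G'
      assume V: "open V" "x \<in> V" "smooth_on V F'" "smooth_on V G'"
        "\<forall>y \<in> V \<inter> S. F' y = f y \<and> G' y = g y"
      show "P x F G = P x F' G'"
        \<comment> \<open>Representatives with different domains are compared on the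
          intersection.\<close>
        using V F xS W by (intro tangent[of x "W \<inter> V"]) (auto elim: smooth_on_mono)
    qed
  qed (use F W in blast)
  then show "mbracket (embedded_poisson P S) f g (mproj (embedded_poisson P S) x) = P x F G"
    by (simp add: embedded_poisson_def)
qed

text \<open>One pair of representatives near the second point of the fibre is enough, since
  \<open>presents M P\<close> makes the bracket there independent of the representatives.\<close>

lemma presents_quotient:
  assumes M: "presents M P"
    and fibre: "\<And>x x' W F G f g. x \<in> mtotal M \<Longrightarrow> x' \<in> mtotal M \<Longrightarrow>
      q (mproj M x) = q (mproj M x') \<Longrightarrow> x \<in> W \<Longrightarrow>
      extends_on M W F (f \<circ> q) \<Longrightarrow> extends_on M W G (g \<circ> q) \<Longrightarrow>
      \<exists>W' F' G'. x' \<in> W' \<and> extends_on M W' F' (f \<circ> q) \<and> extends_on M W' G' (g \<circ> q) \<and>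
        P x' F' G' = P x F G"
  shows "presents (quotient_poisson q M) P"
  unfolding presents_def
proof (intro ballI allI impI)
  fix x W F G f g
  assume x: "x \<in> mtotal (quotient_poisson q M)" and W: "x \<in> W"
    and e: "extends_on (quotient_poisson q M) W F f" "extends_on (quotient_poisson q M) W G g"
  from x have xM: "x \<in> mtotal M" by (simp add: quotient_poisson_def)
  have F: "extends_on M W F (f \<circ> q)" "extends_on M W G (g \<circ> q)"
    using e by (auto simp: extends_on_def quotient_poisson_def)
  have "(THE v. \<forall>p \<in> mpoints M. q p = q (mproj M x) \<longrightarrow> v = mbracket M (f \<circ> q) (g \<circ> q) p) = P x F G"
  proof (rule the_equality)
    show "\<forall>p\<in>mpoints M. q p = q (mproj M x) \<longrightarrow> P x F G = mbracket M (f \<circ> q) (g \<circ> q) p"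
    proof (intro ballI impI)
      fix p assume "p \<in> mpoints M" and p: "q p = q (mproj M x)"
      then obtain x' where x': "x' \<in> mtotal M" "p = mproj M x'" by (auto simp: mpoints_def)
      then show "P x F G = mbracket M (f \<circ> q) (g \<circ> q) p"
        using fibre[OF xM x'(1) _ W F] p presentsD[OF M x'(1)] by metis
    qed
  qed (use presentsD[OF M xM W F] xM in \<open>auto simp: mpoints_def\<close>)
  then show "mbracket (quotient_poisson q M) f g (mproj (quotient_poisson q M) x) = P x F G"
    by (simp add: quotient_poisson_def)
qed

definition product_bivector where
  "product_bivector P Q z F G =
     P (fst z) (\<lambda>x. F (x, snd z)) (\<lambda>x. G (x, snd z)) + Q (snd z) (\<lambda>y. F (fst z, y)) (\<lambda>y. G (fst z, y))"

lemma smooth_map_Pair_left: "open W \<Longrightarrow> smooth_map W (\<lambda>x. (x, y))"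
proof -
  assume W: "open W"
  have "smooth_map W (\<lambda>x. (x, 0) + (0, y))"
    by (intro smooth_map_add smooth_map_const smooth_map_bounded_linear W bounded_linear_Pair
        bounded_linear_ident bounded_linear_zero)
  then show ?thesis by simp
qed

lemma smooth_map_Pair_right: "open W \<Longrightarrow> smooth_map W (\<lambda>y. (x, y))"
proof -
  assume W: "open W"
  have "smooth_map W (\<lambda>y. (0, y) + (x, 0))"
    by (intro smooth_map_add smooth_map_const smooth_map_bounded_linear W bounded_linear_Pair
        bounded_linear_ident bounded_linear_zero)
  then show ?thesis by simp
qed

lemma open_slice_left: "open W \<Longrightarrow> open {x. (x, y) \<in> W}"
  using open_vimage[of W "\<lambda>x. (x, y)"] by (simp add: vimage_def continuous_on_Pair)

lemma open_slice_right: "open W \<Longrightarrow> open {y. (x, y) \<in> W}"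
  using open_vimage[of W "\<lambda>y. (x, y)"] by (simp add: vimage_def continuous_on_Pair)

lemma smooth_on_slice_left:
  "smooth_on W F \<Longrightarrow> open W \<Longrightarrow> smooth_on {x. (x, y) \<in> W} (\<lambda>x. F (x, y))"
  by (rule smooth_on_compose[OF smooth_map_Pair_left]) (auto simp: open_slice_left)

lemma smooth_on_slice_right:
  "smooth_on W F \<Longrightarrow> open W \<Longrightarrow> smooth_on {y. (x, y) \<in> W} (\<lambda>y. F (x, y))"
  by (rule smooth_on_compose[OF smooth_map_Pair_right]) (auto simp: open_slice_right)

lemma extends_on_product_left:
  assumes "extends_on (product_poisson M N) W F f" "y \<in> mtotal N"
  shows "extends_on M {x. (x, y) \<in> W} (\<lambda>x. F (x, y)) (\<lambda>p. f (p, mproj N y))"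
  using assms unfolding extends_on_def
  by (auto simp: open_slice_left smooth_on_slice_left product_poisson_def)

lemma extends_on_product_right:
  assumes "extends_on (product_poisson M N) W F f" "x \<in> mtotal M"
  shows "extends_on N {y. (x, y) \<in> W} (\<lambda>y. F (x, y)) (\<lambda>p. f (mproj M x, p))"
  using assms unfolding extends_on_def
  by (auto simp: open_slice_right smooth_on_slice_right product_poisson_def)

lemma presents_product:
  assumes "presents M P" "presents N Q"
  shows "presents (product_poisson M N) (product_bivector P Q)"
  unfolding presents_def
proof (intro ballI allI impI)
  fix z W F G f g
  assume z: "z \<in> mtotal (product_poisson M N)" and W: "z \<in> W"
    and e: "extends_on (product_poisson M N) W F f" "extends_on (product_poisson M N) W G g"
  obtain x y where xy: "z = (x, y)" "x \<in> mtotal M" "y \<in> mtotal N"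
    using z by (auto simp: product_poisson_def)
  have "mbracket M (\<lambda>p. f (p, mproj N y)) (\<lambda>p. g (p, mproj N y)) (mproj M x) =
      P x (\<lambda>x. F (x, y)) (\<lambda>x. G (x, y))"
    using xy W by (intro presentsD[OF assms(1), where W = "{x. (x, y) \<in> W}"]
        extends_on_product_left[OF e(1)] extends_on_product_left[OF e(2)]) auto
  moreover have "mbracket N (\<lambda>p. f (mproj M x, p)) (\<lambda>p. g (mproj M x, p)) (mproj N y) =
      Q y (\<lambda>y. F (x, y)) (\<lambda>y. G (x, y))"
    using xy W by (intro presentsD[OF assms(2), where W = "{y. (x, y) \<in> W}"]
        extends_on_product_right[OF e(1)] extends_on_product_right[OF e(2)]) auto
  ultimately show "mbracket (product_poisson M N) f g (mproj (product_poisson M N) z) =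
      product_bivector P Q z F G"
    by (simp add: product_poisson_def product_bivector_def xy)
qed

section \<open>A criterion for Poisson diffeomorphisms\<close>

lemma mopen_vimage:
  assumes loc: "\<And>x. x \<in> mtotal M \<Longrightarrow> \<exists>W T. x \<in> W \<and> smooth_map W T \<and>
      T ` (W \<inter> mtotal M) \<subseteq> mtotal N \<and>
      (\<forall>z \<in> W \<inter> mtotal M. mproj M z \<in> U' \<longleftrightarrow> mproj N (T z) \<in> U)"
    and U: "mopen N U" and sub: "U' \<subseteq> mpoints M"
  shows "mopen M U'"
  unfolding mopen_def
proof (intro conjI sub)
  obtain V where V: "open V" "{y \<in> mtotal N. mproj N y \<in> U} = mtotal N \<inter> V"
    using U unfolding mopen_def openin_open by auto
  show "openin (top_of_set (mtotal M)) {x \<in> mtotal M. mproj M x \<in> U'}"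
  proof (subst openin_subopen, intro ballI)
    fix x assume x: "x \<in> {x \<in> mtotal M. mproj M x \<in> U'}"
    then obtain W T where W: "x \<in> W" "smooth_map W T" "T ` (W \<inter> mtotal M) \<subseteq> mtotal N"
      and T: "\<And>z. z \<in> W \<inter> mtotal M \<Longrightarrow> mproj M z \<in> U' \<longleftrightarrow> mproj N (T z) \<in> U"
      using loc[of x] by auto
    have "open (W \<inter> T -` V)" using W V smooth_map_open_vimage by blast
    moreover have "z \<in> mtotal M \<Longrightarrow> z \<in> W \<Longrightarrow> T z \<in> V \<longleftrightarrow> mproj M z \<in> U'" for z
      using T[of z] W(3) V(2) by blast
    ultimately show "\<exists>T. openin (top_of_set (mtotal M)) T \<and> x \<in> T \<and>
        T \<subseteq> {x \<in> mtotal M. mproj M x \<in> U'}"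
      using x W(1) by (intro exI[of _ "mtotal M \<inter> (W \<inter> T -` V)"]) auto
  qed
qed

text \<open>Serves three purposes: pulling back along the map of total spaces, along local sections,
  and along the right translations that move between points of a fibre.\<close>

lemma extends_on_compose:
  assumes T: "smooth_map W T" "T ` (W \<inter> mtotal M) \<subseteq> mtotal N"
    and F: "extends_on N V F f"
    and f: "\<And>z. z \<in> W \<inter> mtotal M \<Longrightarrow> f' (mproj M z) = f (mproj N (T z))"
  shows "extends_on M (W \<inter> T -` V) (\<lambda>z. F (T z)) f'"
  unfolding extends_on_def
proof (intro conjI ballI)
  show o: "open (W \<inter> T -` V)"
    using smooth_map_open_vimage[OF T(1)] F by (simp add: extends_on_def)
  show "smooth_on (W \<inter> T -` V) (\<lambda>z. F (T z))"
    using F by (intro smooth_on_compose[OF smooth_map_mono[OF T(1) o]]) (auto simp: extends_on_def)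
  show "F (T y) = f' (mproj M y)" if "y \<in> W \<inter> T -` V \<inter> mtotal M" for y
    using that F f[of y] T(2) by (auto simp: extends_on_def)
qed

text \<open>\<open>T\<close> induces a bijection of points because it matches fibres and has
  sections up to fibres. Open sets and smooth functions are pulled back along \<open>T\<close> in
  one direction and along the sections in the other; brackets are compared upstairs through
  \<open>P\<close> and \<open>Q\<close>.\<close>

lemma poisson_diffeomorphicI:
  assumes M: "presents M P" and N: "presents N Q"
    and T: "smooth_map UNIV T" "T ` mtotal M \<subseteq> mtotal N"
    and fibres: "\<And>x x'. x \<in> mtotal M \<Longrightarrow> x' \<in> mtotal M \<Longrightarrow>
      mproj M x = mproj M x' \<longleftrightarrow> mproj N (T x) = mproj N (T x')"
    and sect: "\<And>y. y \<in> mtotal N \<Longrightarrow> \<exists>W R. y \<in> W \<and> smooth_map W R \<and>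
      R ` (W \<inter> mtotal N) \<subseteq> mtotal M \<and> (\<forall>z \<in> W \<inter> mtotal N. mproj N (T (R z)) = mproj N z)"
    and bracket: "\<And>x W F G. x \<in> mtotal M \<Longrightarrow> T x \<in> W \<Longrightarrow> open W \<Longrightarrow>
      smooth_on W F \<Longrightarrow> smooth_on W G \<Longrightarrow>
      P x (\<lambda>z. F (T z)) (\<lambda>z. G (T z)) = Q (T x) F G"
  shows "poisson_diffeomorphic M N"
proof -
  \<comment> \<open>The choice of \<open>x\<close> in the fibre is immaterial by
    \<open>fibres\<close>.\<close>
  define \<phi> where "\<phi> p = mproj N (T (SOME x. x \<in> mtotal M \<and> mproj M x = p))" for p
  have \<phi>: "\<phi> (mproj M x) = mproj N (T x)" if "x \<in> mtotal M" for x
  proof -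
    have "\<exists>x'. x' \<in> mtotal M \<and> mproj M x' = mproj M x" using that by blast
    from someI_ex[OF this] show ?thesis using that fibres unfolding \<phi>_def by blast
  qed
  have R: "\<exists>W R. y \<in> W \<and> smooth_map W R \<and> R ` (W \<inter> mtotal N) \<subseteq> mtotal M \<and>
      (\<forall>z \<in> W \<inter> mtotal N. \<phi> (mproj M (R z)) = mproj N z)" if "y \<in> mtotal N" for y
    using sect[OF that] \<phi> by (metis image_subset_iff)
  have bij: "bij_betw \<phi> (mpoints M) (mpoints N)"
  proof (rule bij_betwI')
    show "\<phi> p = \<phi> q \<longleftrightarrow> p = q" if "p \<in> mpoints M" "q \<in> mpoints M" for p q
      using that fibres \<phi> by (auto simp: mpoints_def)
    show "\<phi> p \<in> mpoints N" if "p \<in> mpoints M" for p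
      using that \<phi> T(2) by (auto simp: mpoints_def)
    show "\<exists>p\<in>mpoints M. q = \<phi> p" if q: "q \<in> mpoints N" for q
    proof -
      obtain y where y: "y \<in> mtotal N" "q = mproj N y" using q by (auto simp: mpoints_def)
      with R obtain W r where "y \<in> W" "r ` (W \<inter> mtotal N) \<subseteq> mtotal M"
        "\<forall>z \<in> W \<inter> mtotal N. \<phi> (mproj M (r z)) = mproj N z" by blast
      with y show ?thesis unfolding mpoints_def by (intro bexI[of _ "mproj M (r y)"]) auto
    qed
  qed
  have "mopen N U \<longleftrightarrow> mopen M {p \<in> mpoints M. \<phi> p \<in> U}" if "U \<subseteq> mpoints N" for U
  proof
    assume "mopen N U"
    then show "mopen M {p \<in> mpoints M. \<phi> p \<in> U}"
      by (rule mopen_vimage[rotated])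
        (use T \<phi> in \<open>auto intro!: exI[of _ UNIV] exI[of _ T] simp: mpoints_def\<close>)
  next
    assume o: "mopen M {p \<in> mpoints M. \<phi> p \<in> U}"
    show "mopen N U"
    proof (rule mopen_vimage[OF _ o that])
      fix y assume "y \<in> mtotal N"
      from R[OF this] obtain W r where
        "y \<in> W" "smooth_map W r" "r ` (W \<inter> mtotal N) \<subseteq> mtotal M"
        "\<forall>z \<in> W \<inter> mtotal N. \<phi> (mproj M (r z)) = mproj N z" by blast
      then show "\<exists>W T. y \<in> W \<and> smooth_map W T \<and> T ` (W \<inter> mtotal N) \<subseteq> mtotal M \<and>
          (\<forall>z\<in>W \<inter> mtotal N. (mproj N z \<in> U) = (mproj M (T z) \<in> {p \<in> mpoints M. \<phi> p \<in> U}))"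
        by (intro exI[of _ W] exI[of _ r]) (auto simp: mpoints_def)
    qed
  qed
  moreover have "msmooth N U f \<longleftrightarrow> msmooth M {p \<in> mpoints M. \<phi> p \<in> U} (f \<circ> \<phi>)"
    if "mopen N U" for U f
  proof
    assume f: "msmooth N U f"
    show "msmooth M {p \<in> mpoints M. \<phi> p \<in> U} (f \<circ> \<phi>)"
      unfolding msmooth_iff
    proof (intro ballI impI)
      fix x assume x: "x \<in> mtotal M" "mproj M x \<in> {p \<in> mpoints M. \<phi> p \<in> U}"
      then obtain W F where W: "T x \<in> W" "extends_on N W F f"
        using f[unfolded msmooth_iff, rule_format, of "T x"] T(2) \<phi>[OF x(1)] by auto
      have "extends_on M (UNIV \<inter> T -` W) (\<lambda>z. F (T z)) (f \<circ> \<phi>)"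
        by (rule extends_on_compose[OF T(1) _ W(2)]) (use T(2) \<phi> in auto)
      then show "\<exists>W F. x \<in> W \<and> extends_on M W F (f \<circ> \<phi>)" using W(1) by auto
    qed
  next
    assume f: "msmooth M {p \<in> mpoints M. \<phi> p \<in> U} (f \<circ> \<phi>)"
    show "msmooth N U f"
      unfolding msmooth_iff
    proof (intro ballI impI)
      fix y assume y: "y \<in> mtotal N" "mproj N y \<in> U"
      from R[OF y(1)] obtain W r where
        W: "y \<in> W" "smooth_map W r" "r ` (W \<inter> mtotal N) \<subseteq> mtotal M"
        and r: "\<And>z. z \<in> W \<inter> mtotal N \<Longrightarrow> \<phi> (mproj M (r z)) = mproj N z" by blast
      have ry: "r y \<in> mtotal M" using W y by blast
      moreover have "mproj M (r y) \<in> {p \<in> mpoints M. \<phi> p \<in> U}"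
        using ry r[of y] W(1) y by (auto simp: mpoints_def)
      ultimately obtain V F where V: "r y \<in> V" "extends_on M V F (f \<circ> \<phi>)"
        using f[unfolded msmooth_iff, rule_format, of "r y"] by blast
      have "extends_on N (W \<inter> r -` V) (\<lambda>z. F (r z)) f"
        by (rule extends_on_compose[OF W(2,3) V(2)]) (use r in auto)
      then show "\<exists>W F. y \<in> W \<and> extends_on N W F f"
        using W(1) V(1) by (intro exI[of _ "W \<inter> r -` V"] exI[of _ "\<lambda>z. F (r z)"]) simp
    qed
  qed
  moreover have "mbracket M (f \<circ> \<phi>) (g \<circ> \<phi>) p = mbracket N f g (\<phi> p)"
    if asm: "mopen N U" "msmooth N U f" "msmooth N U g" "p \<in> mpoints M" "\<phi> p \<in> U" for U f g p
  proof -
    obtain x where x: "x \<in> mtotal M" "p = mproj M x" using asm(4) by (auto simp: mpoints_def)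
    have Tx: "T x \<in> mtotal N" "mproj N (T x) \<in> U" using x T(2) \<phi> asm by auto
    obtain W F G where W: "T x \<in> W" "extends_on N W F f" "extends_on N W G g"
      by (rule msmooth_extends_on2[OF asm(2,3) Tx])
    have "extends_on M (UNIV \<inter> T -` W) (\<lambda>z. F (T z)) (f \<circ> \<phi>)"
      by (rule extends_on_compose[OF T(1) _ W(2)]) (use T(2) \<phi> in auto)
    moreover have "extends_on M (UNIV \<inter> T -` W) (\<lambda>z. G (T z)) (g \<circ> \<phi>)"
      by (rule extends_on_compose[OF T(1) _ W(3)]) (use T(2) \<phi> in auto)
    ultimately have "mbracket M (f \<circ> \<phi>) (g \<circ> \<phi>) p = P x (\<lambda>z. F (T z)) (\<lambda>z. G (T z))"
      unfolding x(2) using W(1) by (intro presentsD[OF M x(1)]) auto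
    also have "\<dots> = Q (T x) F G"
      using bracket[OF x(1) W(1)] W(2,3) by (auto simp: extends_on_def)
    also have "\<dots> = mbracket N f g (\<phi> p)"
      unfolding x(2) \<phi>[OF x(1)] by (rule presentsD[OF N Tx(1) W, symmetric])
    finally show ?thesis .
  qed
  ultimately have "poisson_diffeo \<phi> M N"
    using bij unfolding poisson_diffeo_def by blast
  then show ?thesis unfolding poisson_diffeomorphic_def by blast
qed

lemma poisson_diffeoD:
  assumes "poisson_diffeo \<phi> M N"
  shows "bij_betw \<phi> (mpoints M) (mpoints N)"
    and "U \<subseteq> mpoints N \<Longrightarrow> mopen N U \<longleftrightarrow> mopen M {p \<in> mpoints M. \<phi> p \<in> U}"
    and "mopen N U \<Longrightarrow> msmooth N U f \<longleftrightarrow> msmooth M {p \<in> mpoints M. \<phi> p \<in> U} (f \<circ> \<phi>)"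
    and "mopen N U \<Longrightarrow> msmooth N U f \<Longrightarrow> msmooth N U g \<Longrightarrow> p \<in> mpoints M \<Longrightarrow> \<phi> p \<in> U \<Longrightarrow>
      mbracket M (f \<circ> \<phi>) (g \<circ> \<phi>) p = mbracket N f g (\<phi> p)"
proof -
  note d = assms[unfolded poisson_diffeo_def]
  show "bij_betw \<phi> (mpoints M) (mpoints N)" by (rule d[THEN conjunct1])
  show "U \<subseteq> mpoints N \<Longrightarrow> mopen N U \<longleftrightarrow> mopen M {p \<in> mpoints M. \<phi> p \<in> U}"
    by (rule d[THEN conjunct2, THEN conjunct1, rule_format])
  show "mopen N U \<Longrightarrow> msmooth N U f \<longleftrightarrow> msmooth M {p \<in> mpoints M. \<phi> p \<in> U} (f \<circ> \<phi>)"
    by (rule d[THEN conjunct2, THEN conjunct2, THEN conjunct1, rule_format])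
  show "mopen N U \<Longrightarrow> msmooth N U f \<Longrightarrow> msmooth N U g \<Longrightarrow> p \<in> mpoints M \<Longrightarrow> \<phi> p \<in> U \<Longrightarrow>
      mbracket M (f \<circ> \<phi>) (g \<circ> \<phi>) p = mbracket N f g (\<phi> p)"
    by (rule d[THEN conjunct2, THEN conjunct2, THEN conjunct2, rule_format]) auto
qed

lemma poisson_diffeomorphic_trans:
  assumes "poisson_diffeomorphic M N" "poisson_diffeomorphic N L"
  shows "poisson_diffeomorphic M L"
proof -
  obtain \<phi> \<psi> where 1: "poisson_diffeo \<phi> M N" and 2: "poisson_diffeo \<psi> N L"
    using assms by (auto simp: poisson_diffeomorphic_def)
  have b: "bij_betw \<phi> (mpoints M) (mpoints N)" "bij_betw \<psi> (mpoints N) (mpoints L)"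
    using 1 2 by (auto simp: poisson_diffeo_def)
  have \<phi>: "p \<in> mpoints M \<Longrightarrow> \<phi> p \<in> mpoints N" for p using b(1) bij_betwE by blast
  let ?V = "\<lambda>U. {p \<in> mpoints N. \<psi> p \<in> U}"
  have V: "{p \<in> mpoints M. (\<psi> \<circ> \<phi>) p \<in> U} = {p \<in> mpoints M. \<phi> p \<in> ?V U}" for U
    using \<phi> by auto
  have "poisson_diffeo (\<psi> \<circ> \<phi>) M L"
    unfolding poisson_diffeo_def V
  proof (intro conjI allI impI ballI)
    show "bij_betw (\<psi> \<circ> \<phi>) (mpoints M) (mpoints L)" using b by (rule bij_betw_trans)
  next
    fix U assume "U \<subseteq> mpoints L"
    then show "mopen L U \<longleftrightarrow> mopen M {p \<in> mpoints M. \<phi> p \<in> ?V U}"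
      by (simp add: poisson_diffeoD(2)[OF 2] poisson_diffeoD(2)[OF 1])
  next
    fix U f assume U: "mopen L U"
    then have "mopen N (?V U)" using poisson_diffeoD(2)[OF 2, of U] by (simp add: mopen_def)
    with U show "msmooth L U f \<longleftrightarrow> msmooth M {p \<in> mpoints M. \<phi> p \<in> ?V U} (f \<circ> (\<psi> \<circ> \<phi>))"
      by (simp add: poisson_diffeoD(3)[OF 2] poisson_diffeoD(3)[OF 1] o_assoc)
  next
    fix U f g p assume U: "mopen L U \<and> msmooth L U f \<and> msmooth L U g"
      and p: "p \<in> mpoints M" "(\<psi> \<circ> \<phi>) p \<in> U"
    have "mopen N (?V U)" "msmooth N (?V U) (f \<circ> \<psi>)" "msmooth N (?V U) (g \<circ> \<psi>)"
      using U poisson_diffeoD(2)[OF 2, of U] poisson_diffeoD(3)[OF 2, of U]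
      by (simp_all add: mopen_def)
    moreover have "\<phi> p \<in> ?V U" using p \<phi>[OF p(1)] by simp
    ultimately have "mbracket M (f \<circ> \<psi> \<circ> \<phi>) (g \<circ> \<psi> \<circ> \<phi>) p = mbracket N (f \<circ> \<psi>) (g \<circ> \<psi>) (\<phi> p)"
      using p(1) by (intro poisson_diffeoD(4)[OF 1])
    also have "\<dots> = mbracket L f g (\<psi> (\<phi> p))"
      using U p \<phi>[OF p(1)] by (intro poisson_diffeoD(4)[OF 2]) auto
    finally show "mbracket M (f \<circ> (\<psi> \<circ> \<phi>)) (g \<circ> (\<psi> \<circ> \<phi>)) p = mbracket L f g ((\<psi> \<circ> \<phi>) p)"
      by (simp add: o_assoc)
  qed
  then show ?thesis unfolding poisson_diffeomorphic_def by blast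
qed

text \<open>
  Symmetry needs a bracket that ignores values of functions outside the points of the manifold,
  as in general \<open>f \<circ> \<phi>\<^sup>-\<^sup>1 \<circ> \<phi> = f\<close> holds only there.
\<close>

definition bracket_local :: "('a, 'p) pman \<Rightarrow> bool" where
  "bracket_local M \<longleftrightarrow> (\<forall>f f' g g' p. (\<forall>p \<in> mpoints M. f p = f' p) \<longrightarrow>
     (\<forall>p \<in> mpoints M. g p = g' p) \<longrightarrow> p \<in> mpoints M \<longrightarrow> mbracket M f g p = mbracket M f' g' p)"

lemma bracket_local_embedded: "bracket_local (embedded_poisson P S)"
  unfolding bracket_local_def embedded_poisson_def mpoints_def
  by simp

lemma bracket_local_quotient:
  assumes "bracket_local M" shows "bracket_local (quotient_poisson q M)"
  unfolding bracket_local_def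
proof (intro allI impI)
  fix f f' g g' :: "'c \<Rightarrow> real" and y
  assume e: "\<forall>p \<in> mpoints (quotient_poisson q M). f p = f' p"
    "\<forall>p \<in> mpoints (quotient_poisson q M). g p = g' p"
  have "mpoints (quotient_poisson q M) = q ` mpoints M"
    by (auto simp: mpoints_def quotient_poisson_def)
  with e have "mbracket M (f \<circ> q) (g \<circ> q) p = mbracket M (f' \<circ> q) (g' \<circ> q) p"
    if "p \<in> mpoints M" for p
    using that by (intro assms[unfolded bracket_local_def, rule_format]) simp_all
  then show "mbracket (quotient_poisson q M) f g y = mbracket (quotient_poisson q M) f' g' y"
    by (simp add: quotient_poisson_def cong: ball_cong)
qed

lemma poisson_diffeomorphic_sym:
  assumes M: "bracket_local M" and "poisson_diffeomorphic M N"
  shows "poisson_diffeomorphic N M"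
proof -
  obtain \<phi> where \<phi>: "poisson_diffeo \<phi> M N"
    using assms by (auto simp: poisson_diffeomorphic_def)
  have b: "bij_betw \<phi> (mpoints M) (mpoints N)"
    using \<phi> by (auto simp: poisson_diffeo_def)
  define \<psi> where "\<psi> = inv_into (mpoints M) \<phi>"
  have \<psi>\<phi>: "p \<in> mpoints M \<Longrightarrow> \<psi> (\<phi> p) = p" and \<phi>\<psi>: "q \<in> mpoints N \<Longrightarrow> \<phi> (\<psi> q) = q"
    and in_M: "q \<in> mpoints N \<Longrightarrow> \<psi> q \<in> mpoints M" and in_N: "p \<in> mpoints M \<Longrightarrow> \<phi> p \<in> mpoints N" for p q
    unfolding \<psi>_def using b
    by (auto simp: bij_betw_inv_into_left bij_betw_inv_into_right bij_betw_def inv_into_into)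
  let ?V = "\<lambda>U. {q \<in> mpoints N. \<psi> q \<in> U}"
  have VU: "{p \<in> mpoints M. \<phi> p \<in> ?V U} = U" if "U \<subseteq> mpoints M" for U
    using that in_N \<psi>\<phi> by auto
  have smooth_cong: "msmooth M U f \<longleftrightarrow> msmooth M U (f \<circ> \<psi> \<circ> \<phi>)" for U f
    unfolding msmooth_def by (simp add: \<psi>\<phi> mpoints_def)
  have o: "mopen M U \<longleftrightarrow> mopen N (?V U)" if "U \<subseteq> mpoints M" for U
  proof -
    have "?V U \<subseteq> mpoints N" by blast
    then have "mopen N (?V U) \<longleftrightarrow> mopen M {p \<in> mpoints M. \<phi> p \<in> ?V U}"
      using \<phi> unfolding poisson_diffeo_def by blast
    then show ?thesis unfolding VU[OF that] by simp
  qed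
  have s: "msmooth M U f \<longleftrightarrow> msmooth N (?V U) (f \<circ> \<psi>)" if "mopen M U" for U f
  proof -
    have U: "U \<subseteq> mpoints M" using that by (simp add: mopen_def)
    have "mopen N (?V U)" using o[OF U] that by blast
    then have "msmooth N (?V U) (f \<circ> \<psi>) \<longleftrightarrow> msmooth M {p \<in> mpoints M. \<phi> p \<in> ?V U} (f \<circ> \<psi> \<circ> \<phi>)"
      using \<phi> unfolding poisson_diffeo_def by blast
    then show ?thesis unfolding VU[OF U] smooth_cong[of U f] by simp
  qed
  have "poisson_diffeo \<psi> N M"
    unfolding poisson_diffeo_def
  proof (intro conjI allI impI ballI)
    show "bij_betw \<psi> (mpoints N) (mpoints M)"
      unfolding \<psi>_def by (rule bij_betw_inv_into[OF b])
  next
    fix U f g q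
    assume U: "mopen M U \<and> msmooth M U f \<and> msmooth M U g" and q: "q \<in> mpoints N" "\<psi> q \<in> U"
    have "U \<subseteq> mpoints M" using U by (simp add: mopen_def)
    then have "mopen N (?V U)" "msmooth N (?V U) (f \<circ> \<psi>)" "msmooth N (?V U) (g \<circ> \<psi>)"
      using o U s by blast+
    moreover have "\<phi> (\<psi> q) \<in> ?V U" using q \<phi>\<psi> by simp
    ultimately have "mbracket M (f \<circ> \<psi> \<circ> \<phi>) (g \<circ> \<psi> \<circ> \<phi>) (\<psi> q) = mbracket N (f \<circ> \<psi>) (g \<circ> \<psi>) (\<phi> (\<psi> q))"
      using \<phi> in_M[OF q(1)] unfolding poisson_diffeo_def by blast
    moreover have "mbracket M (f \<circ> \<psi> \<circ> \<phi>) (g \<circ> \<psi> \<circ> \<phi>) (\<psi> q) = mbracket M f g (\<psi> q)"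
      using M in_M[OF q(1)] unfolding bracket_local_def by (simp add: \<psi>\<phi>)
    ultimately show "mbracket N (f \<circ> \<psi>) (g \<circ> \<psi>) q = mbracket M f g (\<psi> q)"
      using \<phi>\<psi>[OF q(1)] by simp
  qed (use o s in blast)+
  then show ?thesis unfolding poisson_diffeomorphic_def by blast
qed

section \<open>Unitary matrices\<close>

lemma idx_less_iff [simp]: "idx i < idx j \<longleftrightarrow> i < j"
proof -
  have mono: "idx i < idx j" if "i < j" for i j :: 'a
    unfolding idx_def
  proof (rule psubset_card_mono)
    have "j \<in> {k. k \<le> j}" "j \<notin> {k. k \<le> i}" using that by auto
    then show "{k. k \<le> i} \<subset> {k. k \<le> j}" using that by (blast intro: order_trans less_imp_le)
  qed simp
  show ?thesis
    using mono[of i j] mono[of j i] by (cases i j rule: linorder_cases) auto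
qed

lemma idx_le_iff [simp]: "idx i \<le> idx j \<longleftrightarrow> i \<le> j"
  using idx_less_iff[of j i] by (simp only: not_less[symmetric])

lemma idx_eq_iff [simp]: "idx i = idx j \<longleftrightarrow> i = j"
  by (auto simp: eq_iff idx_le_iff[symmetric] simp del: idx_le_iff)

lemma idx_range: "idx (i::'d::{finite,linorder}) \<in> {1..CARD('d)}"
proof -
  have "{i} \<subseteq> {j. j \<le> i}" by auto
  then have "card {i} \<le> idx i" unfolding idx_def by (intro card_mono) auto
  then show ?thesis unfolding idx_def by (auto intro: card_mono)
qed

lemma idx_pos [simp]: "Suc 0 \<le> idx i" "1 \<le> idx i" "0 < idx i" "idx (i::'d::{finite,linorder}) \<le> CARD('d)"
  using idx_range[of i] by auto

lemma bij_betw_idx: "bij_betw (idx :: 'd::{finite,linorder} \<Rightarrow> nat) UNIV {1..CARD('d)}"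
proof -
  have "inj (idx :: 'd \<Rightarrow> nat)" by (simp add: inj_def)
  moreover from this have "range (idx :: 'd \<Rightarrow> nat) = {1..CARD('d)}"
    by (intro card_subset_eq) (auto simp: card_image)
  ultimately show ?thesis by (simp add: bij_betw_def)
qed

lemma obtain_idx:
  assumes "1 \<le> p" "p \<le> CARD('d::{finite,linorder})"
  obtains i :: "'d::{finite,linorder}" where "idx i = p"
proof -
  have "p \<in> range (idx :: 'd \<Rightarrow> nat)"
    using assms by (simp add: bij_betw_imp_surj_on[OF bij_betw_idx])
  with that show thesis by blast
qed

lemma conj_transpose_nth [simp]: "conj_transpose A $ i $ j = cnj (A $ j $ i)"
  by (simp add: conj_transpose_def)

lemma conj_transpose_mult: "conj_transpose (A ** B) = conj_transpose B ** conj_transpose A"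
  by (simp add: vec_eq_iff matrix_matrix_mult_def mult.commute)

lemma conj_transpose_conj_transpose [simp]: "conj_transpose (conj_transpose A) = A"
  by (simp add: vec_eq_iff)

lemma conj_transpose_mat_1 [simp]: "conj_transpose (mat 1) = mat 1"
  by (simp add: vec_eq_iff mat_def)

lemma det_conj_transpose: "det (conj_transpose A) = cnj (det A)"
proof -
  have "conj_transpose A = transpose (\<chi> i j. cnj (A $ i $ j))"
    by (simp add: vec_eq_iff transpose_def)
  then have "det (conj_transpose A) = det (\<chi> i j. cnj (A $ i $ j))"
    by (simp add: det_transpose)
  also have "\<dots> = cnj (det A)" by (simp add: det_def)
  finally show ?thesis .
qed

lemma unitary_groupD:
  "A \<in> unitary_group \<Longrightarrow> A ** conj_transpose A = mat 1"
  "A \<in> unitary_group \<Longrightarrow> conj_transpose A ** A = mat 1"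
  by (simp_all add: unitary_group_def)

lemma unitary_groupI: "A ** conj_transpose A = mat 1 \<Longrightarrow> A \<in> unitary_group"
  by (simp add: unitary_group_def matrix_left_right_inverse)

lemma unitary_cancel:
  assumes "A \<in> unitary_group"
  shows "A ** (conj_transpose A ** B) = B" "conj_transpose A ** (A ** B) = B"
    "B ** A ** conj_transpose A = B" "B ** conj_transpose A ** A = B"
  using unitary_groupD[OF assms] by (simp_all add: matrix_mul_assoc) (simp_all add: matrix_mul_assoc[symmetric])

lemma unitary_mult: "A \<in> unitary_group \<Longrightarrow> B \<in> unitary_group \<Longrightarrow> A ** B \<in> unitary_group"
  by (intro unitary_groupI)
    (simp add: conj_transpose_mult matrix_mul_assoc unitary_cancel unitary_groupD)

lemma unitary_conj_transpose: "A \<in> unitary_group \<Longrightarrow> conj_transpose A \<in> unitary_group"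
  by (simp add: unitary_group_def)

lemma unitary_mat_1: "mat 1 \<in> unitary_group"
  by (simp add: unitary_group_def)

lemma unitary_matrix_inv: "A \<in> unitary_group \<Longrightarrow> matrix_inv A = conj_transpose A"
  unfolding matrix_inv_def
  by (rule some_equality) (use unitary_groupD unitary_cancel in \<open>metis matrix_mul_lid\<close>)+

lemma unitary_det: "A \<in> unitary_group \<Longrightarrow> det A * cnj (det A) = 1"
  using unitary_groupD(1)[of A] by (metis det_I det_conj_transpose det_mul)

lemma unitary_det_norm: "A \<in> unitary_group \<Longrightarrow> cmod (det A) = 1"
  using unitary_det[of A] complex_norm_square[of "det A"]
  by (metis norm_ge_zero norm_mult norm_one complex_mod_cnj real_sqrt_abs2 abs_of_nonneg real_sqrt_one)

lemma special_unitary_mult: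
  "A \<in> special_unitary_group \<Longrightarrow> B \<in> special_unitary_group \<Longrightarrow> A ** B \<in> special_unitary_group"
  by (simp add: special_unitary_group_def unitary_mult det_mul)

lemma special_unitary_conj_transpose:
  "A \<in> special_unitary_group \<Longrightarrow> conj_transpose A \<in> special_unitary_group"
  by (simp add: special_unitary_group_def unitary_conj_transpose det_conj_transpose)

lemma cmat_add_rdistrib: "((A + B) ** C :: 'd::finite cmat) = A ** C + B ** C"
  by (simp add: vec_eq_iff matrix_matrix_mult_def distrib_right sum.distrib)

lemma bounded_linear_matrix_mult_left: "bounded_linear (\<lambda>B::'d::finite cmat. A ** B)"
  by (rule linear_conv_bounded_linear[THEN iffD1], rule linearI)
    (simp_all add: matrix_add_ldistrib matrix_scalar_ac scalar_matrix_assoc)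

lemma bounded_linear_matrix_mult_right: "bounded_linear (\<lambda>B. B ** (A :: 'd::finite cmat) :: 'd cmat)"
  by (rule linear_conv_bounded_linear[THEN iffD1], rule linearI)
    (simp_all only: cmat_add_rdistrib scalar_matrix_assoc)

text \<open>
  \<open>tangent_unit a b \<i>\<close> and \<open>tangent_unit a b 1\<close> are the matrices \<open>X\<^sup>+\<close> and \<open>X\<^sup>-\<close> of the pair
  \<open>a \<noteq> b\<close>; a complex parameter treats them as one complex coordinate.
\<close>

definition tangent_unit :: "'d::finite \<Rightarrow> 'd \<Rightarrow> complex \<Rightarrow> 'd cmat" where
  "tangent_unit a b z = (\<chi> i j. if i = a \<and> j = b then z else if i = b \<and> j = a then - cnj z else 0)"

lemma tangent_unit_nth:
  "tangent_unit a b z $ i $ j = (if i = a \<and> j = b then z else if i = b \<and> j = a then - cnj z else 0)"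
  by (simp add: tangent_unit_def)

lemma Xplus_idx: "a \<noteq> b \<Longrightarrow> Xplus (idx a) (idx b) = tangent_unit a b \<i>"
  by (simp add: Xplus_def vec_eq_iff tangent_unit_nth munit_def matrix_matrix_mult_def mat_def
      if_distrib[of "\<lambda>x. x * _"] cong: if_cong)

lemma Xminus_idx: "a \<noteq> b \<Longrightarrow> Xminus (idx a) (idx b) = tangent_unit a b 1"
  by (auto simp: Xminus_def vec_eq_iff tangent_unit_nth munit_def)

text \<open>A real linear functional on this complex coordinate is therefore known from its values
  at \<open>1\<close> and \<i>.\<close>

lemma tangent_unit_decomp:
  "a \<noteq> b \<Longrightarrow> tangent_unit a b z = Re z *\<^sub>R tangent_unit a b 1 + Im z *\<^sub>R tangent_unit a b \<i>"
  by (auto simp: vec_eq_iff tangent_unit_nth complex_eq_iff)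

section \<open>The standard bivector field\<close>

definition wedge :: "('v \<Rightarrow> real) \<Rightarrow> ('v \<Rightarrow> real) \<Rightarrow> 'v \<Rightarrow> 'v \<Rightarrow> real" where
  "wedge \<phi> \<psi> X Y = \<phi> X * \<psi> Y - \<phi> Y * \<psi> X"

lemma wedge_at_eq: "wedge_at x A B F G = wedge (frechet_derivative F (at x)) (frechet_derivative G (at x)) A B"
  by (simp add: wedge_at_def wedge_def)

abbreviation left_wedge :: "'d::finite cmat \<Rightarrow> 'd \<Rightarrow> 'd \<Rightarrow> ('d cmat \<Rightarrow> real) \<Rightarrow> ('d cmat \<Rightarrow> real) \<Rightarrow> real" where
  "left_wedge g a b \<equiv> wedge_at g (g ** tangent_unit a b \<i>) (g ** tangent_unit a b 1)"

abbreviation right_wedge :: "'d::finite cmat \<Rightarrow> 'd \<Rightarrow> 'd \<Rightarrow> ('d cmat \<Rightarrow> real) \<Rightarrow> ('d cmat \<Rightarrow> real) \<Rightarrow> real" where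
  "right_wedge g a b \<equiv> wedge_at g (tangent_unit a b \<i> ** g) (tangent_unit a b 1 ** g)"

text \<open>Replaces the numbers by elements of the index type, where pairs can be sorted by
  classes.\<close>

lemma std_bivector_eq:
  fixes g :: "'d::{finite,linorder} cmat"
  shows "std_bivector g F G = (\<Sum>(a,b) | a < b.
     left_wedge g a b F G
     - right_wedge g a b F G)"
proof -
  let ?w = "\<lambda>i j. wedge_at g (g ** Xplus i j) (g ** Xminus i j) F G
     - wedge_at g (Xplus i j ** g) (Xminus i j ** g) F G"
  have "std_bivector g F G = (\<Sum>(j,i) \<in> Sigma {1..CARD('d)} (\<lambda>j. {1..<j}). ?w i j)"
    unfolding std_bivector_def by (rule sum.Sigma) auto
  also have "\<dots> = (\<Sum>(a,b) | a < b. ?w (idx a) (idx (b::'d)))"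
  proof (rule sum.reindex_bij_witness[of _ "\<lambda>(a,b). (idx b, idx a)"
        "\<lambda>(j,i). (inv_into UNIV idx i, inv_into UNIV idx j)"], goal_cases)
    case (1 x)
    then obtain j i where x: "x = (j, i)" "1 \<le> i" "i < j" "j \<le> CARD('d)" by auto
    then show ?case
      using bij_betw_inv_into_right[OF bij_betw_idx[where 'd = 'd]] by auto
  next
    case (2 x)
    then obtain j i where x: "x = (j, i)" "1 \<le> i" "i < j" "j \<le> CARD('d)" by auto
    then have "idx (inv_into UNIV idx i :: 'd) = i" "idx (inv_into UNIV idx j :: 'd) = j"
      using bij_betw_inv_into_right[OF bij_betw_idx[where 'd = 'd]] by auto
    then show ?case using x by (auto simp: idx_less_iff[symmetric] simp del: idx_less_iff)
  next
    case (3 y)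
    then show ?case
      using bij_betw_inv_into_left[OF bij_betw_idx[where 'd = 'd]] by auto
  next
    case (4 y)
    then show ?case by auto
  next
    case (5 x)
    then obtain j i where x: "x = (j, i)" "1 \<le> i" "i < j" "j \<le> CARD('d)" by auto
    then show ?case
      using bij_betw_inv_into_right[OF bij_betw_idx[where 'd = 'd]] by auto
  qed
  also have "\<dots> = (\<Sum>(a,b) | a < b.
     left_wedge g a b F G
     - right_wedge g a b F G)"
    by (intro sum.cong) (auto simp: Xplus_idx Xminus_idx)
  finally show ?thesis .
qed

text \<open>
  The pairs of indices in different diagonal blocks contribute to \<open>r\<close> the imaginary part of a
  Hermitian form, which a block diagonal unitary matrix preserves.
\<close>

lemma off_diagonal_invariant:
  fixes \<phi> \<psi> :: "'d::finite cmat \<Rightarrow> real" and \<kappa> :: "'d \<Rightarrow> nat"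
  assumes \<phi>: "linear \<phi>" and \<psi>: "linear \<psi>" and s: "s \<in> unitary_group"
    and block: "\<And>i j. \<kappa> i \<noteq> \<kappa> j \<Longrightarrow> s $ i $ j = 0"
  shows "(\<Sum>(a,b) | \<kappa> a < \<kappa> b. wedge \<phi> \<psi> (s ** tangent_unit a b \<i>) (s ** tangent_unit a b 1)) =
    (\<Sum>(a,b) | \<kappa> a < \<kappa> b. wedge \<phi> \<psi> (tangent_unit a b \<i> ** s) (tangent_unit a b 1 ** s))"
proof -
  \<comment> \<open>The complex matrix of a real functional: for linear \<open>\<omega>\<close> and
    \<open>\<kappa> p < \<kappa> q\<close>, the value of \<open>\<omega>\<close> on
    \<open>tangent_unit p q u ** s\<close> is
    \<open>Re (cnj u * C \<omega> $ p $ q)\<close>.\<close>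
  define C :: "('d cmat \<Rightarrow> real) \<Rightarrow> 'd cmat" where
    "C \<omega> = (\<chi> p q. if \<kappa> p < \<kappa> q then Complex (\<omega> (tangent_unit p q 1 ** s)) (\<omega> (tangent_unit p q \<i> ** s)) else 0)" for \<omega>
  have C0: "C \<omega> $ p $ q = 0" if "\<not> \<kappa> p < \<kappa> q" for \<omega> p q
    using that by (simp add: C_def)
  define C' where "C' \<omega> = conj_transpose s ** C \<omega> ** s" for \<omega>
  \<comment> \<open>Conjugation by \<open>s\<close> stays in the span of off-diagonal units: as
    \<open>s\<close> is block diagonal, the coefficient at \<open>(p, q)\<close> vanishes unless
    \<open>p\<close> lies in the class of \<open>a\<close> and \<open>q\<close> in that of
    \<open>b\<close>.\<close>
  have conj: "s ** tangent_unit a b z =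
      (\<Sum>(p,q) | \<kappa> p < \<kappa> q. tangent_unit p q (s $ p $ a * z * cnj (s $ q $ b)) ** s)"
    if ab: "\<kappa> a < \<kappa> b" for a b z
  proof -
    have nab: "a \<noteq> b" using ab by auto
    define Z where "Z p q = s $ p $ a * z * cnj (s $ q $ b)" for p q
    have Z0: "Z p q = 0" if "\<not> \<kappa> p < \<kappa> q" for p q
      using block[of p a] block[of q b] ab that unfolding Z_def by force
    have "(s ** tangent_unit a b z ** conj_transpose s) $ i $ j
        = (\<Sum>(p,q) | \<kappa> p < \<kappa> q. tangent_unit p q (Z p q)) $ i $ j" for i j
    proof -
      have "(s ** tangent_unit a b z) $ i $ m = (if m = b then s $ i $ a * z else 0)
          - (if m = a then s $ i $ b * cnj z else 0)" for m
        using nab by (auto simp: matrix_matrix_mult_def tangent_unit_nth if_distrib[of "\<lambda>x. _ * x"]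
            sum.delta cong: if_cong)
      then have "(s ** tangent_unit a b z ** conj_transpose s) $ i $ j = Z i j - cnj (Z j i)"
        unfolding matrix_matrix_mult_def[of "s ** tangent_unit a b z"]
        by (simp add: left_diff_distrib sum_subtractf if_distrib[of "\<lambda>x. x * _"] Z_def cong: if_cong)
      moreover have "(\<Sum>(p,q) | \<kappa> p < \<kappa> q. tangent_unit p q (Z p q)) $ i $ j =
        (\<Sum>(p,q) | \<kappa> p < \<kappa> q. (if p = i \<and> q = j then Z i j else 0) + (if p = j \<and> q = i then - cnj (Z j i) else 0))"
      proof -
        have "tangent_unit p q (Z p q) $ i $ j =
            (if p = i \<and> q = j then Z i j else 0) + (if p = j \<and> q = i then - cnj (Z j i) else 0)"
          if "p \<noteq> q" for p q
          using that by (simp add: tangent_unit_nth)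
        note pt = this
        show ?thesis
          unfolding sum_component
        proof (rule sum.cong[OF refl])
          fix x assume "x \<in> {(p, q). \<kappa> p < \<kappa> q}"
          then obtain p q where x: "x = (p, q)" "p \<noteq> q" by auto
          show "(case x of (p, q) \<Rightarrow> tangent_unit p q (Z p q)) $ i $ j =
            (case x of (p, q) \<Rightarrow> (if p = i \<and> q = j then Z i j else 0) + (if p = j \<and> q = i then - cnj (Z j i) else 0))"
            unfolding x(1) prod.case by (rule pt[OF x(2)])
        qed
      qed
      moreover have "(\<Sum>(p,q) | \<kappa> p < \<kappa> q. (if p = i \<and> q = j then Z i j else 0) + (if p = j \<and> q = i then - cnj (Z j i) else 0))
        = (\<Sum>x | \<kappa> (fst x) < \<kappa> (snd x). if x = (i, j) then Z i j else 0) +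
          (\<Sum>x | \<kappa> (fst x) < \<kappa> (snd x). if x = (j, i) then - cnj (Z j i) else 0)"
        unfolding sum.distrib[symmetric] by (intro sum.cong) (auto split: if_splits)
      moreover have "\<dots> = Z i j - cnj (Z j i)"
        using Z0 by (auto simp: sum.delta)
      ultimately show ?thesis by simp
    qed
    then have "s ** tangent_unit a b z ** conj_transpose s = (\<Sum>(p,q) | \<kappa> p < \<kappa> q. tangent_unit p q (Z p q))"
      by (simp add: vec_eq_iff)
    then have "s ** tangent_unit a b z = (\<Sum>(p,q) | \<kappa> p < \<kappa> q. tangent_unit p q (Z p q)) ** s"
      using unitary_cancel(4)[OF s] by metis
    also have "\<dots> = (\<Sum>(p,q) | \<kappa> p < \<kappa> q. tangent_unit p q (Z p q) ** s)"
      using bounded_linear.linear[OF bounded_linear_matrix_mult_right, THEN linear_sum]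
      by (simp add: case_prod_unfold)
    finally show ?thesis unfolding Z_def .
  qed
  \<comment> \<open>Passing from right to left translates by \<open>s\<close> thus replaces the
    coordinate matrix \<open>C \<omega>\<close> by its unitary conjugate
    \<open>C' \<omega>\<close>.\<close>
  have app: "\<omega> (s ** tangent_unit a b z) = Re (cnj z * C' \<omega> $ a $ b)"
    if lin: "linear \<omega>" and ab: "\<kappa> a < \<kappa> b" for \<omega> a b z
  proof -
    have "\<omega> (tangent_unit p q u ** s) = Re (cnj u * C \<omega> $ p $ q)" if "\<kappa> p < \<kappa> q" for p q u
    proof -
      have "p \<noteq> q" using that by auto
      from tangent_unit_decomp[OF this, of u]
      have "tangent_unit p q u ** s = Re u *\<^sub>R (tangent_unit p q 1 ** s) + Im u *\<^sub>R (tangent_unit p q \<i> ** s)"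
        by (simp add: cmat_add_rdistrib scalar_matrix_assoc)
      then show ?thesis
        using that by (simp add: linear_add[OF lin] linear_cmul[OF lin] C_def)
    qed
    then have "\<omega> (s ** tangent_unit a b z) =
        (\<Sum>(p,q) | \<kappa> p < \<kappa> q. Re (cnj (s $ p $ a * z * cnj (s $ q $ b)) * C \<omega> $ p $ q))"
      unfolding conj[OF ab] linear_sum[OF lin] by (intro sum.cong) (auto simp: algebra_simps)
    also have "\<dots> = (\<Sum>(p,q)\<in>UNIV. Re (cnj (s $ p $ a * z * cnj (s $ q $ b)) * C \<omega> $ p $ q))"
      by (rule sum.mono_neutral_left) (auto, rule ccontr, simp add: C0)
    also have "\<dots> = Re (cnj z * (\<Sum>(p,q)\<in>UNIV. cnj (s $ p $ a) * C \<omega> $ p $ q * s $ q $ b))"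
      by (simp only: sum_distrib_left case_prod_unfold Re_sum[symmetric] complex_cnj_mult complex_cnj_cnj)
        (simp add: mult_ac)
    also have "(\<Sum>(p,q)\<in>UNIV. cnj (s $ p $ a) * C \<omega> $ p $ q * s $ q $ b) = C' \<omega> $ a $ b"
      unfolding C'_def matrix_matrix_mult_def
      by (simp add: sum_distrib_right UNIV_Times_UNIV[symmetric] sum.cartesian_product[symmetric]
          del: UNIV_Times_UNIV) (rule sum.swap)
    finally show ?thesis .
  qed
  \<comment> \<open>This support condition lets the sum over pairs of classes be written as a trace
    over all pairs.\<close>
  have supp: "C' \<omega> $ a $ b = 0" if "\<not> \<kappa> a < \<kappa> b" for \<omega> a b
  proof -
    have "cnj (s $ p $ a) * C \<omega> $ p $ q * s $ q $ b = 0" for p q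
      using block[of p a] block[of q b] that C0[of p q \<omega>] by force
    then show ?thesis
      unfolding C'_def matrix_matrix_mult_def
      by (simp only: vec_lambda_beta conj_transpose_nth sum_distrib_right sum.neutral_const)
  qed
  \<comment> \<open>In coordinates \<open>A\<close>, \<open>B\<close> of two functionals, the wedge
    evaluated on \<i> and \<open>1\<close> is \<open>Im (A * cnj B)\<close>, so the sum is the
    imaginary part of the Hermitian trace form, which unitary conjugation preserves.\<close>
  have form: "(\<Sum>(a,b) | \<kappa> a < \<kappa> b. Im (A $ a $ b * cnj (B $ a $ b))) = Im (trace (A ** conj_transpose B))"
    if "\<And>a b. \<not> \<kappa> a < \<kappa> b \<Longrightarrow> A $ a $ b = 0" for A B :: "'d cmat"
  proof -
    have "(\<Sum>(a,b) | \<kappa> a < \<kappa> b. Im (A $ a $ b * cnj (B $ a $ b))) = (\<Sum>(a,b)\<in>UNIV. Im (A $ a $ b * cnj (B $ a $ b)))"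
      by (intro sum.mono_neutral_left) (auto, rule ccontr, simp add: that)
    also have "\<dots> = Im (trace (A ** conj_transpose B))"
      by (simp only: trace_def matrix_matrix_mult_def vec_lambda_beta conj_transpose_nth Im_sum
          UNIV_Times_UNIV[symmetric] sum.cartesian_product[symmetric])
    finally show ?thesis .
  qed
  have "(\<Sum>(a,b) | \<kappa> a < \<kappa> b. wedge \<phi> \<psi> (s ** tangent_unit a b \<i>) (s ** tangent_unit a b 1)) =
      (\<Sum>(a,b) | \<kappa> a < \<kappa> b. Im (C' \<phi> $ a $ b * cnj (C' \<psi> $ a $ b)))"
    by (intro sum.cong) (auto simp: wedge_def app[OF \<phi>] app[OF \<psi>])
  also have "\<dots> = Im (trace (C' \<phi> ** conj_transpose (C' \<psi>)))"
    using supp by (rule form)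
  also have "C' \<phi> ** conj_transpose (C' \<psi>) = conj_transpose s ** (C \<phi> ** conj_transpose (C \<psi>) ** s)"
    unfolding C'_def conj_transpose_mult conj_transpose_conj_transpose
    by (simp add: matrix_mul_assoc unitary_cancel[OF s])
  also have "trace \<dots> = trace (C \<phi> ** conj_transpose (C \<psi>))"
    by (subst trace_mul_sym) (simp add: unitary_cancel[OF s])
  also have "Im \<dots> = (\<Sum>(a,b) | \<kappa> a < \<kappa> b. Im (C \<phi> $ a $ b * cnj (C \<psi> $ a $ b)))"
    by (rule form[symmetric]) (simp add: C_def)
  also have "\<dots> = (\<Sum>(a,b) | \<kappa> a < \<kappa> b. wedge \<phi> \<psi> (tangent_unit a b \<i> ** s) (tangent_unit a b 1 ** s))"
    by (intro sum.cong) (auto simp: wedge_def C_def)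
  finally show ?thesis .
qed

section \<open>Rotations\<close>

definition coord_proj :: "'d::finite \<Rightarrow> 'd \<Rightarrow> 'd cmat" where
  "coord_proj a b = (\<chi> i j. if i = j \<and> (i = a \<or> i = b) then 1 else 0)"

text \<open>For \<open>a \<noteq> b\<close> and \<open>cmod z = 1\<close> the square of
  \<open>tangent_unit a b z\<close> is \<open>- coord_proj a b\<close>, so this is the closed form
  of the exponential of \<open>t\<close> times \<open>tangent_unit a b z\<close>.\<close>

definition rotation :: "'d::finite \<Rightarrow> 'd \<Rightarrow> complex \<Rightarrow> real \<Rightarrow> 'd cmat" where
  "rotation a b z t = mat 1 + (cos t - 1) *\<^sub>R coord_proj a b + sin t *\<^sub>R tangent_unit a b z"

lemma rotation_nth:
  "a \<noteq> b \<Longrightarrow> rotation a b z t $ i $ j =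
    (if i = j then (if i = a \<or> i = b then of_real (cos t) else 1)
     else if i = a \<and> j = b then of_real (sin t) * z
     else if i = b \<and> j = a then - of_real (sin t) * cnj z else 0)"
  unfolding rotation_def by (auto simp: mat_def coord_proj_def tangent_unit_nth scaleR_conv_of_real[where 'a = complex])

lemma rotation_add:
  assumes ab: "a \<noteq> b" and z: "cmod z = 1"
  shows "rotation a b z s ** rotation a b z t = rotation a b z (s + t)"
proof -
  let ?E = "coord_proj a b" and ?X = "tangent_unit a b z"
  have zz: "z * cnj z = 1" using z complex_norm_square[of z] by simp
  have XM: "(?X ** M) $ i $ j = (if i = a then z * M $ b $ j else if i = b then - cnj z * M $ a $ j else 0)"
    for M :: "'a cmat" and i j
    using ab by (auto simp: matrix_matrix_mult_def tangent_unit_nth if_distrib[of "\<lambda>x. x * _"] cong: if_cong)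
  have EM: "(?E ** M) $ i $ j = (if i = a \<or> i = b then M $ i $ j else 0)" for M :: "'a cmat" and i j
  proof -
    have "(?E ** M) $ i $ j = (\<Sum>k\<in>UNIV. if k = i then (if i = a \<or> i = b then M $ i $ j else 0) else 0)"
      unfolding matrix_matrix_mult_def vec_lambda_beta coord_proj_def by (intro sum.cong) auto
    then show ?thesis by simp
  qed
  have ME: "(M ** ?E) $ i $ j = (if j = a \<or> j = b then M $ i $ j else 0)" for M :: "'a cmat" and i j
  proof -
    have "(M ** ?E) $ i $ j = (\<Sum>k\<in>UNIV. if k = j then (if j = a \<or> j = b then M $ i $ j else 0) else 0)"
      unfolding matrix_matrix_mult_def vec_lambda_beta coord_proj_def by (intro sum.cong) auto
    then show ?thesis by simp
  qed
  have XX: "?X ** ?X = - ?E"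
    using ab zz unfolding vec_eq_iff XM by (auto simp: tangent_unit_nth coord_proj_def mult.commute)
  have EX: "?E ** ?X = ?X" and XE: "?X ** ?E = ?X" and EE: "?E ** ?E = ?E"
    using ab unfolding vec_eq_iff EM ME by (auto simp: tangent_unit_nth coord_proj_def)
  \<comment> \<open>The identity, \<open>?E\<close> and \<open>?X\<close> span an algebra, so the
    claim reduces to the addition theorems for sine and cosine.\<close>
  have "(mat 1 + p *\<^sub>R ?E + u *\<^sub>R ?X) ** (mat 1 + q *\<^sub>R ?E + v *\<^sub>R ?X) =
      mat 1 + (p + q + p * q - u * v) *\<^sub>R ?E + (u + v + p * v + u * q) *\<^sub>R ?X" for p q u v
    by (simp add: matrix_add_ldistrib cmat_add_rdistrib scalar_matrix_assoc[symmetric] matrix_scalar_ac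
        XX EX XE EE) (simp add: algebra_simps)
  then show ?thesis
    unfolding rotation_def by (simp only:) (simp add: cos_add sin_add algebra_simps)
qed

lemma rotation_0: "rotation a b z 0 = mat 1"
  by (simp add: rotation_def)

lemma conj_transpose_rotation: "a \<noteq> b \<Longrightarrow> conj_transpose (rotation a b z t) = rotation a b z (- t)"
  by (auto simp: vec_eq_iff rotation_nth)

lemma rotation_unitary: "a \<noteq> b \<Longrightarrow> cmod z = 1 \<Longrightarrow> rotation a b z t \<in> unitary_group"
  by (intro unitary_groupI) (simp add: conj_transpose_rotation rotation_add rotation_0)

text \<open>
  Changing the sign of one coordinate conjugates a rotation into its inverse, so its determinant
  is \<open>\<plusminus> 1\<close>, and it is a square.
\<close>

lemma det_rotation:
  assumes ab: "a \<noteq> b" and z: "cmod z = 1"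
  shows "det (rotation a b z t) = 1"
proof -
  define D :: "'a cmat" where "D = (\<chi> i j. if i = j then if i = a then - 1 else 1 else 0)"
  have DM: "(D ** M) $ i $ j = (if i = a then - 1 else 1) * M $ i $ j" for M i j
    by (simp add: matrix_matrix_mult_def D_def if_distrib[of "\<lambda>x. x * _"] cong: if_cong)
  have MD: "(M ** D) $ i $ j = M $ i $ j * (if j = a then - 1 else 1)" for M i j
    by (simp add: matrix_matrix_mult_def D_def if_distrib[of "\<lambda>x. _ * x"] cong: if_cong)
  have "D ** D = mat 1"
    by (simp add: vec_eq_iff DM) (simp add: D_def mat_def)
  then have DD: "det D * det D = 1" by (metis det_I det_mul)
  have "D ** rotation a b z t ** D = rotation a b z (- t)" for t
    using ab by (auto simp: vec_eq_iff DM MD rotation_nth)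
  from arg_cong[OF this, of det]
  have "det (rotation a b z (- t)) = det (rotation a b z t) * (det D * det D)" for t
    unfolding det_mul by (simp add: mult_ac)
  then have neg: "det (rotation a b z (- t)) = det (rotation a b z t)" for t
    using DD by simp
  have add: "det (rotation a b z s) * det (rotation a b z t) = det (rotation a b z (s + t))" for s t
    by (simp add: det_mul[symmetric] rotation_add[OF ab z])
  have "det (rotation a b z (t/2)) * det (rotation a b z (- (t/2))) = 1"
    unfolding add by (simp add: rotation_0)
  then show ?thesis
    unfolding neg add by simp
qed

lemma rotation_has_vector_derivative:
  "(rotation a b z has_vector_derivative
    (- sin t *\<^sub>R coord_proj a b + cos t *\<^sub>R tangent_unit a b z)) (at t)"
  unfolding rotation_def
  by (auto intro!: derivative_eq_intros simp: has_vector_derivative_def scaleR_diff_right)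

text \<open>The chain rule identifies both sides with derivatives along the curve, which see the
  functions only on the curve. This is how a derivative in the ambient space comes to depend on
  values in a group alone.\<close>

lemma frechet_derivative_along_curve:
  assumes F: "F differentiable (at (\<gamma> 0))" and F': "F' differentiable (at (\<gamma> 0))"
    and W: "open W" "\<gamma> 0 \<in> W" and eq: "\<And>t. \<gamma> t \<in> W \<Longrightarrow> F (\<gamma> t) = F' (\<gamma> t)"
    and \<gamma>: "(\<gamma> has_vector_derivative V) (at 0)" "continuous_on UNIV \<gamma>"
  shows "frechet_derivative F (at (\<gamma> 0)) V = frechet_derivative F' (at (\<gamma> 0)) V"
proof -
  have 1: "((\<lambda>t. F (\<gamma> t)) has_vector_derivative frechet_derivative F (at (\<gamma> 0)) V) (at 0)"
    if "F differentiable (at (\<gamma> 0))" for F :: "'a \<Rightarrow> 'b"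
  proof -
    have d: "(F has_derivative frechet_derivative F (at (\<gamma> 0))) (at (\<gamma> 0))"
      using that by (simp add: frechet_derivative_works)
    from has_derivative_compose[OF \<gamma>(1)[unfolded has_vector_derivative_def] d]
    show ?thesis
      by (simp add: has_vector_derivative_def linear_cmul[OF has_derivative_linear[OF d]])
  qed
  have "((\<lambda>t. F' (\<gamma> t)) has_vector_derivative frechet_derivative F (at (\<gamma> 0)) V) (at 0)"
    by (rule has_vector_derivative_transform_within_open[OF 1[OF F], of "\<gamma> -` W"])
      (use W eq \<gamma>(2) in \<open>auto intro: open_vimage\<close>)
  then show ?thesis using 1[OF F'] by (rule vector_derivative_unique_at)
qed

text \<open>The velocity of \<open>x ** rotation a b z t\<close> at \<open>t = 0\<close> is
  \<open>x ** tangent_unit a b z\<close>, since the cosine part has zero derivative there.\<close>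

lemma frechet_derivative_along_left:
  fixes x :: "'d::finite cmat"
  assumes "F differentiable (at x)" "F' differentiable (at x)" "open W" "x \<in> W"
    and "\<And>t. x ** rotation a b z t \<in> W \<Longrightarrow> F (x ** rotation a b z t) = F' (x ** rotation a b z t)"
  shows "frechet_derivative F (at x) (x ** tangent_unit a b z) = frechet_derivative F' (at x) (x ** tangent_unit a b z)"
proof -
  have "((\<lambda>t. x ** rotation a b z t) has_vector_derivative x ** (- sin t *\<^sub>R coord_proj a b + cos t *\<^sub>R tangent_unit a b z)) (at t)" for t
    by (rule bounded_linear.has_vector_derivative[OF bounded_linear_matrix_mult_left rotation_has_vector_derivative])
  note d = this
  have "continuous_on UNIV (\<lambda>t. x ** rotation a b z t)"
    by (intro continuous_at_imp_continuous_on ballI) (use d has_vector_derivative_continuous in blast)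
  from frechet_derivative_along_curve[of F "\<lambda>t. x ** rotation a b z t", OF _ _ assms(3) _ assms(5) _ this] d[of 0] assms
  show ?thesis by (simp add: rotation_0)
qed

lemma frechet_derivative_along_right:
  fixes x :: "'d::finite cmat"
  assumes "F differentiable (at x)" "F' differentiable (at x)" "open W" "x \<in> W"
    and "\<And>t. rotation a b z t ** x \<in> W \<Longrightarrow> F (rotation a b z t ** x) = F' (rotation a b z t ** x)"
  shows "frechet_derivative F (at x) (tangent_unit a b z ** x) = frechet_derivative F' (at x) (tangent_unit a b z ** x)"
proof -
  have "((\<lambda>t. rotation a b z t ** x) has_vector_derivative (- sin t *\<^sub>R coord_proj a b + cos t *\<^sub>R tangent_unit a b z) ** x) (at t)" for t
    by (rule bounded_linear.has_vector_derivative[OF bounded_linear_matrix_mult_right rotation_has_vector_derivative])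
  note d = this
  have "continuous_on UNIV (\<lambda>t. rotation a b z t ** x)"
    by (intro continuous_at_imp_continuous_on ballI) (use d has_vector_derivative_continuous in blast)
  from frechet_derivative_along_curve[of F "\<lambda>t. rotation a b z t ** x", OF _ _ assms(3) _ assms(5) _ this] d[of 0] assms
  show ?thesis by (simp add: rotation_0)
qed

section \<open>The subgroups \<open>K\<^sub>k\<close> and \<open>H\<^sub>\<sigma>\<close>\<close>

text \<open>Row \<open>p\<close> of \<open>conj_transpose A ** A\<close> reduces to
  \<open>cnj (A $ p $ p)\<close> times row \<open>p\<close> of \<open>A\<close>, and it equals row
  \<open>p\<close> of the identity.\<close>

lemma unitary_column:
  assumes A: "A \<in> unitary_group" and col: "\<And>i. i \<noteq> p \<Longrightarrow> A $ i $ p = 0"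
  shows "cmod (A $ p $ p) = 1" and "j \<noteq> p \<Longrightarrow> A $ p $ j = 0"
proof -
  have row: "cnj (A $ p $ p) * A $ p $ j = (mat 1 :: 'a cmat) $ p $ j" for j
  proof -
    have "(conj_transpose A ** A) $ p $ j = (\<Sum>k\<in>UNIV. if k = p then cnj (A $ p $ p) * A $ p $ j else 0)"
      unfolding matrix_matrix_mult_def vec_lambda_beta conj_transpose_nth
      by (intro sum.cong) (auto simp: col)
    then show ?thesis by (simp add: unitary_groupD(2)[OF A])
  qed
  have "(cmod (A $ p $ p))\<^sup>2 = 1"
    using row[of p] complex_norm_square[of "A $ p $ p"]
    by (simp add: mat_def mult.commute flip: of_real_power)
  then show n: "cmod (A $ p $ p) = 1"
    using norm_ge_zero[of "A $ p $ p"] by (simp add: power2_eq_1_iff)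
  show "A $ p $ j = 0" if "j \<noteq> p"
    using row[of j] that n by (auto simp: mat_def)
qed

lemma K_D:
  assumes "g \<in> K k"
  shows "g \<in> special_unitary_group" "g \<in> unitary_group" "det g = 1"
    and "(idx i \<le> k) \<noteq> (idx j \<le> k) \<Longrightarrow> g $ i $ j = 0"
  using assms by (auto simp: K_def special_unitary_group_def)

lemma K_mult:
  assumes "g \<in> K k" "h \<in> K k" shows "g ** h \<in> K k"
  unfolding K_def
proof (intro CollectI conjI allI impI)
  show "g ** h \<in> special_unitary_group"
    using assms K_D(1) by (blast intro: special_unitary_mult)
  show "(g ** h) $ i $ j = 0" if "(idx i \<le> k) \<noteq> (idx j \<le> k)" for i j
  proof -
    have "g $ i $ m * h $ m $ j = 0" for m
      using that K_D(4)[OF assms(1), of i m] K_D(4)[OF assms(2), of m j] by auto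
    then show ?thesis
      by (simp only: matrix_matrix_mult_def vec_lambda_beta sum.neutral_const)
  qed
qed

lemma K_conj_transpose: "g \<in> K k \<Longrightarrow> conj_transpose g \<in> K k"
  by (auto simp: K_def special_unitary_conj_transpose)

lemma mat_1_K: "mat 1 \<in> K k"
  by (auto simp: K_def special_unitary_group_def unitary_mat_1) (auto simp: mat_def split: if_splits)

lemma rotation_special_unitary:
  "a \<noteq> b \<Longrightarrow> cmod z = 1 \<Longrightarrow> rotation a b z t \<in> special_unitary_group"
  by (simp add: special_unitary_group_def rotation_unitary det_rotation)

lemma rotation_K:
  "a \<noteq> b \<Longrightarrow> cmod z = 1 \<Longrightarrow> idx a \<le> k \<longleftrightarrow> idx b \<le> k \<Longrightarrow> rotation a b z t \<in> K k"
  by (auto simp: K_def rotation_special_unitary rotation_nth)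

lemma arccos_sqrt:
  assumes "0 \<le> c" "c \<le> 1"
  shows "cos (arccos (sqrt c)) = sqrt c" "sin (arccos (sqrt c)) = sqrt (1 - c)"
proof -
  have "- 1 \<le> sqrt c" "sqrt c \<le> 1" using assms by (auto intro: order_trans[of _ 0])
  then show "cos (arccos (sqrt c)) = sqrt c" "sin (arccos (sqrt c)) = sqrt (1 - c)"
    using assms by (auto simp: sin_arccos_abs)
qed

text \<open>The entry \<open>- sqrt (1 - c)\<close> in the upper right corner fixes the sign of the
  angle. Being a rotation, \<open>sigma c\<close> is special unitary at once.\<close>

lemma sigma_eq_rotation:
  fixes p q :: "'n::{finite,linorder}"
  assumes p: "idx p = 1" and q: "idx q = CARD('n)" and pq: "p \<noteq> q" and c: "0 \<le> c" "c \<le> 1"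
  shows "(sigma c :: 'n cmat) = rotation p q 1 (- arccos (sqrt c))"
proof -
  have cs: "cos (arccos (sqrt c)) = sqrt c" "sin (arccos (sqrt c)) = sqrt (1 - c)"
    using arccos_sqrt c by auto
  have ip: "idx i = 1 \<longleftrightarrow> i = p" for i :: 'n using p idx_eq_iff[of i p] by auto
  have iq: "idx i = CARD('n) \<longleftrightarrow> i = q" for i :: 'n using q idx_eq_iff[of i q] by auto
  have mid: "idx i \<in> {2..CARD('n) - 1} \<longleftrightarrow> i \<noteq> p \<and> i \<noteq> q" for i :: 'n
    using idx_range[of i] ip[of i] iq[of i] pq q p by (auto simp del: idx_pos)
  have "(\<Sum>m = 2..CARD('n) - 1. munit m m) $ i $ j = (if i = j \<and> i \<noteq> p \<and> i \<noteq> q then 1 else (0::complex))" for i j :: 'n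
  proof -
    have "(\<Sum>m = 2..CARD('n) - 1. munit m m) $ i $ j
        = (\<Sum>m = 2..CARD('n) - 1. if m = idx i then (if i = j then 1 else 0) else (0::complex))"
      unfolding sum_component by (intro sum.cong) (auto simp: munit_def)
    also have "\<dots> = (if idx i \<in> {2..CARD('n) - 1} then (if i = j then 1 else 0) else 0)"
      by (rule sum.delta) simp
    finally show ?thesis unfolding mid by auto
  qed
  note mid_sum = this
  have units: "(munit 1 1 :: 'n cmat) $ i $ j = (if i = p \<and> j = p then 1 else 0)"
    "(munit CARD('n) CARD('n) :: 'n cmat) $ i $ j = (if i = q \<and> j = q then 1 else 0)"
    "(munit CARD('n) 1 :: 'n cmat) $ i $ j = (if i = q \<and> j = p then 1 else 0)"
    "(munit 1 CARD('n) :: 'n cmat) $ i $ j = (if i = p \<and> j = q then 1 else 0)" for i j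
    by (simp_all only: munit_def vec_lambda_beta ip iq)
  show ?thesis
    unfolding vec_eq_iff sigma_def Let_def vector_add_component vector_minus_component
      vector_scaleR_component mid_sum units rotation_nth[OF pq] cos_minus sin_minus cs
    using pq by (auto simp: scaleR_conv_of_real)
qed

lemma matrix_mult_axis: "((A::'d::finite cmat) *v axis p 1) $ i = A $ i $ p"
  by (simp add: matrix_vector_mult_def axis_def if_distrib[of "\<lambda>x. _ * x"] cong: if_cong)

text \<open>The indices numbered \<open>1\<close> and \<open>n\<close> as elements of the type;
  \<open>p \<noteq> q\<close> encodes \<open>n \<ge> 2\<close>.\<close>

locale first_last =
  fixes p q :: "'n::{finite,linorder}"
  assumes p: "idx p = 1" and q: "idx q = CARD('n)" and pq: "p \<noteq> q"
begin

lemma idx_p_iff: "idx i = 1 \<longleftrightarrow> i = p" "idx i \<le> 1 \<longleftrightarrow> i = p" "idx i = Suc 0 \<longleftrightarrow> i = p" "idx i \<le> Suc 0 \<longleftrightarrow> i = p"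
  using p idx_eq_iff[of i p] idx_pos(1)[of i] by (auto intro: le_antisym simp del: idx_pos idx_eq_iff)

lemma idx_q_iff: "idx i = CARD('n) \<longleftrightarrow> i = q" "CARD('n) \<le> idx i \<longleftrightarrow> i = q"
  using q idx_eq_iff[of i q] idx_pos(4)[of i] by (auto intro: le_antisym simp del: idx_pos idx_eq_iff)

lemma sigma_special_unitary:
  "0 \<le> c \<Longrightarrow> c \<le> 1 \<Longrightarrow> (sigma c :: 'n cmat) \<in> special_unitary_group"
  using sigma_eq_rotation[OF p q pq] rotation_special_unitary[OF pq] by simp

lemma sigma_axis:
  "0 \<le> c \<Longrightarrow> c \<le> 1 \<Longrightarrow> (sigma c :: 'n cmat) *v axis p 1 = line_vector c"
  using pq unfolding sigma_eq_rotation[OF p q pq]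
  by (auto simp: vec_eq_iff matrix_mult_axis rotation_nth arccos_sqrt
      line_vector_def idx_p_iff idx_q_iff)

text \<open>Invariance of the line through the first basis vector clears the first column off the
  diagonal, and \<open>unitary_column\<close> then clears the first row.\<close>

lemma K_1_iff:
  "h \<in> K 1 \<longleftrightarrow> h \<in> special_unitary_group \<and> (\<exists>z. h *v axis p 1 = z *s axis p 1)"
proof
  assume h: "h \<in> K 1"
  then have "h *v axis p 1 = (h $ p $ p) *s axis p 1"
    using K_D(4)[OF h] unfolding vec_eq_iff vector_smult_component matrix_mult_axis
    by (auto simp: axis_def idx_p_iff)
  then show "h \<in> special_unitary_group \<and> (\<exists>z. h *v axis p 1 = z *s axis p 1)"
    using K_D(1)[OF h] by blast
next
  assume h: "h \<in> special_unitary_group \<and> (\<exists>z. h *v axis p 1 = z *s axis p 1)"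
  then have u: "h \<in> unitary_group" by (simp add: special_unitary_group_def)
  have col: "h $ i $ p = 0" if "i \<noteq> p" for i
    using h that unfolding vec_eq_iff vector_smult_component matrix_mult_axis by (auto simp: axis_def)
  note row = unitary_column(2)[OF u col]
  show "h \<in> K 1"
    using h row col by (auto simp: K_def idx_p_iff)
qed

text \<open>\<open>sigma c\<close> sends the first basis vector to \<open>line_vector c\<close>, so
  conjugation by it carries one stabilizer onto the other.\<close>

lemma H_eq:
  assumes c: "0 \<le> c" "c \<le> 1"
  shows "(H c :: 'n cmat set) =
    {g \<in> special_unitary_group. \<exists>z. g *v line_vector c = z *s line_vector c}"
proof -
  let ?s = "sigma c :: 'n cmat"
  have s: "?s \<in> special_unitary_group" by (rule sigma_special_unitary[OF c])
  then have u: "?s \<in> unitary_group" by (simp add: special_unitary_group_def)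
  note inv = unitary_matrix_inv[OF u]
  have sl: "conj_transpose ?s *v line_vector c = axis p 1"
    unfolding sigma_axis[OF c, symmetric] matrix_vector_mul_assoc unitary_groupD[OF u] by simp
  have scal: "A *v (z *s v) = z *s (A *v v)" for A :: "'n cmat" and z v
    by (simp add: vec_eq_iff matrix_vector_mult_def sum_distrib_left mult_ac)
  show ?thesis
  proof (intro equalityI subsetI)
    fix g :: "'n cmat" assume "g \<in> H c"
    then obtain h where h: "h \<in> K 1" and g: "g = ?s ** h ** conj_transpose ?s"
      by (auto simp: H_def inv)
    then obtain z where z: "h *v axis p 1 = z *s axis p 1" using K_1_iff by blast
    have "g *v line_vector c = z *s line_vector c"
      unfolding g matrix_vector_mul_assoc[symmetric] sl z scal sigma_axis[OF c] ..
    moreover have "g \<in> special_unitary_group"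
      unfolding g using s K_D(1)[OF h] by (intro special_unitary_mult special_unitary_conj_transpose)
    ultimately show "g \<in> {g \<in> special_unitary_group. \<exists>z. g *v line_vector c = z *s line_vector c}"
      by blast
  next
    fix g :: "'n cmat" assume "g \<in> {g \<in> special_unitary_group. \<exists>z. g *v line_vector c = z *s line_vector c}"
    then obtain z where g: "g \<in> special_unitary_group" and z: "g *v line_vector c = z *s line_vector c" by blast
    define h where "h = conj_transpose ?s ** g ** ?s"
    have "h *v axis p 1 = z *s axis p 1"
      unfolding h_def matrix_vector_mul_assoc[symmetric] sigma_axis[OF c] z scal sl ..
    moreover have "h \<in> special_unitary_group"
      unfolding h_def using s g by (intro special_unitary_mult special_unitary_conj_transpose)
    ultimately have "h \<in> K 1" using K_1_iff by blast
    moreover have "g = ?s ** h ** conj_transpose ?s"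
      unfolding h_def by (simp add: matrix_mul_assoc unitary_cancel[OF u] unitary_groupD[OF u])
    ultimately show "g \<in> H c" unfolding H_def inv by blast
  qed
qed

lemma matrix_line_vector:
  "(g *v line_vector c) $ i = g $ i $ p * of_real (sqrt c) + g $ i $ q * of_real (sqrt (1 - c))"
proof -
  have "(g *v line_vector c) $ i =
      (\<Sum>j\<in>UNIV. (if j = p then g $ i $ p * of_real (sqrt c) else 0) + (if j = q then g $ i $ q * of_real (sqrt (1 - c)) else 0))"
    unfolding matrix_vector_mult_def vec_lambda_beta
    using pq by (intro sum.cong) (auto simp: line_vector_def idx_p_iff idx_q_iff)
  then show ?thesis by (simp add: sum.distrib)
qed

text \<open>Block diagonality decouples the eigenvector equation: rows up to \<open>k\<close>
  involve only the component \<open>sqrt c\<close>, the others only \<open>sqrt (1 - c)\<close>.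
  Both are nonzero, so columns \<open>p\<close> and \<open>q\<close> carry the same eigenvalue
  \<open>a\<close>.\<close>

lemma K_H_iff:
  assumes c: "0 < c" "c < 1" and k: "1 \<le> k" "k < CARD('n)"
  shows "g \<in> K k \<inter> H c \<longleftrightarrow>
    g \<in> K k \<and> (\<exists>a. \<forall>i. g $ i $ p = (if i = p then a else 0) \<and> g $ i $ q = (if i = q then a else 0))"
proof -
  have nz: "complex_of_real (sqrt c) \<noteq> 0" "complex_of_real (sqrt (1 - c)) \<noteq> 0"
    using c by auto
  have l: "line_vector c $ i = (if i = p then of_real (sqrt c) else if i = q then of_real (sqrt (1 - c)) else 0)" for i
    by (simp add: line_vector_def idx_p_iff idx_q_iff)
  have pk: "idx p \<le> k" "\<not> idx q \<le> k" using p q k by auto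
  have "(\<exists>z. g *v line_vector c = z *s line_vector c) \<longleftrightarrow>
      (\<exists>a. \<forall>i. g $ i $ p = (if i = p then a else 0) \<and> g $ i $ q = (if i = q then a else 0))"
    if g: "g \<in> K k"
  proof
    assume "\<exists>z. g *v line_vector c = z *s line_vector c"
    then obtain z where z: "g $ i $ p * of_real (sqrt c) + g $ i $ q * of_real (sqrt (1 - c))
        = z * line_vector c $ i" for i
      by (auto simp: vec_eq_iff matrix_line_vector)
    have "g $ i $ p = (if i = p then z else 0) \<and> g $ i $ q = (if i = q then z else 0)" for i
    proof (cases "idx i \<le> k")
      case True
      then have "g $ i $ q = 0" "i \<noteq> q" using K_D(4)[OF g, of i q] pk by auto
      then show ?thesis using z[of i] nz by (auto simp: l split: if_splits)
    next
      case False
      then have "g $ i $ p = 0" "i \<noteq> p" using K_D(4)[OF g, of i p] pk by auto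
      then show ?thesis using z[of i] nz by (auto simp: l split: if_splits)
    qed
    then show "\<exists>a. \<forall>i. g $ i $ p = (if i = p then a else 0) \<and> g $ i $ q = (if i = q then a else 0)" by blast
  next
    assume "\<exists>a. \<forall>i. g $ i $ p = (if i = p then a else 0) \<and> g $ i $ q = (if i = q then a else 0)"
    then obtain a where "\<And>i. g $ i $ p = (if i = p then a else 0)" "\<And>i. g $ i $ q = (if i = q then a else 0)"
      by blast
    then have "g *v line_vector c = a *s line_vector c"
      using pq by (auto simp: vec_eq_iff matrix_line_vector l)
    then show "\<exists>z. g *v line_vector c = z *s line_vector c" ..
  qed
  then show ?thesis
    using c K_D(1) unfolding H_eq[OF less_imp_le[OF c(1)] less_imp_le[OF c(2)]] by blast
qed

end

text \<open>Keeps the size of the matrix and puts the identity outside the block, to match the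
  encoding of \<open>block_unitary_group\<close>.\<close>

definition cut_block :: "nat set \<Rightarrow> 'd::{finite,linorder} cmat \<Rightarrow> 'd cmat" where
  "cut_block J g = (\<chi> i j. if idx i \<in> J \<and> idx j \<in> J then g $ i $ j else mat 1 $ i $ j)"

lemma cut_block_unitary:
  assumes g: "g \<in> unitary_group" and block: "\<And>i j. (idx i \<in> J) \<noteq> (idx j \<in> J) \<Longrightarrow> g $ i $ j = 0"
  shows "cut_block J g \<in> block_unitary_group J"
proof -
  have "(cut_block J g ** conj_transpose (cut_block J g)) $ i $ j = (mat 1 :: 'a cmat) $ i $ j" for i j
  proof (cases "idx i \<in> J \<and> idx j \<in> J")
    case True
    then have "(cut_block J g ** conj_transpose (cut_block J g)) $ i $ j = (g ** conj_transpose g) $ i $ j"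
      unfolding matrix_matrix_mult_def vec_lambda_beta conj_transpose_nth
      using block by (intro sum.cong) (auto simp: cut_block_def mat_def)
    then show ?thesis by (simp add: unitary_groupD[OF g])
  next
    case False
    have "(cut_block J g ** conj_transpose (cut_block J g)) $ i $ j =
        (mat 1 ** conj_transpose (mat 1) :: 'a cmat) $ i $ j"
      unfolding matrix_matrix_mult_def vec_lambda_beta conj_transpose_nth
      using False by (intro sum.cong) (auto simp: cut_block_def mat_def)
    then show ?thesis by simp
  qed
  then have "cut_block J g ** conj_transpose (cut_block J g) = mat 1"
    by (simp add: vec_eq_iff)
  then have "cut_block J g \<in> unitary_group" by (rule unitary_groupI)
  then show ?thesis by (auto simp: block_unitary_group_def cut_block_def)
qed

lemma block_unitary_groupD:
  assumes "B \<in> block_unitary_group J"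
  shows "B \<in> unitary_group" and "idx i \<notin> J \<or> idx j \<notin> J \<Longrightarrow> B $ i $ j = mat 1 $ i $ j"
  using assms by (auto simp: block_unitary_group_def)

definition diag_mat :: "('d::finite \<Rightarrow> complex) \<Rightarrow> 'd cmat" where
  "diag_mat u = (\<chi> i j. if i = j then u i else 0)"

lemma diag_mat_nth: "diag_mat u $ i $ j = (if i = j then u i else 0)"
  by (simp add: diag_mat_def)

lemma diag_mat_mult: "(diag_mat u ** A) $ i $ j = u i * A $ i $ j"
  by (simp add: diag_mat_def matrix_matrix_mult_def if_distrib[of "\<lambda>x. x * _"] cong: if_cong)

lemma mult_diag_mat: "(A ** diag_mat u) $ i $ j = A $ i $ j * u j"
  by (simp add: diag_mat_def matrix_matrix_mult_def if_distrib[of "\<lambda>x. _ * x"] cong: if_cong)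

lemma det_diag_mat: "det (diag_mat u) = (\<Prod>i\<in>UNIV. u i)"
  by (subst det_diagonal) (auto simp: diag_mat_def)

lemma diag_mat_unitary:
  assumes "\<And>i. cmod (u i) = 1" shows "diag_mat u \<in> unitary_group"
proof (rule unitary_groupI)
  have "u i * cnj (u i) = 1" for i
    using complex_norm_square[of "u i"] assms by simp
  then show "diag_mat u ** conj_transpose (diag_mat u) = mat 1"
    by (auto simp: vec_eq_iff diag_mat_mult diag_mat_nth mat_def)
qed

context first_last
begin

definition ends_diag :: "complex \<Rightarrow> 'n cmat" where
  "ends_diag a = diag_mat (\<lambda>i. if i = p \<or> i = q then a else 1)"

lemma det_ends_diag: "det (ends_diag a) = a\<^sup>2"
proof -
  have "(\<Prod>i\<in>UNIV. if i = p \<or> i = q then a else 1) = (\<Prod>i\<in>{p, q}. a)"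
    by (rule prod.mono_neutral_cong_right) auto
  then show ?thesis
    unfolding ends_diag_def det_diag_mat using pq by (simp add: power2_eq_square)
qed

text \<open>\<open>B1\<close> and \<open>B2\<close> are the identity outside disjoint sets of
  indices, so their product has no interaction. The factorization gives unitarity and the
  determinant \<open>a\<^sup>2 * det B1 * det B2\<close>.\<close>

lemma four_block_diag_eq:
  assumes k: "1 \<le> k" "k < CARD('n)"
    and B1: "B1 \<in> block_unitary_group {2..k}" and B2: "B2 \<in> block_unitary_group {k + 1..CARD('n) - 1}"
  shows "(four_block_diag k a B1 B2 :: 'n cmat) = ends_diag a ** B1 ** B2"
proof -
  let ?J = "{2..k}" and ?L = "{k + 1..CARD('n) - 1}"
  note 1 = block_unitary_groupD(2)[OF B1] and 2 = block_unitary_groupD(2)[OF B2]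
  have ends: "idx p = 1" "idx q = CARD('n)" "1 < CARD('n)"
    using p q k by auto
  have "(B1 ** B2) $ i $ j = (if idx i \<in> ?J \<and> idx j \<in> ?J then B1 $ i $ j
      else if idx i \<in> ?L \<and> idx j \<in> ?L then B2 $ i $ j else mat 1 $ i $ j)" for i j
  proof (cases "idx i \<in> ?J")
    case True
    then have "(B1 ** B2) $ i $ j = (\<Sum>m\<in>UNIV. if m = j then B1 $ i $ j else 0)"
      unfolding matrix_matrix_mult_def vec_lambda_beta
    proof (intro sum.cong refl)
      fix m
      show "B1 $ i $ m * B2 $ m $ j = (if m = j then B1 $ i $ j else 0)"
      proof (cases "idx m \<in> ?J")
        case m: True
        then have "B2 $ m $ j = mat 1 $ m $ j" by (intro 2) auto
        then show ?thesis by (simp add: mat_def)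
      next
        case m: False
        then have "B1 $ i $ m = 0" using 1[of i m] True by (auto simp: mat_def)
        then show ?thesis by auto
      qed
    qed
    then show ?thesis using True 1[of i j] by auto
  next
    case False
    then have "(B1 ** B2) $ i $ j = (\<Sum>m\<in>UNIV. if m = i then B2 $ i $ j else 0)"
      unfolding matrix_matrix_mult_def vec_lambda_beta
      using 1[of i] by (intro sum.cong) (auto simp: mat_def)
    then show ?thesis using False 2[of i j] by auto
  qed
  note BB = this
  have "four_block_diag k a B1 B2 $ i $ j = (if i = p \<or> i = q then a else 1) * (B1 ** B2) $ i $ j" for i j
  proof -
    have J: "idx i \<in> ?J \<Longrightarrow> i \<noteq> p \<and> i \<noteq> q" and L: "idx i \<in> ?L \<Longrightarrow> i \<noteq> q \<and> i \<noteq> p" 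
      and R: "idx i \<notin> ?J \<Longrightarrow> idx i \<notin> ?L \<Longrightarrow> i = p \<or> i = q" for i
      using ends k idx_p_iff(1)[of i] idx_q_iff(1)[of i] idx_range[of i] by (auto simp del: idx_pos)
    have E: "idx i \<in> {1, CARD('n)} \<longleftrightarrow> i = p \<or> i = q" using idx_p_iff(1)[of i] idx_q_iff(1)[of i] by auto
    show ?thesis
      unfolding BB four_block_diag_def vec_lambda_beta E
      using J[of i] L[of i] R[of i] J[of j] L[of j] R[of j] by (auto simp: mat_def)
  qed
  then show ?thesis
    unfolding ends_diag_def matrix_mul_assoc[symmetric] vec_eq_iff diag_mat_mult by blast
qed

lemma K_H_eq_four_block_diag:
  assumes c: "0 < c" "c < 1" and k: "1 \<le> k" "k < CARD('n)"
  shows "(K k \<inter> H c :: 'n cmat set) =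
       {four_block_diag k a B1 B2 | a B1 B2.
          cmod a = 1 \<and> B1 \<in> block_unitary_group {2..k} \<and>
          B2 \<in> block_unitary_group {k + 1..CARD('n) - 1} \<and>
          a\<^sup>2 = inverse (det B1 * det B2)}" (is "_ = ?R")
proof (intro equalityI subsetI)
  let ?J = "{2..k}" and ?L = "{k + 1..CARD('n) - 1}"
  have ends: "idx p = 1" "idx q = CARD('n)" "1 < CARD('n)"
    using k p q by auto
  have det: "det (four_block_diag k a B1 B2 :: 'n cmat) = a\<^sup>2 * det B1 * det B2"
    if "B1 \<in> block_unitary_group ?J" "B2 \<in> block_unitary_group ?L" for a B1 B2
    unfolding four_block_diag_eq[OF k that] det_mul det_ends_diag ..
  have J: "idx i \<in> ?J \<Longrightarrow> i \<noteq> p \<and> i \<noteq> q \<and> idx i \<le> k" 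
    and L: "idx i \<in> ?L \<Longrightarrow> i \<noteq> q \<and> i \<noteq> p \<and> \<not> idx i \<le> k" 
    and R: "idx i \<notin> ?J \<Longrightarrow> idx i \<notin> ?L \<Longrightarrow> i = p \<or> i = q" for i
    using ends k idx_p_iff(1)[of i] idx_q_iff(1)[of i] idx_range[of i] by (auto simp del: idx_pos)
  have E: "idx i \<in> {1, CARD('n)} \<longleftrightarrow> i = p \<or> i = q" for i using idx_p_iff(1)[of i] idx_q_iff(1)[of i] by auto
  fix g :: "'n cmat"
  {
    assume "g \<in> K k \<inter> H c"
    then obtain a where g: "g \<in> K k"
      and a: "\<And>i. g $ i $ p = (if i = p then a else 0)" "\<And>i. g $ i $ q = (if i = q then a else 0)"
      using K_H_iff[OF c k] by blast
    note u = K_D(2)[OF g]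
    have a1: "cmod a = 1" and row_p: "\<And>j. j \<noteq> p \<Longrightarrow> g $ p $ j = 0"
      using unitary_column[OF u, of p] a(1) by simp_all
    have row_q: "\<And>j. j \<noteq> q \<Longrightarrow> g $ q $ j = 0"
      using unitary_column[OF u, of q] a(2) by simp
    \<comment> \<open>Entries between different blocks vanish for one of three reasons: they lie in
      column \<open>p\<close> or \<open>q\<close>, in the corresponding row (by
      \<open>unitary_column\<close>), or across the cut at \<open>k\<close>.\<close>
    have b1: "cut_block ?J g \<in> block_unitary_group ?J"
    proof (rule cut_block_unitary[OF u])
      fix i j :: 'n assume "(idx i \<in> ?J) \<noteq> (idx j \<in> ?J)"
      then show "g $ i $ j = 0"
        using J[of i] L[of i] R[of i] J[of j] L[of j] R[of j] K_D(4)[OF g, of i j] a row_p row_q by metis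
    qed
    have b2: "cut_block ?L g \<in> block_unitary_group ?L"
    proof (rule cut_block_unitary[OF u])
      fix i j :: 'n assume "(idx i \<in> ?L) \<noteq> (idx j \<in> ?L)"
      then show "g $ i $ j = 0"
        using J[of i] L[of i] R[of i] J[of j] L[of j] R[of j] K_D(4)[OF g, of i j] a row_p row_q by metis
    qed
    have "g $ i $ j = four_block_diag k a (cut_block ?J g) (cut_block ?L g) $ i $ j" for i j
    proof (cases "i = p \<or> i = q \<or> j = p \<or> j = q")
      case True
      then show ?thesis
        unfolding four_block_diag_def cut_block_def vec_lambda_beta E
        using J[of i] L[of i] J[of j] L[of j] a row_p row_q by auto
    next
      case False
      then have "idx i \<in> ?J \<or> idx i \<in> ?L" "idx j \<in> ?J \<or> idx j \<in> ?L" using R by blast+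
      moreover have "g $ i $ j = 0" if "idx i \<in> ?J" "idx j \<in> ?L" using that by (intro K_D(4)[OF g]) auto
      moreover have "g $ i $ j = 0" if "idx i \<in> ?L" "idx j \<in> ?J" using that by (intro K_D(4)[OF g]) auto
      ultimately show ?thesis
        unfolding four_block_diag_def cut_block_def vec_lambda_beta E
        using False by (simp only: if_False if_True simp_thms split: if_split) blast
    qed
    then have ge: "g = four_block_diag k a (cut_block ?J g) (cut_block ?L g)"
      by (simp add: vec_eq_iff)
    \<comment> \<open>The condition on \<open>a\<close> is \<open>det g = 1\<close>.\<close>
    have "a\<^sup>2 * (det (cut_block ?J g) * det (cut_block ?L g)) = 1"
      using det[OF b1 b2, of a] K_D(3)[OF g] ge by (simp add: mult.assoc)
    then have "a\<^sup>2 = inverse (det (cut_block ?J g) * det (cut_block ?L g))"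
      by (metis inverse_unique mult.commute)
    then show "g \<in> ?R" using ge a1 b1 b2 by blast
  next
    assume "g \<in> ?R"
    then obtain a B1 B2 where g: "g = four_block_diag k a B1 B2" and a: "cmod a = 1"
      and B: "B1 \<in> block_unitary_group ?J" "B2 \<in> block_unitary_group ?L"
      and d: "a\<^sup>2 = inverse (det B1 * det B2)" by blast
    have u: "g \<in> unitary_group"
      unfolding g four_block_diag_eq[OF k B] ends_diag_def using B a block_unitary_groupD(1)
      by (intro unitary_mult diag_mat_unitary) auto
    \<comment> \<open>As \<open>inverse 0 = 0\<close>, a vanishing product would make
      \<open>a\<close> zero, contrary to \<open>cmod a = 1\<close>.\<close>
    have "det B1 * det B2 \<noteq> 0"
      using d a by auto
    then have "det g = 1" unfolding g det[OF B] d by (simp add: field_simps)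
    moreover have "g $ i $ j = 0" if "(idx i \<le> k) \<noteq> (idx j \<le> k)" for i j
      using that J[of i] L[of i] J[of j] L[of j] unfolding g four_block_diag_def by auto
    ultimately have gK: "g \<in> K k" using u by (simp add: K_def special_unitary_group_def)
    have np: "idx p \<notin> ?J" "idx p \<notin> ?L" "idx q \<notin> ?J" "idx q \<notin> ?L" using J L by blast+
    have "g $ i $ p = (if i = p then a else 0) \<and> g $ i $ q = (if i = q then a else 0)" for i
      unfolding g four_block_diag_def vec_lambda_beta E
      by (simp only: np simp_thms if_False) (use pq in auto)
    then show "g \<in> K k \<inter> H c" using gK K_H_iff[OF c k] by blast
  }
qed

end

section \<open>Coisotropic quotients\<close>

lemma frechet_derivative_compose_linear:
  assumes T: "bounded_linear T" and F: "F differentiable (at (T x))"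
  shows "frechet_derivative (\<lambda>z. F (T z)) (at x) V = frechet_derivative F (at (T x)) (T V)"
proof -
  have "((\<lambda>z. F (T z)) has_derivative (\<lambda>V. frechet_derivative F (at (T x)) (T V))) (at x)"
    using has_derivative_compose[OF bounded_linear_imp_has_derivative[OF T], of F _ x UNIV] F
    by (simp add: frechet_derivative_works)
  then show ?thesis by (metis frechet_derivative_at)
qed

text \<open>A monotone \<kappa> has consecutive classes: \<open>\<kappa> a < \<kappa> b\<close>
  forces \<open>a < b\<close>, so the pairs in different classes are among the pairs that make up
  \<open>r\<close>.\<close>

lemma sum_less_split:
  fixes \<kappa> :: "'d::{finite,linorder} \<Rightarrow> nat" and f :: "'d \<Rightarrow> 'd \<Rightarrow> real"
  assumes mono: "mono \<kappa>"
  shows "(\<Sum>(a,b) | a < b. f a b) = (\<Sum>(a,b) | \<kappa> a < \<kappa> b. f a b) + (\<Sum>(a,b) | a < b \<and> \<kappa> a = \<kappa> b. f a b)"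
proof -
  have "{(a,b). a < b} = {(a,b). \<kappa> a < \<kappa> b} \<union> {(a,b). a < b \<and> \<kappa> a = \<kappa> b}"
    using monoD[OF mono] by (auto simp: not_le[symmetric] dest: less_imp_le le_neq_implies_less)
  then show ?thesis by (simp only:) (rule sum.union_disjoint, auto)
qed

definition block_diagonal :: "('d \<Rightarrow> nat) \<Rightarrow> 'd::finite cmat \<Rightarrow> bool" where
  "block_diagonal \<kappa> g \<longleftrightarrow> (\<forall>i j. \<kappa> i \<noteq> \<kappa> j \<longrightarrow> g $ i $ j = 0)"

text \<open>For pairs in different classes the left and right translates contribute equally by
  \<open>off_diagonal_invariant\<close>, so these pairs drop out of the difference.\<close>

lemma std_bivector_block_diagonal:
  fixes g :: "'d::{finite,linorder} cmat" and \<kappa> :: "'d \<Rightarrow> nat"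
  assumes mono: "mono \<kappa>"
    and g: "g \<in> unitary_group" "block_diagonal \<kappa> g"
    and F: "F differentiable (at g)" and G: "G differentiable (at g)"
  shows "std_bivector g F G = (\<Sum>(a,b) | a < b \<and> \<kappa> a = \<kappa> b.
     left_wedge g a b F G
     - right_wedge g a b F G)"
proof -
  have "(\<Sum>(a,b) | \<kappa> a < \<kappa> b. left_wedge g a b F G) =
      (\<Sum>(a,b) | \<kappa> a < \<kappa> b. right_wedge g a b F G)"
    unfolding wedge_at_eq
    using g by (intro off_diagonal_invariant linear_frechet_derivative F G) (auto simp: block_diagonal_def)
  then show ?thesis
    unfolding std_bivector_eq sum_less_split[OF mono]
    by (simp add: case_prod_unfold sum_subtractf)
qed

text \<open>The surviving terms differentiate only along the curves
  \<open>g ** rotation a b z t\<close> and \<open>rotation a b z t ** g\<close>, which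
  \<open>rot\<close> keeps inside \<open>S\<close>; hence only values on \<open>S\<close>
  count.\<close>

lemma presents_poisson_group:
  fixes S :: "'d::{finite,linorder} cmat set" and \<kappa> :: "'d \<Rightarrow> nat"
  assumes mono: "mono \<kappa>"
    and S: "S \<subseteq> unitary_group" and block: "\<And>g. g \<in> S \<Longrightarrow> block_diagonal \<kappa> g"
    and rot: "\<And>g a b z t. g \<in> S \<Longrightarrow> a < b \<Longrightarrow> \<kappa> a = \<kappa> b \<Longrightarrow> cmod z = 1 \<Longrightarrow>
      g ** rotation a b z t \<in> S \<and> rotation a b z t ** g \<in> S"
  shows "presents (poisson_group S) std_bivector"
  unfolding poisson_group_def
proof (rule presents_embedded)
  fix x W and F F' G G' :: "'d cmat \<Rightarrow> real"
  assume x: "x \<in> S" "x \<in> W" "open W"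
    and sm: "smooth_on W F" "smooth_on W F'" "smooth_on W G" "smooth_on W G'"
    and eq: "\<And>y. y \<in> W \<inter> S \<Longrightarrow> F y = F' y" "\<And>y. y \<in> W \<inter> S \<Longrightarrow> G y = G' y"
  have xu: "x \<in> unitary_group" using S x by blast
  note d = sm[THEN smooth_on_differentiable, OF x(2)]
  have "frechet_derivative E (at x) (x ** tangent_unit a b z) = frechet_derivative E' (at x) (x ** tangent_unit a b z)
      \<and> frechet_derivative E (at x) (tangent_unit a b z ** x) = frechet_derivative E' (at x) (tangent_unit a b z ** x)"
    if "E differentiable (at x)" "E' differentiable (at x)" "\<And>y. y \<in> W \<inter> S \<Longrightarrow> E y = E' y"
      "a < b" "\<kappa> a = \<kappa> b" "cmod z = 1" for E E' :: "'d cmat \<Rightarrow> real" and a b z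
    using rot[OF x(1) that(4-6)] that(3)
    by (intro conjI frechet_derivative_along_left[OF that(1,2) x(3,2)]
        frechet_derivative_along_right[OF that(1,2) x(3,2)]) auto
  note E = this
  have "left_wedge x a b F G
     - right_wedge x a b F G =
     left_wedge x a b F' G'
     - right_wedge x a b F' G'"
    if "a < b" "\<kappa> a = \<kappa> b" for a b
    unfolding wedge_at_def
    using E[OF d(1,2) eq(1) that, of 1] E[OF d(1,2) eq(1) that, of \<i>]
      E[OF d(3,4) eq(2) that, of 1] E[OF d(3,4) eq(2) that, of \<i>] by simp
  then show "std_bivector x F G = std_bivector x F' G'"
    unfolding std_bivector_block_diagonal[OF mono xu block[OF x(1)] d(1,3)]
      std_bivector_block_diagonal[OF mono xu block[OF x(1)] d(2,4)]
    by (intro sum.cong) auto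
qed

text \<open>The constant \<kappa> puts all indices into one class: every pair survives, and every
  rotation with unimodular parameter lies in the group.\<close>

lemma presents_unitary_group: "presents (poisson_group unitary_group) std_bivector"
  by (rule presents_poisson_group[of "\<lambda>_. 0"])
    (auto simp: monoI block_diagonal_def intro: unitary_mult rotation_unitary)

lemma presents_K: "presents (poisson_group (K k)) std_bivector"
proof (rule presents_poisson_group[of "\<lambda>a. if idx a \<le> k then 0 else 1"])
  show "K k \<subseteq> unitary_group" using K_D(2) by blast
next
  fix g :: "'a cmat"
  assume "g \<in> K k"
  then show "block_diagonal (\<lambda>a. if idx a \<le> k then 0 else 1) g"
    unfolding block_diagonal_def by (intro allI impI K_D(4)) (auto split: if_splits)
next
  fix g :: "'a cmat" and a b :: 'a and z t
  assume "g \<in> K k" "a < b" "(if idx a \<le> k then 0 else 1::nat) = (if idx b \<le> k then 0 else 1)" "cmod z = 1"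
  then show "g ** rotation a b z t \<in> K k \<and> rotation a b z t ** g \<in> K k"
    by (intro conjI K_mult rotation_K) (auto split: if_splits)
next
  show "mono (\<lambda>a::'a. if idx a \<le> k then 0 else 1::nat)"
  proof (rule monoI)
    fix a b :: 'a assume "a \<le> b"
    then have "idx a \<le> idx b" by simp
    then show "(if idx a \<le> k then 0 else 1::nat) \<le> (if idx b \<le> k then 0 else 1)"
      by (simp del: idx_le_iff)
  qed
qed

text \<open>
  Right translation by \<open>s\<close> preserves the right invariant half of \<open>\<pi>\<close> and replaces the left invariant
  half \<open>r\<close> by \<open>Ad\<^sub>s r\<close>. The blocks of \<open>s\<close> act on the off-diagonal part of \<open>r\<close> as symmetries, and the
  diagonal part is annihilated by functions that are invariant under the diagonal blocks.
\<close>

lemma std_bivector_translate: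
  fixes x s :: "'d::{finite,linorder} cmat" and \<kappa> :: "'d \<Rightarrow> nat"
  assumes mono: "mono \<kappa>"
    and s: "s \<in> unitary_group" "block_diagonal \<kappa> s"
    and W: "open W" "x \<in> W" and F: "smooth_on W F" and G: "smooth_on W G"
    and rot: "\<And>a b z t. a < b \<Longrightarrow> \<kappa> a = \<kappa> b \<Longrightarrow> cmod z = 1 \<Longrightarrow> rotation a b z t \<in> S"
    and normal: "\<And>t. t \<in> S \<Longrightarrow> s ** t ** conj_transpose s \<in> S"
    and inv: "\<And>E t. E \<in> {F, G} \<Longrightarrow> t \<in> S \<Longrightarrow> x ** t \<in> W \<Longrightarrow> E (x ** t) = E x"
  shows "std_bivector (x ** s) (\<lambda>z. F (z ** conj_transpose s)) (\<lambda>z. G (z ** conj_transpose s))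
    = std_bivector x F G"
proof -
  let ?R = "\<lambda>z::'d cmat. z ** conj_transpose s"
  have xs: "?R (x ** s) = x" by (simp add: unitary_cancel[OF s(1)])
  \<comment> \<open>Translated back by \<open>conj_transpose s\<close>, the curve through
    \<open>x ** s\<close> becomes \<open>x\<close> times a conjugate of a rotation, which
    \<open>normal\<close> places in \<open>S\<close>.\<close>
  have inv': "x ** s ** rotation a b z t ** conj_transpose s \<in> W \<Longrightarrow>
      E (x ** s ** rotation a b z t ** conj_transpose s) = E x"
    if E: "E \<in> {F, G}" and ab: "a < b" "\<kappa> a = \<kappa> b" "cmod z = 1" for E a b z t
    using inv[OF E normal[OF rot[OF ab, of t]]] by (simp add: matrix_mul_assoc)
  have dx: "E differentiable (at x)" if "E \<in> {F, G}" for E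
    using that F G W(2) smooth_on_differentiable by blast
  have D: "frechet_derivative (\<lambda>z. E (?R z)) (at (x ** s)) V = frechet_derivative E (at x) (?R V)"
    if "E \<in> {F, G}" for E V
    using frechet_derivative_compose_linear[OF bounded_linear_matrix_mult_right, of E "x ** s" "conj_transpose s" V] dx[OF that]
    unfolding xs by simp
  \<comment> \<open>Near \<open>x\<close> the function is constant along curves inside the coset of
    \<open>x\<close>, so pairs within a class contribute nothing to the left invariant half;
    \<open>Zs\<close> says the same at \<open>x ** s\<close>.\<close>
  have Z: "frechet_derivative E (at x) (x ** tangent_unit a b z) = 0"
    if E: "E \<in> {F, G}" and ab: "a < b" "\<kappa> a = \<kappa> b" "cmod z = 1" for E a b z
  proof -
    have "frechet_derivative E (at x) (x ** tangent_unit a b z) = frechet_derivative (\<lambda>_. E x) (at x) (x ** tangent_unit a b z)"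
      using inv[OF E rot[OF ab]] by (intro frechet_derivative_along_left[OF dx[OF E] _ W]) auto
    then show ?thesis by simp
  qed
  have Zs: "frechet_derivative (\<lambda>z. E (?R z)) (at (x ** s)) (x ** s ** tangent_unit a b z) = 0"
    if E: "E \<in> {F, G}" and ab: "a < b" "\<kappa> a = \<kappa> b" "cmod z = 1" for E a b z
  proof -
    have sm: "smooth_on (UNIV \<inter> ?R -` W) (\<lambda>z. E (?R z))" "open (UNIV \<inter> ?R -` W)"
      using smooth_map_open_vimage[of UNIV ?R W] E F G W(1)
      by (auto intro!: smooth_on_compose[of _ ?R W] smooth_map_bounded_linear bounded_linear_matrix_mult_right)
    have "frechet_derivative (\<lambda>z. E (?R z)) (at (x ** s)) (x ** s ** tangent_unit a b z)
        = frechet_derivative (\<lambda>_. E x) (at (x ** s)) (x ** s ** tangent_unit a b z)"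
      using inv'[OF E ab] W(2) xs
      by (intro frechet_derivative_along_left[OF _ _ sm(2)] smooth_on_differentiable[OF sm(1)]) auto
    then show ?thesis by simp
  qed
  \<comment> \<open>With these functionals the off-diagonal sums at \<open>x ** s\<close> and at
    \<open>x\<close> become the two sides of \<open>off_diagonal_invariant\<close>.\<close>
  let ?\<phi> = "\<lambda>V. frechet_derivative F (at x) (x ** V ** conj_transpose s)"
  let ?\<psi> = "\<lambda>V. frechet_derivative G (at x) (x ** V ** conj_transpose s)"
  have lin: "linear (\<lambda>V. frechet_derivative E (at x) (x ** V ** conj_transpose s))" if "E \<in> {F, G}" for E
    by (intro linear_compose[OF _ linear_frechet_derivative[OF dx[OF that]], unfolded o_def]
        linear_compose[OF _ bounded_linear.linear[OF bounded_linear_matrix_mult_right], unfolded o_def]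
        bounded_linear.linear[OF bounded_linear_matrix_mult_left])
  have "(\<Sum>(a,b) | \<kappa> a < \<kappa> b. left_wedge (x ** s) a b
        (\<lambda>z. F (?R z)) (\<lambda>z. G (?R z))) =
      (\<Sum>(a,b) | \<kappa> a < \<kappa> b. wedge ?\<phi> ?\<psi> (s ** tangent_unit a b \<i>) (s ** tangent_unit a b 1))"
    by (intro sum.cong) (auto simp: wedge_at_def wedge_def D matrix_mul_assoc)
  also have "\<dots> = (\<Sum>(a,b) | \<kappa> a < \<kappa> b. wedge ?\<phi> ?\<psi> (tangent_unit a b \<i> ** s) (tangent_unit a b 1 ** s))"
    using s by (intro off_diagonal_invariant lin) (auto simp: block_diagonal_def)
  also have "\<dots> = (\<Sum>(a,b) | \<kappa> a < \<kappa> b. left_wedge x a b F G)"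
    by (intro sum.cong) (auto simp: wedge_at_def wedge_def matrix_mul_assoc unitary_cancel[OF s(1)])
  finally have off: "(\<Sum>(a,b) | \<kappa> a < \<kappa> b. left_wedge (x ** s) a b
        (\<lambda>z. F (?R z)) (\<lambda>z. G (?R z))) =
      (\<Sum>(a,b) | \<kappa> a < \<kappa> b. left_wedge x a b F G)" .
  have on: "(\<Sum>(a,b) | a < b \<and> \<kappa> a = \<kappa> b. left_wedge (x ** s) a b
        (\<lambda>z. F (?R z)) (\<lambda>z. G (?R z))) =
      (\<Sum>(a,b) | a < b \<and> \<kappa> a = \<kappa> b. left_wedge x a b F G)"
    by (intro sum.cong) (auto simp: wedge_at_def Z Zs)
  \<comment> \<open>In right invariant directions the factor \<open>s\<close> stands last and
    cancels against \<open>conj_transpose s\<close>.\<close>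
  have right: "wedge_at (x ** s) (X ** (x ** s)) (Y ** (x ** s)) (\<lambda>z. F (?R z)) (\<lambda>z. G (?R z)) =
      wedge_at x (X ** x) (Y ** x) F G" for X Y
    by (simp add: wedge_at_def D matrix_mul_assoc unitary_cancel[OF s(1)])
  show ?thesis
    unfolding std_bivector_eq right case_prod_unfold sum_subtractf
    using sum_less_split[OF mono, of "\<lambda>a b. left_wedge (x ** s) a b
        (\<lambda>z. F (?R z)) (\<lambda>z. G (?R z))"]
      sum_less_split[OF mono, of "\<lambda>a b. left_wedge x a b F G"]
      off on by (simp add: case_prod_unfold)
qed

section \<open>Quotients by subgroups\<close>

definition matrix_subgroup :: "'d::finite cmat set \<Rightarrow> bool" where
  "matrix_subgroup S \<longleftrightarrow> S \<subseteq> unitary_group \<and> mat 1 \<in> S \<and>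
    (\<forall>s\<in>S. \<forall>t\<in>S. s ** t \<in> S) \<and> (\<forall>s\<in>S. conj_transpose s \<in> S)"

lemma left_coset_eq_iff:
  assumes S: "matrix_subgroup S"
  shows "left_coset S x = left_coset S y \<longleftrightarrow> (\<exists>s\<in>S. y = x ** s)"
proof
  assume "left_coset S x = left_coset S y"
  moreover have "y \<in> left_coset S y"
    unfolding left_coset_def using S by (intro image_eqI[of _ _ "mat 1"]) (auto simp: matrix_subgroup_def)
  ultimately show "\<exists>s\<in>S. y = x ** s" unfolding left_coset_def by blast
next
  assume "\<exists>s\<in>S. y = x ** s"
  then obtain s where s: "s \<in> S" "y = x ** s" by blast
  have u: "s \<in> unitary_group" using S s by (auto simp: matrix_subgroup_def)
  show "left_coset S x = left_coset S y"
  proof (intro equalityI subsetI)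
    fix z assume "z \<in> left_coset S x"
    then obtain t where t: "t \<in> S" "z = x ** t" by (auto simp: left_coset_def)
    then have "z = y ** (conj_transpose s ** t)"
      using s(2) by (simp add: matrix_mul_assoc unitary_cancel[OF u])
    then show "z \<in> left_coset S y"
      using S s t unfolding left_coset_def matrix_subgroup_def by blast
  next
    fix z assume "z \<in> left_coset S y"
    then obtain t where t: "t \<in> S" "z = y ** t" by (auto simp: left_coset_def)
    then have "z = x ** (s ** t)"
      using s(2) by (simp add: matrix_mul_assoc)
    then show "z \<in> left_coset S x"
      using S s t unfolding left_coset_def matrix_subgroup_def by blast
  qed
qed

lemma homogeneous_space_sel:
  "mtotal (homogeneous_space G S) = G" "mproj (homogeneous_space G S) = left_coset S"
  by (simp_all add: homogeneous_space_def quotient_poisson_def poisson_group_def embedded_poisson_def o_def)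

text \<open>Two points of a fibre differ by some \<open>s\<close> in \<open>S\<close>. Precomposing
  representatives near \<open>x\<close> with right multiplication by \<open>conj_transpose s\<close>
  gives representatives near \<open>x ** s\<close> of the same functions on the quotient;
  \<open>std_bivector_translate\<close> equates the brackets.\<close>

lemma presents_homogeneous_space:
  fixes G S :: "'d::{finite,linorder} cmat set" and \<kappa> :: "'d \<Rightarrow> nat"
  assumes mono: "mono \<kappa>"
    and G: "presents (poisson_group G) std_bivector" "\<And>g s. g \<in> G \<Longrightarrow> s \<in> S \<Longrightarrow> g ** s \<in> G"
    and S: "matrix_subgroup S" and block: "\<And>s. s \<in> S \<Longrightarrow> block_diagonal \<kappa> s"
    and rot: "\<And>a b z t. a < b \<Longrightarrow> \<kappa> a = \<kappa> b \<Longrightarrow> cmod z = 1 \<Longrightarrow> rotation a b z t \<in> S"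
  shows "presents (homogeneous_space G S) std_bivector"
  unfolding homogeneous_space_def
proof (rule presents_quotient[OF G(1)])
  have sel: "mtotal (poisson_group G) = G" "mproj (poisson_group G) = (\<lambda>x. x)"
    by (simp_all add: poisson_group_def embedded_poisson_def)
  fix x x' W and F H :: "'d cmat \<Rightarrow> real" and f h
  assume x: "x \<in> mtotal (poisson_group G)" "x' \<in> mtotal (poisson_group G)"
    and "left_coset S (mproj (poisson_group G) x) = left_coset S (mproj (poisson_group G) x')"
    and W: "x \<in> W" and F: "extends_on (poisson_group G) W F (f \<circ> left_coset S)"
    and H: "extends_on (poisson_group G) W H (h \<circ> left_coset S)"
  then obtain s where s: "s \<in> S" "x' = x ** s"
    unfolding sel using left_coset_eq_iff[OF S] by blast
  have u: "s \<in> unitary_group" using S s by (auto simp: matrix_subgroup_def)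
  have cs: "conj_transpose s \<in> S" using S s by (auto simp: matrix_subgroup_def)
  have xG: "x \<in> G" using x by (simp add: sel)
  have coset: "left_coset S (y ** t) = left_coset S y" if "t \<in> S" for y t
    using left_coset_eq_iff[OF S] that by metis
  let ?R = "\<lambda>z::'d cmat. z ** conj_transpose s"
  have T: "smooth_map UNIV ?R"
    by (intro smooth_map_bounded_linear bounded_linear_matrix_mult_right open_UNIV)
  have ext: "extends_on (poisson_group G) (UNIV \<inter> ?R -` W) (\<lambda>z. E (?R z)) (e \<circ> left_coset S)"
    if "extends_on (poisson_group G) W E (e \<circ> left_coset S)" for E e
    by (rule extends_on_compose[OF T _ that]) (use G(2) cs coset in \<open>auto simp: sel\<close>)
  have "std_bivector (x ** s) (\<lambda>z. F (?R z)) (\<lambda>z. H (?R z)) = std_bivector x F H"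
  proof (rule std_bivector_translate[OF mono u block[OF s(1)] _ W])
    show "open W" "smooth_on W F" "smooth_on W H" using F H by (auto simp: extends_on_def)
    show "rotation a b z t \<in> S" if "a < b" "\<kappa> a = \<kappa> b" "cmod z = 1" for a b z t
      using that by (rule rot)
    show "s ** t ** conj_transpose s \<in> S" if "t \<in> S" for t
      using that S s(1) cs unfolding matrix_subgroup_def by blast
    show "E (x ** t) = E x" if "E \<in> {F, H}" "t \<in> S" "x ** t \<in> W" for E t
      using that F H W xG G(2)[OF xG that(2)] coset[OF that(2)]
      by (auto simp: extends_on_def sel)
  qed
  moreover have "x' \<in> UNIV \<inter> ?R -` W" using W s by (simp add: unitary_cancel[OF u])
  ultimately show "\<exists>W' F' H'. x' \<in> W' \<and> extends_on (poisson_group G) W' F' (f \<circ> left_coset S) \<and>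
      extends_on (poisson_group G) W' H' (h \<circ> left_coset S) \<and> std_bivector x' F' H' = std_bivector x F H"
    using ext[OF F] ext[OF H] s(2)
    by (intro exI[of _ "UNIV \<inter> ?R -` W"] exI[of _ "\<lambda>z. F (?R z)"] exI[of _ "\<lambda>z. H (?R z)"]) simp
qed

section \<open>Odd spheres and the circle action\<close>

lemma mat_1_block_unitary_group: "mat 1 \<in> block_unitary_group J"
  by (simp add: block_unitary_group_def unitary_mat_1)

lemma matrix_subgroup_block_unitary_group: "matrix_subgroup (block_unitary_group J)"
proof -
  have mult: "s ** t \<in> block_unitary_group J"
    if s: "s \<in> block_unitary_group J" and t: "t \<in> block_unitary_group J" for s t :: "'a cmat"
  proof -
    have "(s ** t) $ i $ j = mat 1 $ i $ j" if "idx i \<notin> J \<or> idx j \<notin> J" for i j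
    proof (cases "idx i \<in> J")
      case False
      then have "(s ** t) $ i $ j = (mat 1 ** t) $ i $ j"
        unfolding matrix_matrix_mult_def vec_lambda_beta
        by (intro sum.cong) (auto simp: block_unitary_groupD(2)[OF s])
      then show ?thesis using that False by (simp add: block_unitary_groupD(2)[OF t])
    next
      case True
      with that have j: "idx j \<notin> J" by blast
      then have "(s ** t) $ i $ j = (s ** mat 1) $ i $ j"
        unfolding matrix_matrix_mult_def vec_lambda_beta
        by (intro sum.cong) (auto simp: block_unitary_groupD(2)[OF t])
      then show ?thesis using j by (simp add: block_unitary_groupD(2)[OF s])
    qed
    then show ?thesis
      using unitary_mult[OF block_unitary_groupD(1)[OF s] block_unitary_groupD(1)[OF t]]
      by (auto simp: block_unitary_group_def)
  qed
  have inv: "conj_transpose s \<in> block_unitary_group J" if s: "s \<in> block_unitary_group J" for s :: "'a cmat"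
  proof -
    have "cnj (s $ j $ i) = mat 1 $ i $ j" if "idx i \<notin> J \<or> idx j \<notin> J" for i j
    proof -
      have "s $ j $ i = mat 1 $ j $ i" using that by (intro block_unitary_groupD(2)[OF s]) blast
      then show ?thesis by (simp add: mat_def)
    qed
    then show ?thesis
      using unitary_conj_transpose[OF block_unitary_groupD(1)[OF s]] by (simp add: block_unitary_group_def)
  qed
  with mult show ?thesis
    unfolding matrix_subgroup_def using block_unitary_groupD(1) mat_1_block_unitary_group by blast
qed

lemma rotation_block_unitary_group:
  assumes "a \<noteq> b" "cmod z = 1" "idx a \<in> J" "idx b \<in> J"
  shows "rotation a b z t \<in> block_unitary_group J"
  using assms by (auto simp: block_unitary_group_def rotation_unitary rotation_nth mat_def)

text \<open>The conditions on \<kappa> say that \<open>J\<close>, if nonempty, is a class and that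
  all other classes are singletons. Rotations within classes therefore lie in the group.\<close>

lemma presents_block_quotient:
  fixes J :: "nat set" and \<kappa> :: "'d::{finite,linorder} \<Rightarrow> nat"
  assumes "mono \<kappa>"
    and "\<And>i j::'d. idx i \<in> J \<Longrightarrow> idx j \<in> J \<Longrightarrow> \<kappa> i = \<kappa> j"
    and J: "\<And>a b::'d. a < b \<Longrightarrow> \<kappa> a = \<kappa> b \<Longrightarrow> idx a \<in> J \<and> idx b \<in> J"
  shows "presents (homogeneous_space unitary_group (block_unitary_group J) :: ('d cmat, _) pman) std_bivector"
    and "s \<in> block_unitary_group J \<Longrightarrow> block_diagonal \<kappa> s"
proof -
  show block: "block_diagonal \<kappa> s" if "s \<in> block_unitary_group J" for s
    unfolding block_diagonal_def
  proof (intro allI impI)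
    fix i j assume "\<kappa> i \<noteq> \<kappa> j"
    then have "i \<noteq> j" "idx i \<notin> J \<or> idx j \<notin> J" using assms(2) by blast+
    then show "s $ i $ j = 0" using block_unitary_groupD(2)[OF that] by (simp add: mat_def)
  qed
  show "presents (homogeneous_space unitary_group (block_unitary_group J) :: ('d cmat, _) pman) std_bivector"
  proof (rule presents_homogeneous_space[OF assms(1) presents_unitary_group _ matrix_subgroup_block_unitary_group block])
    show "g ** s \<in> unitary_group" if "g \<in> unitary_group" "s \<in> block_unitary_group J" for g s :: "'d cmat"
      using that block_unitary_groupD(1) by (blast intro: unitary_mult)
    show "rotation a b z t \<in> block_unitary_group J" if "a < b" "\<kappa> a = \<kappa> b" "cmod z = 1" for a b z t
      using that J by (intro rotation_block_unitary_group) auto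
  qed
qed

definition first_class :: "'d::{finite,linorder} \<Rightarrow> nat" where
  "first_class a = (if idx a = 1 then 0 else 1)"

definition last_class :: "'d::{finite,linorder} \<Rightarrow> nat" where
  "last_class a = (if idx a = CARD('d) then 1 else 0)"

lemma idx_less_if_less: "a < b \<Longrightarrow> idx a < idx b" "a \<le> b \<Longrightarrow> idx a \<le> idx b"
  by simp_all

lemma first_class:
  fixes i j a b :: "'d::{finite,linorder}"
  shows "mono (first_class :: 'd \<Rightarrow> nat)"
    and "idx i \<in> {2..CARD('d)} \<Longrightarrow> idx j \<in> {2..CARD('d)} \<Longrightarrow> first_class i = first_class j"
    and "a < b \<Longrightarrow> first_class a = first_class b \<Longrightarrow> idx a \<in> {2..CARD('d)} \<and> idx b \<in> {2..CARD('d)}"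
proof -
  show "mono (first_class :: 'd \<Rightarrow> nat)"
  proof (rule monoI)
    fix a b :: 'd assume "a \<le> b"
    then show "first_class a \<le> first_class b"
      using idx_less_if_less(2)[of a b] idx_range[of a] by (auto simp: first_class_def simp del: idx_le_iff idx_pos)
  qed
  show "idx i \<in> {2..CARD('d)} \<Longrightarrow> idx j \<in> {2..CARD('d)} \<Longrightarrow> first_class i = first_class j"
    by (simp add: first_class_def)
  show "idx a \<in> {2..CARD('d)} \<and> idx b \<in> {2..CARD('d)}" if "a < b" "first_class a = first_class b"
  proof -
    have "idx a < idx b" "1 \<le> idx a" "idx b \<le> CARD('d)" using that(1) by auto
    moreover from this have "first_class b = 1" unfolding first_class_def by (intro if_not_P) linarith
    then have "idx a \<noteq> 1" using that(2) unfolding first_class_def by (metis zero_neq_one)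
    ultimately show ?thesis unfolding atLeastAtMost_iff by linarith
  qed
qed

lemma last_class:
  fixes i j a b :: "'d::{finite,linorder}"
  shows "mono (last_class :: 'd \<Rightarrow> nat)"
    and "idx i \<in> {1..CARD('d) - 1} \<Longrightarrow> idx j \<in> {1..CARD('d) - 1} \<Longrightarrow> last_class i = last_class j"
    and "a < b \<Longrightarrow> last_class a = last_class b \<Longrightarrow> idx a \<in> {1..CARD('d) - 1} \<and> idx b \<in> {1..CARD('d) - 1}"
proof -
  show "mono (last_class :: 'd \<Rightarrow> nat)"
  proof (rule monoI)
    fix a b :: 'd assume "a \<le> b"
    then show "last_class a \<le> last_class b"
      using idx_less_if_less(2)[of a b] idx_range[of b] by (auto simp: last_class_def simp del: idx_le_iff idx_pos)
  qed
  show "idx i \<in> {1..CARD('d) - 1} \<Longrightarrow> idx j \<in> {1..CARD('d) - 1} \<Longrightarrow> last_class i = last_class j"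
    by (auto simp: last_class_def simp del: idx_pos)
  show "idx a \<in> {1..CARD('d) - 1} \<and> idx b \<in> {1..CARD('d) - 1}" if "a < b" "last_class a = last_class b"
  proof -
    have "idx a < idx b" "1 \<le> idx a" "idx b \<le> CARD('d)" using that(1) by auto
    moreover from this have "last_class a = 0" unfolding last_class_def by (intro if_not_P) linarith
    then have "idx b \<noteq> CARD('d)" using that(2) unfolding last_class_def by (metis zero_neq_one)
    ultimately show ?thesis unfolding atLeastAtMost_iff by linarith
  qed
qed

lemma presents_sphere_first: "presents sphere_first std_bivector"
  unfolding sphere_first_def by (rule presents_block_quotient(1)[OF first_class(1)]) (use first_class in blast)+

lemma presents_sphere_last: "presents sphere_last std_bivector"
  unfolding sphere_last_def by (rule presents_block_quotient(1)[OF last_class(1)]) (use last_class in blast)+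

section \<open>The circle action on pairs of cosets\<close>

lemma unit_diag_eq: "unit_diag p a = diag_mat (\<lambda>i. if idx i = p then a else 1)"
  by (simp add: vec_eq_iff unit_diag_def diag_mat_nth)

lemma unit_diag_mult: "unit_diag p a ** unit_diag p b = unit_diag p (a * b)"
  by (auto simp: vec_eq_iff unit_diag_eq diag_mat_mult diag_mat_nth)

lemma unit_diag_1: "unit_diag p 1 = mat 1"
  by (auto simp: vec_eq_iff unit_diag_eq diag_mat_nth mat_def)

lemma unit_diag_unitary: "cmod a = 1 \<Longrightarrow> unit_diag p a \<in> unitary_group"
  unfolding unit_diag_eq by (intro diag_mat_unitary) auto

text \<open>Row and column \<open>p\<close> of \<open>B\<close> are those of the identity, so
  scaling the row and scaling the column agree.\<close>

lemma unit_diag_commute: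
  assumes B: "B \<in> block_unitary_group J" and p: "p \<notin> J"
  shows "unit_diag p a ** B = B ** unit_diag p a"
proof -
  have "(if idx i = p then a else 1) * B $ i $ j = B $ i $ j * (if idx j = p then a else 1)" for i j
  proof (cases "idx i = p \<or> idx j = p")
    case True
    then have "B $ i $ j = mat 1 $ i $ j" using p by (intro block_unitary_groupD(2)[OF B]) blast
    then show ?thesis by (auto simp: mat_def)
  qed auto
  then show ?thesis by (simp add: vec_eq_iff unit_diag_eq diag_mat_mult mult_diag_mat)
qed

lemma left_coset_unit_diag:
  assumes "p \<notin> J"
  shows "(\<lambda>x. x ** unit_diag p a) ` left_coset (block_unitary_group J) A =
    left_coset (block_unitary_group J) (A ** unit_diag p a)"
proof -
  have "A ** s ** unit_diag p a = A ** unit_diag p a ** s" if "s \<in> block_unitary_group J" for s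
    by (simp add: matrix_mul_assoc[symmetric] unit_diag_commute[OF that assms])
  then show ?thesis unfolding left_coset_def image_image by (intro image_cong) auto
qed

definition sphere_product_coset :: "'k::{finite,linorder} cmat \<times> 'l::{finite,linorder} cmat \<Rightarrow> 'k cmat set \<times> 'l cmat set" where
  "sphere_product_coset = map_prod (left_coset (block_unitary_group {2..CARD('k)}))
     (left_coset (block_unitary_group {1..CARD('l) - 1}))"

lemma circle_act_coset:
  "circle_act a (sphere_product_coset (A, B :: 'l::{finite,linorder} cmat)) =
    sphere_product_coset (A ** unit_diag 1 a, B ** unit_diag CARD('l) a)"
proof -
  have "CARD('l) \<notin> {1..CARD('l) - 1}" 
    unfolding atLeastAtMost_iff using zero_less_card_finite[where 'a = 'l] by linarith
  moreover have "1 \<notin> {2..CARD('a)}" by simp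
  ultimately show ?thesis
    by (simp only: circle_act_def sphere_product_coset_def map_prod_simp prod.case left_coset_unit_diag not_False_eq_True)
qed

abbreviation orbit_of :: "'k::{finite,linorder} cmat \<times> 'l::{finite,linorder} cmat \<Rightarrow> ('k cmat set \<times> 'l cmat set) set" where
  "orbit_of z \<equiv> circle_orbit (sphere_product_coset z)"

text \<open>Describes the fibres of the combined projection by right multiplication, the form needed
  both for invariance of the bracket and for the comparison with cosets in
  \<open>K k\<close>.\<close>

lemma circle_orbit_coset_eq_iff:
  fixes A A' :: "'k::{finite,linorder} cmat" and B B' :: "'l::{finite,linorder} cmat"
  shows "orbit_of (A, B) = orbit_of (A', B') \<longleftrightarrow>
    (\<exists>a s t. cmod a = 1 \<and> s \<in> block_unitary_group {2..CARD('k)} \<and> t \<in> block_unitary_group {1..CARD('l) - 1} \<and>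
      A' = A ** (unit_diag 1 a ** s) \<and> B' = B ** (unit_diag CARD('l) a ** t))"
    (is "?orb A B = ?orb A' B' \<longleftrightarrow> ?R")
proof -
  note iff1 = left_coset_eq_iff[OF matrix_subgroup_block_unitary_group]
  have "?orb A B = ?orb A' B' \<longleftrightarrow>
      (\<exists>a. cmod a = 1 \<and> sphere_product_coset (A', B') = circle_act a (sphere_product_coset (A, B)))"
  proof
    assume eq: "?orb A B = ?orb A' B'"
    have "circle_act 1 (sphere_product_coset (A', B')) = sphere_product_coset (A', B')"
      by (simp add: circle_act_coset unit_diag_1)
    then have "sphere_product_coset (A', B') \<in> ?orb A' B'"
      unfolding circle_orbit_def by (intro CollectI exI[of _ 1]) simp
    then have "sphere_product_coset (A', B') \<in> ?orb A B" by (simp only: eq)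
    then show "\<exists>a. cmod a = 1 \<and> sphere_product_coset (A', B') = circle_act a (sphere_product_coset (A, B))"
      unfolding circle_orbit_def by auto
  next
    assume "\<exists>a. cmod a = 1 \<and> sphere_product_coset (A', B') = circle_act a (sphere_product_coset (A, B))"
    then obtain a where a: "cmod a = 1" "sphere_product_coset (A', B') = circle_act a (sphere_product_coset (A, B))"
      by blast
    have aa: "a * cnj a = 1" using a(1) complex_norm_square[of a] by simp
    have 1: "circle_act b (sphere_product_coset (A', B')) = circle_act (a * b) (sphere_product_coset (A, B))" for b
      unfolding a(2) circle_act_coset by (simp add: matrix_mul_assoc[symmetric] unit_diag_mult)
    \<comment> \<open>\<open>cnj a\<close> inverts \<open>a\<close>, so each of the two pairs is
      reached from the other.\<close>
    have 2: "circle_act b (sphere_product_coset (A, B)) = circle_act (cnj a * b) (sphere_product_coset (A', B'))" for b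
      unfolding 1 using aa by (simp add: mult.assoc[symmetric])
    have "cmod b = 1 \<Longrightarrow> cmod (a * b) = 1 \<and> cmod (cnj a * b) = 1" for b
      using a(1) by (simp add: norm_mult)
    note unimodular = this
    show "?orb A B = ?orb A' B'"
    proof (intro equalityI subsetI)
      fix p assume "p \<in> ?orb A B"
      then obtain b where "cmod b = 1" "p = circle_act b (sphere_product_coset (A, B))"
        unfolding circle_orbit_def by blast
      then show "p \<in> ?orb A' B'"
        using 2[of b] unimodular[of b] unfolding circle_orbit_def by auto
    next
      fix p assume "p \<in> ?orb A' B'"
      then obtain b where "cmod b = 1" "p = circle_act b (sphere_product_coset (A', B'))"
        unfolding circle_orbit_def by blast
      then show "p \<in> ?orb A B"
        using 1[of b] unimodular[of b] unfolding circle_orbit_def by auto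
    qed
  qed
  also have "\<dots> \<longleftrightarrow> ?R"
    unfolding circle_act_coset
    by (auto simp: sphere_product_coset_def eq_commute[of "left_coset _ A'"] eq_commute[of "left_coset _ B'"]
        iff1 matrix_mul_assoc)
  finally show ?thesis .
qed

lemma smooth_map_compose_linear:
  assumes T: "bounded_linear T" and S: "smooth_map W S"
  shows "smooth_map W (\<lambda>x. T (S x))"
proof -
  have "smooth_on UNIV (\<lambda>y. T y \<bullet> b)" if "b \<in> Basis" for b
    using smooth_map_bounded_linear[OF T open_UNIV] that by (simp add: smooth_map_def)
  then show ?thesis
    using S smooth_on_compose[OF S, of UNIV] by (auto simp: smooth_map_def)
qed

lemma sphere_sel:
  "mtotal sphere_first = unitary_group"
  "mproj (sphere_first :: ('d::{finite,linorder} cmat, _) pman) = left_coset (block_unitary_group {2..CARD('d)})"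
  "mtotal sphere_last = unitary_group"
  "mproj (sphere_last :: ('d::{finite,linorder} cmat, _) pman) = left_coset (block_unitary_group {1..CARD('d) - 1})"
  by (simp_all add: sphere_first_def sphere_last_def homogeneous_space_sel)

lemma sphere_product_sel:
  "mtotal (product_poisson sphere_first sphere_last) = unitary_group \<times> unitary_group"
  "mproj (product_poisson sphere_first sphere_last) = sphere_product_coset"
  "mtotal sphere_product_mod_circle = unitary_group \<times> unitary_group"
  "mproj sphere_product_mod_circle = circle_orbit \<circ> sphere_product_coset"
  by (simp_all add: sphere_product_mod_circle_def quotient_poisson_def product_poisson_def sphere_sel
      sphere_product_coset_def)

lemma block_diagonal_mult:
  assumes "block_diagonal \<kappa> g" "block_diagonal \<kappa> h" shows "block_diagonal \<kappa> (g ** h)"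
  unfolding block_diagonal_def
proof (intro allI impI)
  fix i j assume "\<kappa> i \<noteq> \<kappa> j"
  then have "g $ i $ m * h $ m $ j = 0" for m
    using assms unfolding block_diagonal_def by (cases "\<kappa> i = \<kappa> m") auto
  then show "(g ** h) $ i $ j = 0"
    by (simp only: matrix_matrix_mult_def vec_lambda_beta sum.neutral_const)
qed

lemma block_diagonal_unit_diag: "block_diagonal \<kappa> (unit_diag p a)"
  by (auto simp: block_diagonal_def unit_diag_def)

text \<open>The circle element commutes with the subgroup, so the conjugation is that by
  \<open>s\<close> alone. This provides \<open>normal\<close> in
  \<open>std_bivector_translate\<close> for a translation that may lie outside the subgroup.\<close>

lemma unit_diag_conj_block:
  assumes a: "cmod a = 1" and s: "s \<in> block_unitary_group J" and t: "t \<in> block_unitary_group J" and p: "p \<notin> J"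
  shows "(unit_diag p a ** s) ** t ** conj_transpose (unit_diag p a ** s) \<in> block_unitary_group J"
proof -
  have "s ** t ** conj_transpose s \<in> block_unitary_group J"
    using matrix_subgroup_block_unitary_group[of J] s t unfolding matrix_subgroup_def by blast
  then have "unit_diag p a ** (s ** t ** conj_transpose s) ** conj_transpose (unit_diag p a) = s ** t ** conj_transpose s"
    unfolding unit_diag_commute[OF \<open>s ** t ** conj_transpose s \<in> block_unitary_group J\<close> p]
    by (simp add: matrix_mul_assoc[symmetric] unitary_groupD[OF unit_diag_unitary[OF a]])
  then have "(unit_diag p a ** s) ** t ** conj_transpose (unit_diag p a ** s) = s ** t ** conj_transpose s"
    by (simp add: conj_transpose_mult matrix_mul_assoc)
  then show ?thesis
    using \<open>s ** t ** conj_transpose s \<in> block_unitary_group J\<close> by simp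
qed

lemma last_notin: "CARD('d::finite) \<notin> {1..CARD('d) - 1}"
  unfolding atLeastAtMost_iff using zero_less_card_finite[where 'a = 'd] by linarith

lemma block_diagonal_first:
  "s \<in> block_unitary_group {2..CARD('d)} \<Longrightarrow> block_diagonal first_class (s :: 'd::{finite,linorder} cmat)"
  by (rule presents_block_quotient(2)[OF first_class]) assumption+

lemma block_diagonal_last:
  "s \<in> block_unitary_group {1..CARD('d) - 1} \<Longrightarrow> block_diagonal last_class (s :: 'd::{finite,linorder} cmat)"
  by (rule presents_block_quotient(2)[OF last_class]) assumption+

text \<open>Points over one orbit differ by right multiplication with \<open>u\<close> in the first
  factor and \<open>v\<close> in the second. Each is block diagonal for its sphere, so
  \<open>std_bivector_translate\<close> applies to the two partial functions separately.\<close>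

lemma presents_sphere_product_mod_circle:
  "presents (sphere_product_mod_circle :: ('k::{finite,linorder} cmat \<times> 'l::{finite,linorder} cmat, _) pman)
     (product_bivector std_bivector std_bivector)"
  unfolding sphere_product_mod_circle_def
proof (rule presents_quotient[OF presents_product[OF presents_sphere_first presents_sphere_last]])
  let ?M = "product_poisson sphere_first sphere_last :: ('k cmat \<times> 'l cmat, _) pman"
  let ?S = "block_unitary_group {2..CARD('k)} :: 'k cmat set"
  let ?S' = "block_unitary_group {1..CARD('l) - 1} :: 'l cmat set"
  fix x x' W and F G :: "'k cmat \<times> 'l cmat \<Rightarrow> real" and f g
  assume x: "x \<in> mtotal ?M" "x' \<in> mtotal ?M"
    and orb: "circle_orbit (mproj ?M x) = circle_orbit (mproj ?M x')" and W: "x \<in> W"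
    and F: "extends_on ?M W F (f \<circ> circle_orbit)" and G: "extends_on ?M W G (g \<circ> circle_orbit)"
  obtain A B where AB: "x = (A, B)" "A \<in> unitary_group" "B \<in> unitary_group"
    using x(1) by (auto simp: sphere_product_sel)
  obtain A' B' where AB': "x' = (A', B')" by (cases x')
  obtain a s t where a: "cmod a = 1" and st: "s \<in> ?S" "t \<in> ?S'"
    and A': "A' = A ** (unit_diag 1 a ** s)" and B': "B' = B ** (unit_diag CARD('l) a ** t)"
    using orb unfolding sphere_product_sel AB(1) AB' circle_orbit_coset_eq_iff by blast
  define u where "u = unit_diag 1 a ** s"
  define v where "v = unit_diag CARD('l) a ** t"
  have u: "u \<in> unitary_group" "block_diagonal first_class u"
    unfolding u_def
    by (intro unitary_mult unit_diag_unitary a block_unitary_groupD(1)[OF st(1)])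
      (intro block_diagonal_mult block_diagonal_unit_diag block_diagonal_first st(1))
  have v: "v \<in> unitary_group" "block_diagonal last_class v"
    unfolding v_def
    by (intro unitary_mult unit_diag_unitary a block_unitary_groupD(1)[OF st(2)])
      (intro block_diagonal_mult block_diagonal_unit_diag block_diagonal_last st(2))
  have orbit: "orbit_of (C ** (unit_diag 1 b ** s'), D ** (unit_diag CARD('l) b ** t')) =
      orbit_of (C, D)"
    if "cmod b = 1" "s' \<in> ?S" "t' \<in> ?S'" for b s' t' and C :: "'k cmat" and D :: "'l cmat"
    using that circle_orbit_coset_eq_iff by metis
  have one: "mat 1 \<in> ?S" "mat 1 \<in> ?S'" by (rule mat_1_block_unitary_group)+
  \<comment> \<open>Circle parameter \<open>1\<close> shows invariance under each subgroup
    separately, as required when the other variable is frozen.\<close>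
  have orbit1: "orbit_of (C ** s', D) = orbit_of (C, D)"
    if "s' \<in> ?S" for s' and C :: "'k cmat" and D :: "'l cmat"
    using orbit[of 1 s' "mat 1" C D] that one by (simp add: unit_diag_1)
  have orbit2: "orbit_of (C, D ** t') = orbit_of (C, D)"
    if "t' \<in> ?S'" for t' and C :: "'k cmat" and D :: "'l cmat"
    using orbit[of 1 "mat 1" t' C D] that one by (simp add: unit_diag_1)
  let ?R = "\<lambda>z::'k cmat \<times> 'l cmat. (fst z ** conj_transpose u, snd z ** conj_transpose v)"
  have T: "smooth_map UNIV ?R"
    by (intro smooth_map_bounded_linear bounded_linear_Pair open_UNIV
        bounded_linear_compose[OF bounded_linear_matrix_mult_right bounded_linear_fst]
        bounded_linear_compose[OF bounded_linear_matrix_mult_right bounded_linear_snd])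
  have Rx: "?R x' = x"
    unfolding AB(1) AB' A' B' u_def[symmetric] v_def[symmetric] by (simp add: unitary_cancel[OF u(1)] unitary_cancel[OF v(1)])
  have ext: "extends_on ?M (UNIV \<inter> ?R -` W) (\<lambda>z. E (?R z)) (e \<circ> circle_orbit)"
    if "extends_on ?M W E (e \<circ> circle_orbit)" for E e
  proof (rule extends_on_compose[OF T _ that])
    show "?R ` (UNIV \<inter> mtotal ?M) \<subseteq> mtotal ?M"
      using u(1) v(1) by (auto simp: sphere_product_sel intro!: unitary_mult unitary_conj_transpose)
    show "(e \<circ> circle_orbit) (mproj ?M z) = (e \<circ> circle_orbit) (mproj ?M (?R z))" for z
      using orbit[OF a st, of "fst (?R z)" "snd (?R z)"]
      unfolding u_def[symmetric] v_def[symmetric] sphere_product_sel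
      by (simp add: unitary_cancel[OF u(1)] unitary_cancel[OF v(1)])
  qed
  note FW = F[unfolded extends_on_def sphere_product_sel] G[unfolded extends_on_def sphere_product_sel]
  have oW: "open W" using FW by blast
  \<comment> \<open>The second variable is frozen at \<open>B\<close>: at
    \<open>x' = (A ** u, B ** v)\<close> the map \<open>?R\<close> brings it back from
    \<open>B ** v\<close>.\<close>
  have "std_bivector (A ** u) (\<lambda>z. (\<lambda>X. F (X, B)) (z ** conj_transpose u)) (\<lambda>z. (\<lambda>X. G (X, B)) (z ** conj_transpose u))
      = std_bivector A (\<lambda>X. F (X, B)) (\<lambda>X. G (X, B))"
  proof (rule std_bivector_translate[OF first_class(1) u open_slice_left[OF oW, of B], where S = ?S])
    show "A \<in> {X. (X, B) \<in> W}" using W AB by simp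
    show "smooth_on {X. (X, B) \<in> W} (\<lambda>X. F (X, B))" "smooth_on {X. (X, B) \<in> W} (\<lambda>X. G (X, B))"
      using FW by (auto intro: smooth_on_slice_left)
    show "rotation b d z r \<in> ?S" if "b < d" "first_class b = first_class d" "cmod z = 1" for b d z r
      using first_class(3)[OF that(1,2)] that(1,3) by (intro rotation_block_unitary_group) auto
    show "u ** r ** conj_transpose u \<in> ?S" if "r \<in> ?S" for r
      unfolding u_def by (rule unit_diag_conj_block[OF a st(1) that]) simp
    show "E (A ** r) = E A" if "E \<in> {\<lambda>X. F (X, B), \<lambda>X. G (X, B)}" "r \<in> ?S" "A ** r \<in> {X. (X, B) \<in> W}" for E r
      using that FW W AB orbit1[OF that(2), of A B] unitary_mult[OF AB(2) block_unitary_groupD(1)[OF that(2)]]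
      by auto
  qed
  moreover have "std_bivector (B ** v) (\<lambda>z. (\<lambda>X. F (A, X)) (z ** conj_transpose v)) (\<lambda>z. (\<lambda>X. G (A, X)) (z ** conj_transpose v))
      = std_bivector B (\<lambda>X. F (A, X)) (\<lambda>X. G (A, X))"
  proof (rule std_bivector_translate[OF last_class(1) v open_slice_right[OF oW, of A], where S = ?S'])
    show "B \<in> {X. (A, X) \<in> W}" using W AB by simp
    show "smooth_on {X. (A, X) \<in> W} (\<lambda>X. F (A, X))" "smooth_on {X. (A, X) \<in> W} (\<lambda>X. G (A, X))"
      using FW by (auto intro: smooth_on_slice_right)
    show "rotation b d z r \<in> ?S'" if "b < d" "last_class b = last_class d" "cmod z = 1" for b d z r
      using last_class(3)[OF that(1,2)] that(1,3) by (intro rotation_block_unitary_group) auto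
    show "v ** r ** conj_transpose v \<in> ?S'" if "r \<in> ?S'" for r
      unfolding v_def by (rule unit_diag_conj_block[OF a st(2) that last_notin])
    show "E (B ** r) = E B" if "E \<in> {\<lambda>X. F (A, X), \<lambda>X. G (A, X)}" "r \<in> ?S'" "B ** r \<in> {X. (A, X) \<in> W}" for E r
      using that FW W AB orbit2[OF that(2), of A B] unitary_mult[OF AB(3) block_unitary_groupD(1)[OF that(2)]]
      by auto
  qed
  ultimately have "product_bivector std_bivector std_bivector x' (\<lambda>z. F (?R z)) (\<lambda>z. G (?R z)) =
      product_bivector std_bivector std_bivector x F G"
    unfolding AB(1) AB' A' B' u_def[symmetric] v_def[symmetric] product_bivector_def
    by (simp add: unitary_cancel[OF u(1)] unitary_cancel[OF v(1)])
  then show "\<exists>W' F' G'. x' \<in> W' \<and> extends_on ?M W' F' (f \<circ> circle_orbit) \<and>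
      extends_on ?M W' G' (g \<circ> circle_orbit) \<and>
      product_bivector std_bivector std_bivector x' F' G' = product_bivector std_bivector std_bivector x F G"
    using ext[OF F] ext[OF G] W Rx
    by (intro exI[of _ "UNIV \<inter> ?R -` W"] exI[of _ "\<lambda>z. F (?R z)"] exI[of _ "\<lambda>z. G (?R z)"]) simp
qed

section \<open>The Poisson structure of \<open>K k\<close> modulo
  \<open>K k \<inter> H c\<close>\<close>

context first_last
begin

lemma matrix_subgroup_K_H:
  assumes c: "0 < c" "c < 1" and k: "1 \<le> k" "k < CARD('n)"
  shows "matrix_subgroup (K k \<inter> H c :: 'n cmat set)"
  unfolding matrix_subgroup_def
proof (intro conjI ballI)
  note iff = K_H_iff[OF c k]
  show "K k \<inter> H c \<subseteq> (unitary_group :: 'n cmat set)" using K_D(2) by blast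
  show "(mat 1 :: 'n cmat) \<in> K k \<inter> H c"
    unfolding iff using mat_1_K by (intro conjI exI[of _ 1]) (auto simp: mat_def)
  fix s :: "'n cmat" assume s: "s \<in> K k \<inter> H c"
  then obtain a where sK: "s \<in> K k"
    and sa: "\<And>i. s $ i $ p = (if i = p then a else 0)" "\<And>i. s $ i $ q = (if i = q then a else 0)"
    unfolding iff by blast
  have "s $ p $ j = 0" if "j \<noteq> p" for j
    using unitary_column(2)[OF K_D(2)[OF sK], of p j] sa that by simp
  moreover have "s $ q $ j = 0" if "j \<noteq> q" for j
    using unitary_column(2)[OF K_D(2)[OF sK], of q j] sa that by simp
  ultimately show "conj_transpose s \<in> K k \<inter> H c"
    unfolding iff using K_conj_transpose[OF sK] sa by (auto intro!: exI[of _ "cnj a"])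
  fix t :: "'n cmat" assume "t \<in> K k \<inter> H c"
  then obtain b where tK: "t \<in> K k"
    and tb: "\<And>i. t $ i $ p = (if i = p then b else 0)" "\<And>i. t $ i $ q = (if i = q then b else 0)"
    unfolding iff by blast
  have "(s ** t) $ i $ p = (if i = p then a * b else 0)" "(s ** t) $ i $ q = (if i = q then a * b else 0)" for i
    by (simp_all add: matrix_matrix_mult_def sa tb if_distrib[of "\<lambda>x. _ * x"] cong: if_cong)
  then show "s ** t \<in> K k \<inter> H c"
    unfolding iff using K_mult[OF sK tK] by blast
qed

lemma presents_K_mod_H:
  assumes c: "0 < c" "c < 1" and k: "1 \<le> k" "k < CARD('n)"
  shows "presents (homogeneous_space (K k) (K k \<inter> H c) :: ('n cmat, _) pman) std_bivector"
proof -
  note iff = K_H_iff[OF c k]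
  \<comment> \<open>The classes are {1}, {2..k}, {k+1..n-1}, {n}. Both ends are singletons, so
    rotations within classes fix the first and the last basis vector and satisfy
    \<open>K_H_iff\<close> with \<open>a = 1\<close>.\<close>
  define \<kappa> :: "'n \<Rightarrow> nat" where "\<kappa> i = (if i = p then 0 else if idx i \<le> k then 1 else if i = q then 3 else 2)" for i
  have pk: "idx p \<le> k" "\<not> idx q \<le> k" using p q k by auto
  show ?thesis
  proof (rule presents_homogeneous_space[OF _ presents_K _ matrix_subgroup_K_H[OF c k], of \<kappa>])
    show "mono \<kappa>"
    proof (rule monoI)
      fix a b :: 'n assume "a \<le> b"
      then have ab: "idx a \<le> idx b" by simp
      have "a = p" if "b = p" using ab that p idx_p_iff by simp
      moreover have "b = q" if "a = q" using ab that q idx_q_iff by simp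
      ultimately show "\<kappa> a \<le> \<kappa> b" using ab pk unfolding \<kappa>_def by (auto simp del: idx_le_iff)
    qed
    show "g ** s \<in> K k" if "g \<in> K k" "s \<in> K k \<inter> H c" for g s :: "'n cmat"
      using that by (blast intro: K_mult)
    show "block_diagonal \<kappa> s" if s: "s \<in> K k \<inter> H c" for s
      unfolding block_diagonal_def
    proof (intro allI impI)
      fix i j assume ij: "\<kappa> i \<noteq> \<kappa> j"
      obtain a where sK: "s \<in> K k"
        and sa: "\<And>i. s $ i $ p = (if i = p then a else 0)" "\<And>i. s $ i $ q = (if i = q then a else 0)"
        using s unfolding iff by blast
      have row: "s $ p $ j = 0" if "j \<noteq> p" for j
        using unitary_column(2)[OF K_D(2)[OF sK], of p j] sa that by simp
      have row': "s $ q $ j = 0" if "j \<noteq> q" for j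
        using unitary_column(2)[OF K_D(2)[OF sK], of q j] sa that by simp
      show "s $ i $ j = 0"
        using ij row row' sa K_D(4)[OF sK, of i j] unfolding \<kappa>_def by (auto split: if_splits)
    qed
    fix a b :: 'n and z t assume ab: "a < b" "\<kappa> a = \<kappa> b" "cmod z = 1"
    have ne: "a \<noteq> b" using ab by auto
    have "a \<noteq> p \<and> b \<noteq> p \<and> a \<noteq> q \<and> b \<noteq> q" and same: "idx a \<le> k \<longleftrightarrow> idx b \<le> k"
      using ab(2) ne pk unfolding \<kappa>_def by (auto split: if_splits)
    then have "rotation a b z t $ i $ p = (if i = p then 1 else 0) \<and> rotation a b z t $ i $ q = (if i = q then 1 else 0)" for i
      using ne by (auto simp: rotation_nth)
    then show "rotation a b z t \<in> K k \<inter> H c"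
      unfolding iff using rotation_K[OF ne ab(3) same] by blast
  qed
qed

end

section \<open>Diagonal blocks\<close>

lemma frechet_derivative_slice:
  assumes "F differentiable (at (x, y))"
  shows "frechet_derivative (\<lambda>u. F (u, y)) (at x) v = frechet_derivative F (at (x, y)) (v, 0)"
    and "frechet_derivative (\<lambda>u. F (x, u)) (at y) w = frechet_derivative F (at (x, y)) (0, w)"
proof -
  have F: "(F has_derivative frechet_derivative F (at (x, y))) (at (x, y))"
    using assms by (simp add: frechet_derivative_works)
  have "((\<lambda>u. (u, y)) has_derivative (\<lambda>v. (v, 0))) (at x)"
    "((\<lambda>u. (x, u)) has_derivative (\<lambda>v. (0, v))) (at y)"
    by (auto intro!: derivative_eq_intros)
  from this[THEN has_derivative_compose, OF F]
  show "frechet_derivative (\<lambda>u. F (u, y)) (at x) v = frechet_derivative F (at (x, y)) (v, 0)"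
    "frechet_derivative (\<lambda>u. F (x, u)) (at y) w = frechet_derivative F (at (x, y)) (0, w)"
    by (metis frechet_derivative_at)+
qed

text \<open>The blocks have index types of their own; \<open>e1\<close> and \<open>e2\<close>
  identify these, in increasing order, with the first \<open>CARD('k)\<close> indices and with the
  remaining ones.\<close>

locale two_blocks = first_last p q for p q :: "'n::{finite,linorder}" +
  fixes e1 :: "'k::{finite,linorder} \<Rightarrow> 'n" and e2 :: "'l::{finite,linorder} \<Rightarrow> 'n"
  assumes e1: "idx (e1 i) = idx i" and e2: "idx (e2 j) = CARD('k) + idx j"
    and card: "CARD('n) = CARD('k) + CARD('l)"
begin

lemma e1_le: "idx (e1 i) \<le> CARD('k)"
  by (simp add: e1)

lemma e2_gt: "\<not> idx (e2 j) \<le> CARD('k)"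
  using idx_pos(3)[of j] unfolding e2 by linarith

lemma obtain_e1:
  assumes "idx m \<le> CARD('k)" obtains i where "m = e1 i"
proof -
  obtain i :: 'k where "idx i = idx m" using obtain_idx[OF _ assms] by auto
  then have "m = e1 i" using idx_eq_iff[of m "e1 i"] by (simp add: e1)
  then show thesis by (rule that)
qed

lemma obtain_e2:
  assumes "\<not> idx m \<le> CARD('k)" obtains j where "m = e2 j"
proof -
  have "idx m \<le> CARD('k) + CARD('l)" using idx_pos(4)[of m] card by simp
  then have "idx m - CARD('k) \<in> {1..CARD('l)}"
    using assms by (simp only: atLeastAtMost_iff) linarith
  then have "idx m - CARD('k) \<in> range (idx :: 'l \<Rightarrow> nat)"
    by (simp only: bij_betw_imp_surj_on[OF bij_betw_idx])
  then obtain j :: 'l where j: "idx j = idx m - CARD('k)" by (metis rangeE)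
  have "idx (e2 j) = idx m" unfolding e2 j using assms by linarith
  then show thesis using that[of j] by simp
qed

lemma e_eq_iff [simp]: "e1 i = e1 i' \<longleftrightarrow> i = i'" "e2 j = e2 j' \<longleftrightarrow> j = j'" "e1 i \<noteq> e2 j" "e2 j \<noteq> e1 i"
proof -
  show "e1 i = e1 i' \<longleftrightarrow> i = i'" by (metis e1 idx_eq_iff)
  show "e2 j = e2 j' \<longleftrightarrow> j = j'" by (metis add_left_cancel e2 idx_eq_iff)
  show "e1 i \<noteq> e2 j" "e2 j \<noteq> e1 i" using e1_le e2_gt by metis+
qed

lemma e_less_iff [simp]: "e1 i < e1 i' \<longleftrightarrow> i < i'" "e2 j < e2 j' \<longleftrightarrow> j < j'" "e1 i < e2 j" "\<not> e2 j < e1 i"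
proof -
  show "e1 i < e1 i' \<longleftrightarrow> i < i'" "e2 j < e2 j' \<longleftrightarrow> j < j'"
    by (simp_all only: idx_less_iff[symmetric] e1 e2 nat_add_left_cancel_less)
  have "idx (e1 i) < idx (e2 j)" using e1_le[of i] e2_gt[of j] by linarith
  then show "e1 i < e2 j" "\<not> e2 j < e1 i" by auto
qed

lemma index_cases:
  obtains i where "m = e1 i" | j where "m = e2 j"
  using obtain_e1[of m] obtain_e2[of m] by blast

definition block1 :: "'n cmat \<Rightarrow> 'k cmat" where
  "block1 g = (\<chi> i j. g $ e1 i $ e1 j)"

definition block2 :: "'n cmat \<Rightarrow> 'l cmat" where
  "block2 g = (\<chi> i j. g $ e2 i $ e2 j)"

definition join :: "'k cmat \<times> 'l cmat \<Rightarrow> 'n cmat" where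
  "join z = (\<chi> m r. if idx m \<le> CARD('k) \<and> idx r \<le> CARD('k) then fst z $ inv e1 m $ inv e1 r
     else if \<not> idx m \<le> CARD('k) \<and> \<not> idx r \<le> CARD('k) then snd z $ inv e2 m $ inv e2 r else 0)"

lemma inv_e [simp]: "inv e1 (e1 i) = i" "inv e2 (e2 j) = j"
  by (simp_all add: inv_f_f inj_def)

lemma join_nth [simp]:
  "join z $ e1 i $ e1 i' = fst z $ i $ i'" "join z $ e2 j $ e2 j' = snd z $ j $ j'"
  "join z $ e1 i $ e2 j = 0" "join z $ e2 j $ e1 i = 0"
  using e1_le e2_gt by (simp_all add: join_def)

lemma block_nth [simp]: "block1 g $ i $ i' = g $ e1 i $ e1 i'" "block2 g $ j $ j' = g $ e2 j $ e2 j'"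
  by (simp_all add: block1_def block2_def)

lemma cmat_eqI:
  assumes "\<And>i i'. g $ e1 i $ e1 i' = h $ e1 i $ e1 i'" "\<And>j j'. g $ e2 j $ e2 j' = h $ e2 j $ e2 j'"
    "\<And>i j. g $ e1 i $ e2 j = h $ e1 i $ e2 j" "\<And>i j. g $ e2 j $ e1 i = h $ e2 j $ e1 i"
  shows "g = (h :: 'n cmat)"
proof -
  have "g $ m $ r = h $ m $ r" for m r
    by (cases m rule: index_cases; cases r rule: index_cases) (simp_all add: assms)
  then show ?thesis by (simp add: vec_eq_iff)
qed

lemma sum_blocks: "(\<Sum>m\<in>UNIV. f m) = (\<Sum>i\<in>UNIV. f (e1 i)) + (\<Sum>j\<in>UNIV. f (e2 j))" for f :: "'n \<Rightarrow> 'a::comm_monoid_add"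
proof -
  have "(UNIV :: 'n set) = range e1 \<union> range e2" using index_cases by blast
  then have "(\<Sum>m\<in>UNIV. f m) = sum f (range e1 \<union> range e2)" by metis
  also have "\<dots> = sum f (range e1) + sum f (range e2)"
    by (rule sum.union_disjoint) auto
  finally show ?thesis by (simp add: sum.reindex inj_def)
qed

definition off_zero :: "'n cmat \<Rightarrow> bool" where
  "off_zero g \<longleftrightarrow> (\<forall>i j. g $ e1 i $ e2 j = 0 \<and> g $ e2 j $ e1 i = 0)"

lemma join_mult: "join z ** join w = join (fst z ** fst w, snd z ** snd w)"
  by (rule cmat_eqI) (simp_all add: matrix_matrix_mult_def sum_blocks)

lemma join_mat_1: "join (mat 1, mat 1) = mat 1"
  by (rule cmat_eqI) (simp_all add: mat_def)

lemma conj_transpose_join: "conj_transpose (join z) = join (conj_transpose (fst z), conj_transpose (snd z))"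
  by (rule cmat_eqI) simp_all

lemma join_unitary: "A \<in> unitary_group \<Longrightarrow> B \<in> unitary_group \<Longrightarrow> join (A, B) \<in> unitary_group"
  by (rule unitary_groupI) (simp add: conj_transpose_join join_mult unitary_groupD join_mat_1)

lemma block_join [simp]: "block1 (join z) = fst z" "block2 (join z) = snd z"
  by (simp_all add: vec_eq_iff)

lemma K_off_zero: "g \<in> K CARD('k) \<Longrightarrow> off_zero g"
  unfolding off_zero_def using K_D(4)[of g "CARD('k)"] e1_le e2_gt by blast

lemma join_block: "off_zero g \<Longrightarrow> join (block1 g, block2 g) = g"
  by (rule cmat_eqI) (simp_all add: off_zero_def)

lemma block_mult:
  assumes "off_zero g"
  shows "block1 (g ** h) = block1 g ** block1 h" "block2 (g ** h) = block2 g ** block2 h"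
  using assms by (simp_all add: vec_eq_iff matrix_matrix_mult_def sum_blocks off_zero_def)

lemma block_unitary:
  assumes g: "g \<in> unitary_group" "off_zero g"
  shows "block1 g \<in> unitary_group" "block2 g \<in> unitary_group"
proof -
  have "conj_transpose (block1 g) = block1 (conj_transpose g)" "conj_transpose (block2 g) = block2 (conj_transpose g)"
    by (simp_all add: vec_eq_iff)
  moreover have "block1 (mat 1) = mat 1" "block2 (mat 1) = mat 1"
    by (simp_all add: vec_eq_iff mat_def)
  ultimately show "block1 g \<in> unitary_group" "block2 g \<in> unitary_group"
    using unitary_groupD(1)[OF g(1)] block_mult[OF g(2), of "conj_transpose g"]
    by (auto intro!: unitary_groupI)
qed

lemma join_K: "A \<in> unitary_group \<Longrightarrow> B \<in> unitary_group \<Longrightarrow> det (join (A, B)) = 1 \<Longrightarrow> join (A, B) \<in> K CARD('k)"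
  using join_unitary[of A B]
  by (auto simp: K_def special_unitary_group_def join_def)

definition blocks :: "'n cmat \<Rightarrow> 'k cmat \<times> 'l cmat" where
  "blocks g = (block1 g, block2 g)"

lemma bounded_linear_blocks: "bounded_linear blocks"
  unfolding blocks_def
  by (rule linear_conv_bounded_linear[THEN iffD1], rule linearI) (simp_all add: vec_eq_iff)

lemma bounded_linear_join: "bounded_linear join"
  by (rule linear_conv_bounded_linear[THEN iffD1], rule linearI)
    (rule cmat_eqI; simp)+

lemma sum_less_blocks:
  fixes h :: "'n \<Rightarrow> 'n \<Rightarrow> real"
  assumes "\<And>i j. h (e1 i) (e2 j) = 0"
  shows "(\<Sum>(a,b) | a < b. h a b) = (\<Sum>(a,b) | a < b. h (e1 a) (e1 b)) + (\<Sum>(a,b) | a < b. h (e2 a) (e2 b))"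
proof -
  let ?A1 = "(\<lambda>(a,b). (e1 a, e1 b)) ` {(a,b). a < b}" and ?A2 = "(\<lambda>(a,b). (e2 a, e2 b)) ` {(a,b). a < b}"
  have "(\<Sum>(a,b) | a < b. h a b) = (\<Sum>(a,b) \<in> ?A1 \<union> ?A2. h a b)"
  proof (rule sum.mono_neutral_right)
    show "?A1 \<union> ?A2 \<subseteq> {(a, b). a < b}" by auto
    show "\<forall>x\<in>{(a, b). a < b} - (?A1 \<union> ?A2). (case x of (a, b) \<Rightarrow> h a b) = 0"
    proof
      fix x assume x: "x \<in> {(a, b). a < b} - (?A1 \<union> ?A2)"
      obtain a b where ab: "x = (a, b)" by (cases x)
      show "(case x of (a, b) \<Rightarrow> h a b) = 0"
        using x assms unfolding ab
        by (cases a rule: index_cases; cases b rule: index_cases) (auto simp: image_iff)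
    qed
  qed simp
  also have "\<dots> = (\<Sum>(a,b) \<in> ?A1. h a b) + (\<Sum>(a,b) \<in> ?A2. h a b)"
    by (rule sum.union_disjoint) auto
  also have "(\<Sum>(a,b) \<in> ?A1. h a b) = (\<Sum>(a,b) | a < b. h (e1 a) (e1 b))"
    by (subst sum.reindex) (auto simp: inj_on_def case_prod_unfold)
  also have "(\<Sum>(a,b) \<in> ?A2. h a b) = (\<Sum>(a,b) | a < b. h (e2 a) (e2 b))"
    by (subst sum.reindex) (auto simp: inj_on_def case_prod_unfold)
  finally show ?thesis .
qed

lemma blocks_tangent_unit:
  "blocks (tangent_unit (e1 a) (e1 b) z) = (tangent_unit a b z, 0)"
  "blocks (tangent_unit (e2 c) (e2 d) z) = (0, tangent_unit c d z)"
  "blocks (tangent_unit (e1 a) (e2 c) z) = (0, 0)"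
  by (auto simp: blocks_def vec_eq_iff tangent_unit_nth)

text \<open>\<open>blocks\<close> kills the mixed tangent units and maps the others to tangent units
  of one factor; block diagonality of \<open>g\<close> makes it compatible with multiplication by
  \<open>g\<close> on either side.\<close>

lemma std_bivector_blocks:
  assumes g: "off_zero g" and F: "F differentiable (at (blocks g))" and G: "G differentiable (at (blocks g))"
  shows "std_bivector g (\<lambda>x. F (blocks x)) (\<lambda>x. G (blocks x)) =
    product_bivector std_bivector std_bivector (blocks g) F G"
proof -
  have left: "blocks (g ** X) = (block1 g ** fst (blocks X), block2 g ** snd (blocks X))" for X
    by (simp add: blocks_def block_mult[OF g])
  have right: "blocks (X ** g) = (fst (blocks X) ** block1 g, snd (blocks X) ** block2 g)" for X
    using g by (simp add: blocks_def vec_eq_iff matrix_matrix_mult_def sum_blocks off_zero_def)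
  have D: "frechet_derivative (\<lambda>x. E (blocks x)) (at g) V = frechet_derivative E (at (blocks g)) (blocks V)"
    if "E differentiable (at (blocks g))" for E :: "'k cmat \<times> 'l cmat \<Rightarrow> real" and V
    by (rule frechet_derivative_compose_linear[OF bounded_linear_blocks that])
  have Z: "frechet_derivative E (at (blocks g)) (0, 0) = 0" if "E differentiable (at (blocks g))"
    for E :: "'k cmat \<times> 'l cmat \<Rightarrow> real"
    using linear_0[OF linear_frechet_derivative[OF that]] by (simp add: zero_prod_def)
  have w: "wedge_at g X Y (\<lambda>x. F (blocks x)) (\<lambda>x. G (blocks x)) = wedge_at (blocks g) (blocks X) (blocks Y) F G" for X Y
    by (simp add: wedge_at_def D[OF F] D[OF G])
  have w0: "wedge_at (blocks g) (0, 0) Y F G = 0" for Y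
    by (simp add: wedge_at_def Z[OF F] Z[OF G])
  note F' = F[unfolded blocks_def] and G' = G[unfolded blocks_def]
  have w1: "wedge_at (block1 g) X Y (\<lambda>u. F (u, block2 g)) (\<lambda>u. G (u, block2 g)) = wedge_at (blocks g) (X, 0) (Y, 0) F G" for X Y
    by (simp add: wedge_at_def blocks_def frechet_derivative_slice(1)[OF F'] frechet_derivative_slice(1)[OF G'])
  have w2: "wedge_at (block2 g) X Y (\<lambda>u. F (block1 g, u)) (\<lambda>u. G (block1 g, u)) = wedge_at (blocks g) (0, X) (0, Y) F G" for X Y
    by (simp add: wedge_at_def blocks_def frechet_derivative_slice(2)[OF F'] frechet_derivative_slice(2)[OF G'])
  have pb: "product_bivector std_bivector std_bivector (blocks g) F G =
      std_bivector (block1 g) (\<lambda>u. F (u, block2 g)) (\<lambda>u. G (u, block2 g)) +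
      std_bivector (block2 g) (\<lambda>u. F (block1 g, u)) (\<lambda>u. G (block1 g, u))"
    by (simp add: product_bivector_def blocks_def)
  show ?thesis
    unfolding pb std_bivector_eq w w1 w2
    by (subst sum_less_blocks) (simp_all add: left right blocks_tangent_unit w0)
qed

end

section \<open>Cosets, circle orbits and local sections\<close>

lemma unit_column_block_unitary:
  fixes A :: "'d::{finite,linorder} cmat"
  assumes A: "A \<in> unitary_group" and col: "\<And>i. A $ i $ r = (if i = r then 1 else 0)"
    and J: "\<And>i::'d. idx i \<notin> J \<longleftrightarrow> i = r"
  shows "A \<in> block_unitary_group J"
proof -
  have "A $ r $ j = 0" if "j \<noteq> r" for j
    using unitary_column(2)[OF A, of r j] col that by simp
  with A col J show ?thesis by (auto simp: block_unitary_group_def mat_def)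
qed

context two_blocks
begin

lemma obtain_ends:
  obtains p' :: 'k and q' :: 'l where "e1 p' = p" "e2 q' = q"
    "\<And>i::'k. idx i = 1 \<longleftrightarrow> i = p'" "\<And>i::'k. idx i \<notin> {2..CARD('k)} \<longleftrightarrow> i = p'"
    "\<And>j::'l. idx j = CARD('l) \<longleftrightarrow> j = q'" "\<And>j::'l. idx j \<notin> {1..CARD('l) - 1} \<longleftrightarrow> j = q'"
proof -
  have "idx p \<le> CARD('k)" using p zero_less_card_finite[where 'a = 'k] by linarith
  then obtain p' where p': "p = e1 p'" by (rule obtain_e1)
  have "\<not> idx q \<le> CARD('k)" unfolding q card using zero_less_card_finite[where 'a = 'l] by linarith
  then obtain q' where q': "q = e2 q'" by (rule obtain_e2)
  have 1: "idx p' = 1" using p e1[of p'] p' by simp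
  have 2: "idx q' = CARD('l)" using q e2[of q'] q' card by simp
  have p1: "idx i = 1 \<longleftrightarrow> i = p'" for i :: 'k using 1 idx_eq_iff[of i p'] by auto
  have q1: "idx j = CARD('l) \<longleftrightarrow> j = q'" for j :: 'l using 2 idx_eq_iff[of j q'] by auto
  have "idx i \<notin> {2..CARD('k)} \<longleftrightarrow> idx i = 1" for i :: 'k
    using idx_pos(2,4)[of i] unfolding atLeastAtMost_iff by linarith
  moreover have "idx j \<notin> {1..CARD('l) - 1} \<longleftrightarrow> idx j = CARD('l)" for j :: 'l
    using idx_pos(2,4)[of j] unfolding atLeastAtMost_iff by linarith
  ultimately show thesis using p' q' p1 q1 by (intro that[of p' q']) simp_all
qed

lemma join_unit_diag: "join (unit_diag 1 a, unit_diag CARD('l) a) = ends_diag a"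
proof -
  obtain p' :: 'k and q' :: 'l where pq': "e1 p' = p" "e2 q' = q"
    "\<And>i::'k. idx i = 1 \<longleftrightarrow> i = p'" "\<And>j::'l. idx j = CARD('l) \<longleftrightarrow> j = q'"
    by (metis obtain_ends)
  show ?thesis
    unfolding ends_diag_def unit_diag_eq
    by (rule cmat_eqI) (simp_all add: diag_mat_nth pq'(3,4) pq'(1,2)[symmetric] del: One_nat_def)
qed

lemma blocks_unitary: "g \<in> K CARD('k) \<Longrightarrow> blocks g \<in> unitary_group \<times> unitary_group"
  unfolding blocks_def using block_unitary K_D(2) K_off_zero by blast

text \<open>Splitting off the corner entry \<open>a\<close> turns the blocks of an element of
  \<open>K CARD('k) \<inter> H c\<close> into circle elements times elements of the two sphere
  subgroups. That both corners are equal means that one circle acts on both factors.\<close>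

lemma coset_iff_orbit:
  assumes c: "0 < c" "c < 1" and g: "g \<in> K CARD('k)" "g' \<in> K CARD('k)"
  shows "left_coset (K CARD('k) \<inter> H c) g = left_coset (K CARD('k) \<inter> H c) g' \<longleftrightarrow>
    orbit_of (blocks g) = orbit_of (blocks g')"
proof -
  obtain p' :: 'k and q' :: 'l where pq': "e1 p' = p" "e2 q' = q"
    and p1: "\<And>i::'k. idx i = 1 \<longleftrightarrow> i = p'" and pJ: "\<And>i::'k. idx i \<notin> {2..CARD('k)} \<longleftrightarrow> i = p'"
    and q1: "\<And>j::'l. idx j = CARD('l) \<longleftrightarrow> j = q'" and qJ: "\<And>j::'l. idx j \<notin> {1..CARD('l) - 1} \<longleftrightarrow> j = q'"
    by (rule obtain_ends) blast
  have k: "1 \<le> CARD('k)" "CARD('k) < CARD('n)"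
    using zero_less_card_finite[where 'a = 'k] zero_less_card_finite[where 'a = 'l] unfolding card by linarith+
  note iff = K_H_iff[OF c k] and sub = matrix_subgroup_K_H[OF c k]
  have "(\<exists>s\<in>K CARD('k) \<inter> H c. g' = g ** s) \<longleftrightarrow>
    (\<exists>a s t. cmod a = 1 \<and> s \<in> block_unitary_group {2..CARD('k)} \<and> t \<in> block_unitary_group {1..CARD('l) - 1} \<and>
      block1 g' = block1 g ** (unit_diag 1 a ** s) \<and> block2 g' = block2 g ** (unit_diag CARD('l) a ** t))"
    (is "?L = ?R")
  proof
    assume ?L
    then obtain s where s: "s \<in> K CARD('k) \<inter> H c" "g' = g ** s" by blast
    then obtain a where sK: "s \<in> K CARD('k)"
      and sa: "\<And>i. s $ i $ p = (if i = p then a else 0)" "\<And>i. s $ i $ q = (if i = q then a else 0)"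
      unfolding iff by blast
    have a: "cmod a = 1" using unitary_column(1)[OF K_D(2)[OF sK], of p] sa(1) by simp
    then have aa: "a * cnj a = 1" "cnj a * a = 1" using complex_norm_square[of a] by (simp_all add: mult.commute)
    \<comment> \<open>Division by the corner entry makes the distinguished column a basis vector,
      which \<open>unit_column_block_unitary\<close> recognizes.\<close>
    define s1 where "s1 = unit_diag 1 (cnj a) ** block1 s"
    define s2 where "s2 = unit_diag CARD('l) (cnj a) ** block2 s"
    have un: "block1 s \<in> unitary_group" "block2 s \<in> unitary_group"
      using block_unitary K_D(2)[OF sK] K_off_zero[OF sK] by blast+
    have "s1 \<in> block_unitary_group {2..CARD('k)}"
    proof (rule unit_column_block_unitary[where r = p'])
      show "s1 \<in> unitary_group"
        unfolding s1_def using a un by (intro unitary_mult unit_diag_unitary) auto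
      show "s1 $ i $ p' = (if i = p' then 1 else 0)" for i
        unfolding s1_def unit_diag_eq diag_mat_mult block_nth p1 pq' sa
        by (simp add: pq'[symmetric] aa)
    qed (rule pJ)
    moreover have "s2 \<in> block_unitary_group {1..CARD('l) - 1}"
    proof (rule unit_column_block_unitary[where r = q'])
      show "s2 \<in> unitary_group"
        unfolding s2_def using a un by (intro unitary_mult unit_diag_unitary) auto
      show "s2 $ i $ q' = (if i = q' then 1 else 0)" for i
        unfolding s2_def unit_diag_eq diag_mat_mult block_nth q1 pq' sa
        by (simp add: pq'[symmetric] aa)
    qed (rule qJ)
    moreover have "unit_diag 1 a ** s1 = block1 s" "unit_diag CARD('l) a ** s2 = block2 s"
      by (simp_all only: s1_def s2_def matrix_mul_assoc unit_diag_mult aa unit_diag_1 matrix_mul_lid)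
    moreover have "block1 g' = block1 g ** block1 s" "block2 g' = block2 g ** block2 s"
      unfolding s(2) using block_mult[OF K_off_zero[OF g(1)]] by blast+
    ultimately show ?R using a by metis
  next
    assume ?R
    then obtain a s t where a: "cmod a = 1" and s: "s \<in> block_unitary_group {2..CARD('k)}"
      and t: "t \<in> block_unitary_group {1..CARD('l) - 1}"
      and e: "block1 g' = block1 g ** (unit_diag 1 a ** s)" "block2 g' = block2 g ** (unit_diag CARD('l) a ** t)"
      by blast
    define h where "h = join (unit_diag 1 a ** s, unit_diag CARD('l) a ** t)"
    have g': "g' = g ** h"
      using join_block[OF K_off_zero[OF g(2)]] join_block[OF K_off_zero[OF g(1)]]
      unfolding h_def e by (metis fst_conv join_mult snd_conv)
    \<comment> \<open>Determinant one is obtained here: \<open>h\<close> is a quotient of two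
      elements of \<open>K CARD('k)\<close>.\<close>
    then have "h = conj_transpose g ** g'"
      by (simp add: unitary_cancel[OF K_D(2)[OF g(1)]])
    then have hK: "h \<in> K CARD('k)" using g by (simp add: K_mult K_conj_transpose)
    have sc: "s $ i $ p' = (if i = p' then 1 else 0)" for i
      using block_unitary_groupD(2)[OF s, of i p'] pJ by (simp add: mat_def)
    have tc: "t $ j $ q' = (if j = q' then 1 else 0)" for j
      using block_unitary_groupD(2)[OF t, of j q'] qJ by (simp add: mat_def)
    have "h $ i $ p = (if i = p then a else 0) \<and> h $ i $ q = (if i = q then a else 0)" for i
      by (cases i rule: index_cases)
        (simp_all add: h_def pq'[symmetric] unit_diag_eq diag_mat_mult sc tc p1 q1 del: One_nat_def)
    then have "h \<in> K CARD('k) \<inter> H c" unfolding iff using hK by blast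
    then show ?L using g' by blast
  qed
  then show ?thesis
    unfolding left_coset_eq_iff[OF sub] blocks_def circle_orbit_coset_eq_iff .
qed

text \<open>
  Right multiplication by \<open>diag(a, 1, \<dots>, 1, a)\<close> moves a pair of unitary blocks along its circle orbit and
  multiplies the determinant by \<open>a\<^sup>2\<close>, so a local square root of the determinant gives a local section.
\<close>

lemma local_section:
  assumes y: "y \<in> unitary_group \<times> unitary_group"
  shows "\<exists>W R. y \<in> W \<and> smooth_map W R \<and> R ` (W \<inter> unitary_group \<times> unitary_group) \<subseteq> K CARD('k) \<and>
    (\<forall>z \<in> W \<inter> unitary_group \<times> unitary_group.
      orbit_of (blocks (R z)) = orbit_of z)"
proof -
  define d where "d z = det (join z)" for z
  \<comment> \<open>Equal to \<open>1\<close> at \<open>y\<close>, hence away from \<open>-1\<close>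
    nearby, where \<open>unit_sqrt\<close> is smooth. The constant root in \<open>a\<close> corrects
    this normalization, so that \<open>(a z)\<^sup>2 = cnj (d z)\<close> for unitary blocks.\<close>
  define w where "w z = cnj (d z) * d y" for z
  define a where "a z = csqrt (cnj (d y)) * unit_sqrt (w z)" for z
  define R where "R z = join z ** ends_diag (a z)" for z
  define W where "W = UNIV \<inter> w -` (- {- 1})"
  have sw: "smooth_map UNIV w"
    unfolding w_def d_def
    by (intro smooth_map_mult smooth_map_cnj smooth_map_const smooth_map_det
        smooth_map_bounded_linear[OF bounded_linear_join] open_UNIV)
  have W: "open W" unfolding W_def by (rule smooth_map_open_vimage[OF sw]) auto
  have d: "cmod (d z) = 1" if "z \<in> unitary_group \<times> unitary_group" for z
    using that join_unitary unfolding d_def by (cases z) (auto intro: unitary_det_norm)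
  then have dd: "cnj (d z) * d z = 1" if "z \<in> unitary_group \<times> unitary_group" for z
    using that complex_norm_square[of "d z"] by (simp add: mult.commute)
  have "w y = 1" unfolding w_def by (rule dd[OF y])
  then have "y \<in> W" unfolding W_def by simp
  moreover have "smooth_map W R"
  proof -
    have a: "smooth_map W a" unfolding a_def
      by (intro smooth_map_mult smooth_map_const smooth_map_unit_sqrt smooth_map_mono[OF sw] W) (auto simp: W_def)
    have "smooth_map W (\<lambda>z. diag_mat (\<lambda>i. if i = p \<or> i = q then a z else 1))"
    proof (rule smooth_map_cmat[OF W])
      show "smooth_map W (\<lambda>z. diag_mat (\<lambda>i. if i = p \<or> i = q then a z else 1) $ i $ j)" for i j
        using a W by (cases "i = j"; cases "i = p \<or> i = q") (simp_all add: diag_mat_nth smooth_map_const)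
    qed
    then show ?thesis unfolding R_def ends_diag_def
      by (rule smooth_map_matrix_mult[OF smooth_map_bounded_linear[OF bounded_linear_join W]])
  qed
  moreover have main: "R z \<in> K CARD('k) \<and> orbit_of (blocks (R z)) = orbit_of z"
    if z: "z \<in> W" "z \<in> unitary_group \<times> unitary_group" for z
  proof -
    have w: "cmod (w z) = 1" "w z \<noteq> - 1"
      using d[OF z(2)] d[OF y] z(1) by (auto simp: w_def W_def norm_mult)
    have "(cmod (csqrt (cnj (d y))))\<^sup>2 = cmod ((csqrt (cnj (d y)))\<^sup>2)"
      by (simp add: norm_power)
    then have "cmod (csqrt (cnj (d y))) = 1"
      using d[OF y] norm_ge_zero[of "csqrt (cnj (d y))"] by (simp add: power2_eq_1_iff)
    then have a1: "cmod (a z) = 1" using unit_sqrt(2)[OF w] by (simp add: a_def norm_mult)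
    have "(a z)\<^sup>2 = cnj (d y) * (cnj (d z) * d y)"
      using unit_sqrt(1)[OF w] by (simp add: a_def power_mult_distrib w_def)
    also have "\<dots> = cnj (d z)" using dd[OF y] by (simp add: mult_ac)
    finally have a2: "(a z)\<^sup>2 = cnj (d z)" .
    obtain A B where AB: "z = (A, B)" "A \<in> unitary_group" "B \<in> unitary_group" using z(2) by blast
    have Rz: "R z = join (A ** unit_diag 1 (a z), B ** unit_diag CARD('l) (a z))"
      unfolding R_def join_unit_diag[symmetric] join_mult AB(1) by simp
    have "det (R z) = 1" unfolding R_def det_mul det_ends_diag a2 d_def[symmetric]
      using dd[OF z(2)] by (simp add: mult.commute)
    then have "R z \<in> K CARD('k)"
      unfolding Rz using AB a1 by (intro join_K unitary_mult unit_diag_unitary) auto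
    moreover have "orbit_of (A, B) = orbit_of (blocks (R z))"
      unfolding Rz blocks_def block_join fst_conv snd_conv circle_orbit_coset_eq_iff
      using a1 by (intro exI[of _ "a z"] exI[of _ "mat 1"]) (simp add: mat_1_block_unitary_group)
    ultimately show ?thesis using AB(1) by simp
  qed
  ultimately show ?thesis by (intro exI[of _ W] exI[of _ R]) blast
qed

lemma K_mod_H_diffeomorphic:
  assumes c: "0 < c" "c < 1"
  shows "poisson_diffeomorphic
    (homogeneous_space (K CARD('k)) (K CARD('k) \<inter> H c) :: ('n cmat, _) pman)
    (sphere_product_mod_circle :: ('k cmat \<times> 'l cmat, _) pman)"
proof -
  have k: "1 \<le> CARD('k)" "CARD('k) < CARD('n)"
    using zero_less_card_finite[where 'a = 'k] zero_less_card_finite[where 'a = 'l] unfolding card by linarith+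
  show ?thesis
  proof (rule poisson_diffeomorphicI[OF presents_K_mod_H[OF c k] presents_sphere_product_mod_circle, where T = blocks],
      unfold homogeneous_space_sel sphere_product_sel o_def)
    show "smooth_map UNIV blocks" by (intro smooth_map_bounded_linear bounded_linear_blocks open_UNIV)
    show "blocks ` K CARD('k) \<subseteq> unitary_group \<times> unitary_group" using blocks_unitary by blast
  next
    fix g g' :: "'n cmat" assume "g \<in> K CARD('k)" "g' \<in> K CARD('k)"
    then show "left_coset (K CARD('k) \<inter> H c) g = left_coset (K CARD('k) \<inter> H c) g' \<longleftrightarrow>
      orbit_of (blocks g) = orbit_of (blocks g')"
      by (rule coset_iff_orbit[OF c])
  next
    fix y :: "'k cmat \<times> 'l cmat" assume "y \<in> unitary_group \<times> unitary_group"
    then show "\<exists>W R. y \<in> W \<and> smooth_map W R \<and> R ` (W \<inter> unitary_group \<times> unitary_group) \<subseteq> K CARD('k) \<and>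
      (\<forall>z \<in> W \<inter> unitary_group \<times> unitary_group.
        orbit_of (blocks (R z)) = orbit_of z)"
      by (rule local_section)
  next
    fix g W and F G :: "'k cmat \<times> 'l cmat \<Rightarrow> real"
    assume "g \<in> K CARD('k)" "blocks g \<in> W" "smooth_on W F" "smooth_on W G"
    then show "std_bivector g (\<lambda>z. F (blocks z)) (\<lambda>z. G (blocks z)) =
        product_bivector std_bivector std_bivector (blocks g) F G"
      using smooth_on_differentiable by (intro std_bivector_blocks K_off_zero) blast+
  qed
qed

end

section \<open>The case \<open>k = 1\<close>\<close>

lemma idx_unit: "idx (u :: unit) = 1"
  by (simp add: idx_def)

text \<open>\<open>\<tau>\<close> allows for both models of the sphere: the identity for
  \<open>sphere_last\<close>, which is the second factor itself, and \<open>flip\<close> for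
  \<open>sphere_first\<close>. The sphere is embedded as the slice with first component
  \<open>mat 1\<close>.\<close>

lemma sphere_diffeomorphic_sphere_product:
  fixes \<tau> :: "'l::{finite,linorder} cmat \<Rightarrow> 'l cmat" and S :: "'l cmat set"
  assumes \<tau>: "bounded_linear \<tau>" "\<And>x. \<tau> (\<tau> x) = x" "\<And>x y. \<tau> (x ** y) = \<tau> x ** \<tau> y"
      "\<And>x. x \<in> unitary_group \<Longrightarrow> \<tau> x \<in> unitary_group"
    and S: "matrix_subgroup S" "\<And>s. \<tau> s \<in> block_unitary_group {1..CARD('l) - 1} \<longleftrightarrow> s \<in> S"
    and pres: "presents (homogeneous_space unitary_group S) std_bivector"
    and bracket: "\<And>x F G. F differentiable (at (\<tau> x)) \<Longrightarrow> G differentiable (at (\<tau> x)) \<Longrightarrow>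
      std_bivector x (\<lambda>z. F (\<tau> z)) (\<lambda>z. G (\<tau> z)) = std_bivector (\<tau> x) F G"
  shows "poisson_diffeomorphic (homogeneous_space unitary_group S)
    (sphere_product_mod_circle :: (unit cmat \<times> 'l cmat, _) pman)"
proof -
  \<comment> \<open>Over \<open>unit\<close> the sphere subgroup is trivial, so a circle element
    fixing the first component is \<open>1\<close>, and an orbit meets the slice in at most one
    point.\<close>
  have 1: "(mat 1 :: unit cmat) ** (unit_diag 1 a ** s) = mat 1 \<longleftrightarrow> a = 1"
    if "s \<in> block_unitary_group {2..CARD(unit)}" for a s
  proof -
    have "s = mat 1" using block_unitary_groupD(2)[OF that] by (simp add: vec_eq_iff idx_unit)
    then have "mat 1 ** (unit_diag 1 a ** s) = unit_diag 1 a" by simp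
    then show ?thesis by (simp add: vec_eq_iff unit_diag_def idx_unit mat_def)
  qed
  show ?thesis
  proof (rule poisson_diffeomorphicI[OF pres presents_sphere_product_mod_circle, where T = "\<lambda>B. (mat 1, \<tau> B)"],
      unfold homogeneous_space_sel sphere_product_sel o_def)
    have "smooth_map UNIV (\<lambda>B. (mat 1 :: unit cmat, 0) + (0, \<tau> B))"
      by (intro smooth_map_add smooth_map_const smooth_map_bounded_linear open_UNIV bounded_linear_Pair
          bounded_linear_zero \<tau>(1))
    then show "smooth_map UNIV (\<lambda>B. (mat 1 :: unit cmat, \<tau> B))" by simp
    show "(\<lambda>B. (mat 1, \<tau> B)) ` unitary_group \<subseteq> unitary_group \<times> unitary_group"
      using \<tau>(4) unitary_mat_1 by blast
  next
    fix B B' :: "'l cmat"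
    show "left_coset S B = left_coset S B' \<longleftrightarrow>
      orbit_of (mat 1 :: unit cmat, \<tau> B) = orbit_of (mat 1, \<tau> B')"
      unfolding left_coset_eq_iff[OF S(1)] circle_orbit_coset_eq_iff
    proof
      assume "\<exists>s\<in>S. B' = B ** s"
      then obtain s where s: "s \<in> S" "B' = B ** s" by blast
      have "\<tau> s \<in> block_unitary_group {1..CARD('l) - 1}" using S(2) s by blast
      moreover have "mat 1 \<in> block_unitary_group {2..CARD(unit)}" by (rule mat_1_block_unitary_group)
      ultimately show "\<exists>a s t. cmod a = 1 \<and> s \<in> block_unitary_group {2..CARD(unit)} \<and>
          t \<in> block_unitary_group {1..CARD('l) - 1} \<and>
          (mat 1 :: unit cmat) = mat 1 ** (unit_diag 1 a ** s) \<and> \<tau> B' = \<tau> B ** (unit_diag CARD('l) a ** t)"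
        by (intro exI[of _ 1] exI[of _ "mat 1"] exI[of _ "\<tau> s"]) (simp add: s(2) \<tau>(3) unit_diag_1)
    next
      assume "\<exists>a s t. cmod a = 1 \<and> s \<in> block_unitary_group {2..CARD(unit)} \<and>
          t \<in> block_unitary_group {1..CARD('l) - 1} \<and>
          (mat 1 :: unit cmat) = mat 1 ** (unit_diag 1 a ** s) \<and> \<tau> B' = \<tau> B ** (unit_diag CARD('l) a ** t)"
      then obtain a t and s :: "unit cmat" where s: "s \<in> block_unitary_group {2..CARD(unit)}" "mat 1 = mat 1 ** (unit_diag 1 a ** s)"
        and t: "t \<in> block_unitary_group {1..CARD('l) - 1}" "\<tau> B' = \<tau> B ** (unit_diag CARD('l) a ** t)" by blast
      have "a = 1" using 1[OF s(1)] s(2) by metis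
      then have "\<tau> (\<tau> B') = \<tau> (\<tau> B ** t)" unfolding t(2) by (simp add: unit_diag_1)
      then have "B' = B ** \<tau> t" by (simp add: \<tau>)
      moreover have "\<tau> t \<in> S" using S(2)[of "\<tau> t"] t(1) by (simp add: \<tau>(2))
      ultimately show "\<exists>s\<in>S. B' = B ** s" by blast
    qed
  next
    fix y :: "unit cmat \<times> 'l cmat" assume "y \<in> unitary_group \<times> unitary_group"
    \<comment> \<open>The circle element inverse to the single entry of the first component moves
      that component to \<open>mat 1\<close>. Writing the inverse as \<open>cnj\<close> makes the
      section smooth on all matrices.\<close>
    let ?R = "\<lambda>z::unit cmat \<times> 'l cmat. \<tau> (snd z ** unit_diag CARD('l) (cnj (fst z $ () $ ())))"
    have "smooth_map UNIV (\<lambda>z::unit cmat \<times> 'l cmat. cnj (fst z $ () $ ()))"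
      by (intro smooth_map_cnj smooth_map_entry smooth_map_bounded_linear bounded_linear_fst open_UNIV)
    then have "smooth_map UNIV (\<lambda>z::unit cmat \<times> 'l cmat. unit_diag CARD('l) (cnj (fst z $ () $ ())) $ i $ j)" for i j :: 'l
      by (cases "i = j"; cases "idx i = CARD('l)") (simp_all add: unit_diag_def smooth_map_const)
    then have smooth: "smooth_map UNIV ?R"
      by (intro smooth_map_compose_linear[OF \<tau>(1)]
          smooth_map_matrix_mult[OF smooth_map_bounded_linear[OF bounded_linear_snd open_UNIV]]
          smooth_map_cmat[OF open_UNIV])
    have main: "?R z \<in> unitary_group \<and> orbit_of (mat 1 :: unit cmat, \<tau> (?R z)) = orbit_of z"
      if z: "z \<in> unitary_group \<times> unitary_group" for z :: "unit cmat \<times> 'l cmat"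
    proof -
      obtain A B where AB: "z = (A, B)" "A \<in> unitary_group" "B \<in> unitary_group" using z by blast
      let ?a = "cnj (A $ () $ ())"
      have "(A ** conj_transpose A) $ () $ () = 1" using unitary_groupD(1)[OF AB(2)] by (simp add: mat_def)
      then have aa: "A $ () $ () * ?a = 1" by (simp add: matrix_matrix_mult_def UNIV_unit)
      then have a: "cmod ?a = 1" using unitary_column(1)[OF AB(2), of "()"] by simp
      have "mat 1 = A ** unit_diag 1 ?a"
        using aa by (simp add: vec_eq_iff unit_diag_eq mult_diag_mat idx_unit mat_def)
      then have "mat 1 = A ** (unit_diag 1 ?a ** mat 1)"
        unfolding matrix_mul_rid .
      moreover have "B ** unit_diag CARD('l) ?a = B ** (unit_diag CARD('l) ?a ** mat 1)" by simp
      ultimately have "orbit_of (A, B) =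
          orbit_of (mat 1, B ** unit_diag CARD('l) ?a)"
        unfolding circle_orbit_coset_eq_iff
        by (intro exI[of _ ?a] exI[of _ "mat 1"] conjI a mat_1_block_unitary_group)
      moreover have "?R z \<in> unitary_group"
        using AB a by (simp add: \<tau>(4) unitary_mult unit_diag_unitary)
      ultimately show ?thesis by (simp add: AB(1) \<tau>(2))
    qed
    show "\<exists>W R. y \<in> W \<and> smooth_map W R \<and> R ` (W \<inter> unitary_group \<times> unitary_group) \<subseteq> unitary_group \<and>
      (\<forall>z \<in> W \<inter> unitary_group \<times> unitary_group.
        orbit_of (mat 1 :: unit cmat, \<tau> (R z)) = orbit_of z)"
      using smooth main by (intro exI[of _ UNIV] exI[of _ ?R]) blast
  next
    fix B W and F G :: "unit cmat \<times> 'l cmat \<Rightarrow> real"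
    assume W: "(mat 1, \<tau> B) \<in> W" "open W" "smooth_on W F" "smooth_on W G"
    \<comment> \<open>A single index leaves no pairs, so the factor \<open>U(1)\<close> has zero
      bracket.\<close>
    have "std_bivector (mat 1 :: unit cmat) F' G' = 0" for F' G'
      unfolding std_bivector_eq by (simp add: case_prod_unfold)
    moreover have "(\<lambda>y. E (mat 1, y)) differentiable (at (\<tau> B))" if "smooth_on W E" for E :: "unit cmat \<times> 'l cmat \<Rightarrow> real"
      using W(1) by (intro smooth_on_differentiable[OF smooth_on_slice_right[OF that W(2)]]) simp
    ultimately show "std_bivector B (\<lambda>z. F (mat 1, \<tau> z)) (\<lambda>z. G (mat 1, \<tau> z)) =
        product_bivector std_bivector std_bivector (mat 1, \<tau> B) F G"
      using W(3,4) bracket[of "\<lambda>y. F (mat 1, y)" B "\<lambda>y. G (mat 1, y)"]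
      by (simp add: product_bivector_def)
  qed
qed

section \<open>An automorphism exchanging the two models of the odd sphere\<close>

definition reversal :: "'d::{finite,linorder} \<Rightarrow> 'd" where
  "reversal i = inv_into UNIV idx (CARD('d) + 1 - idx i)"

lemma idx_reversal: "idx (reversal (i::'d::{finite,linorder})) = CARD('d) + 1 - idx i"
proof -
  have "CARD('d) + 1 - idx i \<in> {1..CARD('d)}"
    using idx_pos(2,4)[of i] unfolding atLeastAtMost_iff by linarith
  then show ?thesis
    unfolding reversal_def by (intro f_inv_into_f) (simp only: bij_betw_imp_surj_on[OF bij_betw_idx])
qed

lemma reversal_reversal [simp]: "reversal (reversal i) = i"
proof -
  have "idx (reversal (reversal i)) = idx i"
    using idx_pos(4)[of i] unfolding idx_reversal by linarith
  then show ?thesis by simp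
qed

lemma reversal_eq_iff: "reversal i = j \<longleftrightarrow> i = reversal j"
  by (metis reversal_reversal)

lemma reversal_less_iff: "reversal i < reversal j \<longleftrightarrow> j < i"
  using idx_pos(4)[of i] idx_pos(4)[of j] unfolding idx_less_iff[symmetric] idx_reversal by linarith

lemma sum_reversal: "(\<Sum>i\<in>UNIV. f (reversal i)) = (\<Sum>i\<in>UNIV. f i)"
  by (rule sum.reindex_bij_witness[of _ reversal reversal]) auto

text \<open>
  Reversing the order of the basis and complex conjugation both change the sign of \<open>r\<close>, so together
  they give a Poisson automorphism of the unitary group. It exchanges the two kinds of odd spheres.
\<close>

definition flip :: "'d::{finite,linorder} cmat \<Rightarrow> 'd cmat" where
  "flip A = (\<chi> i j. cnj (A $ reversal i $ reversal j))"

lemma flip_nth: "flip A $ i $ j = cnj (A $ reversal i $ reversal j)"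
  by (simp add: flip_def)

lemma bounded_linear_flip: "bounded_linear flip"
  by (rule linear_conv_bounded_linear[THEN iffD1], rule linearI) (simp_all add: vec_eq_iff flip_nth)

lemma flip_flip: "flip (flip A) = A"
  by (simp add: vec_eq_iff flip_nth)

lemma flip_mult: "flip (A ** B) = flip A ** flip B"
proof -
  have "flip (A ** B) $ i $ j = (flip A ** flip B) $ i $ j" for i j
    using sum_reversal[of "\<lambda>m. cnj (A $ reversal i $ m) * cnj (B $ m $ reversal j)"]
    by (simp add: flip_nth matrix_matrix_mult_def)
  then show ?thesis by (simp add: vec_eq_iff)
qed

lemma flip_mat_1: "flip (mat 1) = mat 1"
  by (auto simp: vec_eq_iff flip_nth mat_def reversal_eq_iff)

lemma conj_transpose_flip: "conj_transpose (flip A) = flip (conj_transpose A)"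
  by (simp add: vec_eq_iff flip_nth)

lemma flip_unitary: "A \<in> unitary_group \<Longrightarrow> flip A \<in> unitary_group"
  by (intro unitary_groupI) (simp add: conj_transpose_flip flip_mult[symmetric] unitary_groupD flip_mat_1)

text \<open>The sign occurs in both arguments of each wedge and cancels there. Reversal swaps the
  smaller and the larger index, so the order \<open>reversal b\<close>, \<open>reversal a\<close>
  keeps the smaller one first and permutes the terms of \<open>r\<close>.\<close>

lemma flip_tangent_unit:
  assumes "a \<noteq> b"
  shows "flip (tangent_unit a b z) = - tangent_unit (reversal b) (reversal a) z"
proof -
  have swap: "cnj (if i = c \<and> j = d then z else if i = d \<and> j = c then - cnj z else 0) =
      - (if i = d \<and> j = c then z else if i = c \<and> j = d then - cnj z else 0)" if "c \<noteq> d" for c d i j :: 'a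
    using that by auto
  have "reversal a \<noteq> reversal b" using assms by (metis reversal_reversal)
  from swap[OF this]
  have "flip (tangent_unit a b z) $ i $ j = - (tangent_unit (reversal b) (reversal a) z $ i $ j)" for i j
    by (simp only: flip_nth tangent_unit_nth reversal_eq_iff)
  then show ?thesis by (simp add: vec_eq_iff)
qed

lemma flip_block_unitary_group:
  fixes s :: "'d::{finite,linorder} cmat"
  shows "flip s \<in> block_unitary_group {1..CARD('d) - 1} \<longleftrightarrow> s \<in> block_unitary_group {2..CARD('d)}"
proof -
  have J: "idx (reversal i) \<in> {1..CARD('d) - 1} \<longleftrightarrow> idx i \<in> {2..CARD('d)}" for i :: 'd
    using idx_pos(2,4)[of i] unfolding idx_reversal atLeastAtMost_iff by linarith
  have m: "(mat 1 :: 'd cmat) $ reversal i $ reversal j = cnj (mat 1 $ i $ j)" for i j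
  proof -
    have "reversal i = reversal j \<longleftrightarrow> i = j" by (metis reversal_reversal)
    then show ?thesis by (simp add: mat_def)
  qed
  have "(\<forall>i j. idx i \<notin> {1..CARD('d) - 1} \<or> idx j \<notin> {1..CARD('d) - 1} \<longrightarrow> flip s $ i $ j = mat 1 $ i $ j) \<longleftrightarrow>
    (\<forall>i j. idx i \<notin> {2..CARD('d)} \<or> idx j \<notin> {2..CARD('d)} \<longrightarrow> s $ i $ j = mat 1 $ i $ j)"
    (is "(\<forall>i j. ?P i j) \<longleftrightarrow> (\<forall>i j. ?Q i j)")
  proof -
    have PQ: "?P (reversal i) (reversal j) \<longleftrightarrow> ?Q i j" for i j
      unfolding J m flip_nth reversal_reversal complex_cnj_cancel_iff ..
    show ?thesis
    proof (intro iffI allI)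
      show "?Q i j" if "\<forall>i j. ?P i j" for i j
        using that[rule_format, of "reversal i" "reversal j"] PQ[of i j] by argo
      show "?P i j" if "\<forall>i j. ?Q i j" for i j
        using that[rule_format, of "reversal i" "reversal j"] PQ[of "reversal i" "reversal j"]
        unfolding reversal_reversal by argo
    qed
  qed
  then show ?thesis
    unfolding block_unitary_group_def using flip_unitary[of s] flip_unitary[of "flip s"] by (auto simp: flip_flip)
qed

lemma std_bivector_flip:
  fixes x :: "'d::{finite,linorder} cmat"
  assumes F: "F differentiable (at (flip x))" and G: "G differentiable (at (flip x))"
  shows "std_bivector x (\<lambda>z. F (flip z)) (\<lambda>z. G (flip z)) = std_bivector (flip x) F G"
proof -
  have D: "frechet_derivative (\<lambda>z. E (flip z)) (at x) V = frechet_derivative E (at (flip x)) (flip V)"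
    if "E differentiable (at (flip x))" for E V
    by (rule frechet_derivative_compose_linear[OF bounded_linear_flip that])
  have neg: "wedge_at (flip x) (- X) (- Y) F G = wedge_at (flip x) X Y F G" for X Y
    using linear_neg[OF linear_frechet_derivative[OF F]] linear_neg[OF linear_frechet_derivative[OF G]]
    by (simp add: wedge_at_def)
  have w: "wedge_at x X Y (\<lambda>z. F (flip z)) (\<lambda>z. G (flip z)) = wedge_at (flip x) (flip X) (flip Y) F G" for X Y
    by (simp add: wedge_at_def D[OF F] D[OF G])
  have mneg: "A ** (- B) = - (A ** B)" "(- A) ** B = - (A ** B)" for A B :: "'d cmat"
    by (simp_all add: vec_eq_iff matrix_matrix_mult_def sum_negf)
  show ?thesis
    unfolding std_bivector_eq w flip_mult
    by (rule sum.reindex_bij_witness[of _ "\<lambda>(a,b). (reversal b, reversal a)" "\<lambda>(a,b). (reversal b, reversal a)"])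
      (auto simp: reversal_less_iff flip_tangent_unit less_imp_neq mneg neg)
qed

lemma sphere_first_diffeomorphic:
  "poisson_diffeomorphic (sphere_first :: ('l::{finite,linorder} cmat, _) pman)
    (sphere_product_mod_circle :: (unit cmat \<times> 'l cmat, _) pman)"
  unfolding sphere_first_def
  by (rule sphere_diffeomorphic_sphere_product[OF bounded_linear_flip flip_flip flip_mult flip_unitary
        matrix_subgroup_block_unitary_group flip_block_unitary_group
        presents_sphere_first[unfolded sphere_first_def] std_bivector_flip])

lemma sphere_last_diffeomorphic:
  "poisson_diffeomorphic (sphere_last :: ('l::{finite,linorder} cmat, _) pman)
    (sphere_product_mod_circle :: (unit cmat \<times> 'l cmat, _) pman)"
  unfolding sphere_last_def
  by (rule sphere_diffeomorphic_sphere_product[where \<tau> = "\<lambda>x. x"])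
    (auto simp: matrix_subgroup_block_unitary_group presents_sphere_last[unfolded sphere_last_def, simplified])

section \<open>Composition of the diffeomorphisms\<close>

lemma bracket_local_homogeneous_space: "bracket_local (homogeneous_space G S)"
  unfolding homogeneous_space_def poisson_group_def
  by (intro bracket_local_quotient bracket_local_embedded)

lemma bracket_local_spheres: "bracket_local sphere_first" "bracket_local sphere_last"
  unfolding sphere_first_def sphere_last_def by (rule bracket_local_homogeneous_space)+

lemma homogeneous_space_diffeomorphic_sphere_product:
  fixes c :: real
  assumes c: "0 < c" "c < 1" and card: "CARD('n::{finite,linorder}) = CARD('k::{finite,linorder}) + CARD('l::{finite,linorder})"
  shows "poisson_diffeomorphic
    (homogeneous_space (K CARD('k)) (K CARD('k) \<inter> H c) :: ('n cmat, 'n cmat set) pman)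
    (sphere_product_mod_circle :: ('k cmat \<times> 'l cmat, ('k cmat set \<times> 'l cmat set) set) pman)"
proof -
  have pos: "1 \<le> CARD('k)" "1 \<le> CARD('l)"
    using zero_less_card_finite[where 'a = 'k] zero_less_card_finite[where 'a = 'l] by linarith+
  have surj: "\<exists>m::'n. idx m = i" if "1 \<le> i" "i \<le> CARD('n)" for i
    by (rule obtain_idx[OF that]) blast
  obtain p q :: 'n where p: "idx p = 1" and q: "idx q = CARD('n)"
    using surj[of 1] surj[of "CARD('n)"] pos card by fastforce
  \<comment> \<open>Indices are matched by their numbers, those of the second block shifted by
    \<open>CARD('k)\<close>; such indices exist because the cardinalities add up.\<close>
  define e1 :: "'k \<Rightarrow> 'n" where "e1 i = (SOME m. idx m = idx i)" for i
  define e2 :: "'l \<Rightarrow> 'n" where "e2 j = (SOME m. idx m = CARD('k) + idx j)" for j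
  have "idx (e1 i) = idx i" for i
    unfolding e1_def by (rule someI_ex) (use idx_pos(2,4)[of i] card in \<open>intro surj; linarith\<close>)
  moreover have "idx (e2 j) = CARD('k) + idx j" for j
    unfolding e2_def by (rule someI_ex) (use idx_pos(2,4)[of j] card in \<open>intro surj; linarith\<close>)
  moreover have "p \<noteq> q"
  proof
    assume "p = q"
    then have "CARD('n) = 1" using p q by simp
    then show False using pos card by linarith
  qed
  ultimately interpret two_blocks p q e1 e2
    using p q card by unfold_locales auto
  show ?thesis by (rule K_mod_H_diffeomorphic[OF c])
qed

theorem theorem10:
  fixes c :: real and k :: nat
  assumes "CARD('n::{finite,linorder}) \<ge> 2"
    and "0 < c" and "c < 1"
    and "1 \<le> k" and "k \<le> CARD('n) - 1"
  shows "(sigma c :: 'n cmat) \<in> special_unitary_group \<and>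
    (H c :: 'n cmat set) =
       {g \<in> special_unitary_group. \<exists>z. g *v line_vector c = z *s line_vector c} \<and>
    (K k \<inter> H c :: 'n cmat set) =
       {four_block_diag k a B1 B2 | a B1 B2.
          cmod a = 1 \<and> B1 \<in> block_unitary_group {2..k} \<and>
          B2 \<in> block_unitary_group {k + 1..CARD('n) - 1} \<and>
          a\<^sup>2 = inverse (det B1 * det B2)} \<and>
    (CARD('k::{finite,linorder}) = k \<and> CARD('l::{finite,linorder}) = CARD('n) - k \<longrightarrow>
       poisson_diffeomorphic
         (homogeneous_space (K k) (K k \<inter> H c) :: ('n cmat, 'n cmat set) pman)
         (sphere_product_mod_circle ::
            ('k cmat \<times> 'l cmat, ('k cmat set \<times> 'l cmat set) set) pman)) \<and>
    (k = 1 \<and> CARD('l) = CARD('n) - 1 \<longrightarrow>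
       poisson_diffeomorphic
         (homogeneous_space (K k) (K k \<inter> H c) :: ('n cmat, 'n cmat set) pman)
         (sphere_first :: ('l cmat, 'l cmat set) pman) \<and>
       poisson_diffeomorphic
         (homogeneous_space (K k) (K k \<inter> H c) :: ('n cmat, 'n cmat set) pman)
         (sphere_last :: ('l cmat, 'l cmat set) pman))"
proof (intro conjI impI)
  have k: "1 \<le> k" "k < CARD('n)" using assms by linarith+
  have "1 \<le> CARD('n)" using assms(1) by linarith
  obtain p :: 'n where p: "idx p = 1" using obtain_idx[OF order_refl \<open>1 \<le> CARD('n)\<close>] .
  obtain q :: 'n where q: "idx q = CARD('n)" using obtain_idx[OF \<open>1 \<le> CARD('n)\<close> order_refl] .
  interpret first_last p q
    using p q assms(1) by unfold_locales auto
  show "(sigma c :: 'n cmat) \<in> special_unitary_group"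
    using assms by (intro sigma_special_unitary) auto
  show "(H c :: 'n cmat set) =
      {g \<in> special_unitary_group. \<exists>z. g *v line_vector c = z *s line_vector c}"
    using assms by (intro H_eq) auto
  show "(K k \<inter> H c :: 'n cmat set) =
       {four_block_diag k a B1 B2 | a B1 B2.
          cmod a = 1 \<and> B1 \<in> block_unitary_group {2..k} \<and>
          B2 \<in> block_unitary_group {k + 1..CARD('n) - 1} \<and>
          a\<^sup>2 = inverse (det B1 * det B2)}"
    by (rule K_H_eq_four_block_diag[OF assms(2,3) k])
  show "poisson_diffeomorphic
      (homogeneous_space (K k) (K k \<inter> H c) :: ('n cmat, 'n cmat set) pman)
      (sphere_product_mod_circle :: ('k cmat \<times> 'l cmat, ('k cmat set \<times> 'l cmat set) set) pman)"
    if card: "CARD('k) = k \<and> CARD('l) = CARD('n) - k"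
  proof -
    have "CARD('n) = CARD('k) + CARD('l)" using card k by linarith
    from homogeneous_space_diffeomorphic_sphere_product[OF assms(2,3) this] card
    show ?thesis by simp
  qed
  assume card: "k = 1 \<and> CARD('l) = CARD('n) - 1"
  \<comment> \<open>\<open>unit\<close> serves as the index type of the first block; the spheres are
    reached through the product model over it.\<close>
  then have "CARD('n) = CARD(unit) + CARD('l)" using k by simp
  from homogeneous_space_diffeomorphic_sphere_product[OF assms(2,3) this] card
  have M: "poisson_diffeomorphic
      (homogeneous_space (K k) (K k \<inter> H c) :: ('n cmat, 'n cmat set) pman)
      (sphere_product_mod_circle :: (unit cmat \<times> 'l cmat, _) pman)"
    by simp
  \<comment> \<open>The available map goes from the sphere to the product model and has to be
    inverted, which uses locality of the bracket on the sphere.\<close>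
  show "poisson_diffeomorphic
      (homogeneous_space (K k) (K k \<inter> H c) :: ('n cmat, 'n cmat set) pman)
      (sphere_first :: ('l cmat, 'l cmat set) pman)"
    by (rule poisson_diffeomorphic_trans[OF M
          poisson_diffeomorphic_sym[OF bracket_local_spheres(1) sphere_first_diffeomorphic]])
  show "poisson_diffeomorphic
      (homogeneous_space (K k) (K k \<inter> H c) :: ('n cmat, 'n cmat set) pman)
      (sphere_last :: ('l cmat, 'l cmat set) pman)"
    by (rule poisson_diffeomorphic_trans[OF M
          poisson_diffeomorphic_sym[OF bracket_local_spheres(2) sphere_last_diffeomorphic]])
qed

end
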